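(* Assume the Riemann Hypothesis. Let $\gamma_1 \neq \gamma_2$ be two simple (real) zeros of Hardy's $Z$-function. Define \[ \bar{g}_{\{\gamma_1,\gamma_2\}} = (\gamma_1-\gamma_2)^2 \sum_{\gamma\notin\{\gamma_1,\gamma_2\}} \left(\frac{1}{(\gamma-\gamma_1)^2}+\frac{1}{(\gamma-\gamma_2)^2}\right), \] where $\gamma$ runs over all zeros of $Z$ (counted with multiplicity), and \[ \hat{g}_{\{\gamma_1,\gamma_2\}} = \frac{1}{3}(\gamma_1-\gamma_2)^2\left(\widehat{F}(\gamma_1)+\widehat{F}(\gamma_2)\right) - 2, \qquad \widehat{F}(t) = -\frac{Z'''(t)}{Z'(t)} + \frac{3}{4}\left(\frac{Z''(t)}{Z'(t)}\right)^2. \] Then \[ 0 < \bar{g}_{\{\gamma_1,\gamma_2\}} - \hat{g}_{\{\gamma_1,\gamma_2\}} < 3(\gamma_1-\gamma_2)^2\left(\frac{1}{\gamma_1^2}+\frac{1}{\gamma_2^2}\right) < 3\,\hat{g}_{\{\gamma_1,\gamma_2\}}. \]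
   Context: Hardy's $Z$-function is $Z(t) = e^{i\vartheta(t)}\zeta(\tfrac12 + it)$, where $\vartheta(t) = \frac{1}{2i}\log\frac{\Gamma(\frac14 + i\frac t2)}{\Gamma(\frac14 - i\frac t2)} - \frac{\log \pi}{2} t$; it is real for real $t$ and holomorphic in a neighborhood of the real axis. Under the Riemann Hypothesis its zeros are exactly the (real) ordinates $\gamma$ of the nontrivial zeros $\tfrac12+i\gamma$ of the Riemann zeta function. *)

theory Defs
  imports "HOL-Complex_Analysis.Complex_Analysis"
begin

text \<open>The Riemann zeta function is the unique analytic continuation of the Dirichlet series to
  the plane without \<open>1\<close>. The value at the pole is fixed to \<open>0\<close>
  only to make the function unique.\<close>

definition zeta :: "complex \<Rightarrow> complex" where
  "zeta = (THE f. f holomorphic_on (- {1}) \<and> f 1 = 0 \<and>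
             (\<forall>s. Re s > 1 \<longrightarrow> (\<lambda>n. of_nat (Suc n) powr (- s)) sums f s))"

definition nontrivial_zeta_zero :: "complex \<Rightarrow> bool" where
  "nontrivial_zeta_zero s \<longleftrightarrow>
     s \<noteq> 1 \<and> zeta s = 0 \<and> (\<forall>n::nat. n \<ge> 1 \<longrightarrow> s \<noteq> - 2 * of_nat n)"

definition Riemann_Hypothesis :: bool where
  "Riemann_Hypothesis \<longleftrightarrow> (\<forall>s. nontrivial_zeta_zero s \<longrightarrow> Re s = 1 / 2)"

text \<open>The logarithm of the Gamma quotient is the branch that is holomorphic on the strip
  \<open>\<bar>Im t\<bar> < 1 / 2\<close> and vanishes at \<open>t = 0\<close>, that is,
  the difference of the holomorphic log-Gamma functions.
  The principal logarithm of the quotient would make \<open>hardy_theta\<close> jump on the real axis.\<close>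

definition hardy_theta :: "complex \<Rightarrow> complex" where
  "hardy_theta t =
     (ln_Gamma (1 / 4 + \<i> * t / 2) - ln_Gamma (1 / 4 - \<i> * t / 2)) / (2 * \<i>)
       - of_real (ln pi) / 2 * t"

definition hardy_Z :: "complex \<Rightarrow> complex" where
  "hardy_Z t = exp (\<i> * hardy_theta t) * zeta (1 / 2 + \<i> * t)"

definition Z_zeros :: "real set" where
  "Z_zeros = {\<gamma>. hardy_Z (of_real \<gamma>) = 0}"

definition Z_mult :: "real \<Rightarrow> int" where
  "Z_mult \<gamma> = zorder hardy_Z (of_real \<gamma>)"

definition simple_Z_zero :: "real \<Rightarrow> bool" where
  "simple_Z_zero \<gamma> \<longleftrightarrow> \<gamma> \<in> Z_zeros \<and> Z_mult \<gamma> = 1"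

text \<open>\<open>hardy_Z\<close> and its derivatives are real on the real axis, so \<open>Re\<close> only
  changes the type.\<close>

definition F_hat :: "real \<Rightarrow> real" where
  "F_hat t = Re (let z = complex_of_real t in
      - ((deriv ^^ 3) hardy_Z z / deriv hardy_Z z)
      + 3 / 4 * ((deriv ^^ 2) hardy_Z z / deriv hardy_Z z)\<^sup>2)"

definition g_bar :: "real \<Rightarrow> real \<Rightarrow> real" where
  "g_bar \<gamma>\<^sub>1 \<gamma>\<^sub>2 = (\<gamma>\<^sub>1 - \<gamma>\<^sub>2)\<^sup>2 *
     (\<Sum>\<^sub>\<infinity>\<gamma>\<in>Z_zeros - {\<gamma>\<^sub>1, \<gamma>\<^sub>2}.
        of_int (Z_mult \<gamma>) * (1 / (\<gamma> - \<gamma>\<^sub>1)\<^sup>2 + 1 / (\<gamma> - \<gamma>\<^sub>2)\<^sup>2))"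

definition g_hat :: "real \<Rightarrow> real \<Rightarrow> real" where
  "g_hat \<gamma>\<^sub>1 \<gamma>\<^sub>2 = 1 / 3 * (\<gamma>\<^sub>1 - \<gamma>\<^sub>2)\<^sup>2 * (F_hat \<gamma>\<^sub>1 + F_hat \<gamma>\<^sub>2) - 2"

end

theory Submission
  imports Defs "HOL-Real_Asymp.Real_Asymp"
begin

text \<open>
  Let \<open>\<xi>\<close> be normalised by \<open>\<xi>(s) = s (s - 1) pi powr (- s/2) \<Gamma>(s/2) \<zeta>(s)\<close>. By the functional equation
  \<open>\<xi>(s) = K(s (s - 1))\<close> for an entire function \<open>K\<close> of order \<open>1/2\<close> with \<open>K(0) = 1\<close>; under the Riemann
  Hypothesis the zeros of \<open>K\<close> are the numbers \<open>- (\<gamma>\<^sup>2 + 1/4)\<close>, and Hadamard's argument gives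
  \<open>K(w) = \<Prod> (1 + w / (\<gamma>\<^sup>2 + 1/4))\<close>, the product running over \<open>\<gamma> > 0\<close>. On the real axis \<open>Z(t) = K(- t\<^sup>2 - 1/4) / B(t)\<close> with an explicit
  zero-free \<open>B\<close> built from the Gamma function. If \<open>Z(t) = (t - \<gamma>\<^sub>1) k(t)\<close>, then
  \<open>F_hat(\<gamma>\<^sub>1)\<close> equals \<open>- 3 (log k)''(\<gamma>\<^sub>1)\<close>, which by the product formula is
  \<open>3 \<Sum> 1 / (\<gamma> - \<gamma>\<^sub>1)\<^sup>2 + 3 (log B)''(\<gamma>\<^sub>1)\<close>. Hence the difference in the theorem is
  \<open>- (\<gamma>\<^sub>1 - \<gamma>\<^sub>2)\<^sup>2 ((log B)''(\<gamma>\<^sub>1) + (log B)''(\<gamma>\<^sub>2))\<close>, and \<open>- (log B)''(t)\<close> is about \<open>7 / (4 t\<^sup>2)\<close>.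

  The last inequality needs that there are no zeros close to \<open>0\<close> and sufficiently many zeros at
  height comparable to \<open>\<gamma>\<^sub>1\<close>. Both follow by comparing the product formula with the values of
  \<open>\<xi>\<close> at even integers: \<open>\<xi>(2)\<close> and \<open>\<xi>(4)\<close> force \<open>\<gamma>\<^sup>2 + 1/4 > 265/2\<close> for every zero, and
  \<open>\<xi>(12)\<close> and \<open>\<xi>(14)\<close> bound \<open>\<Sum> 1 / (\<gamma>\<^sup>2 + 529/4)\<close> from below.
\<close>

section \<open>The functional equation of the theta function\<close>

text \<open>The last inequality is a budget. The Gamma factor may consume up to 2 (1/g1^2 + 1/g2^2),
  where g1 and g2 are the two given zeros, so the sum over the other zeros has to supply 3 (1/g1^2 +
  1/g2^2). The bound must hold however far apart the zeros lie; therefore each pair of zeros r, -r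
  is replaced by its guaranteed contribution 2 / (r^2 + x^2) at x = g1 or x = g2. Over all pairs
  this exceeds 5 / x^2; taking away the pairs of g1 and g2 themselves and adding the bounds at both
  zeros leaves the required 3. The number 529/4 has two roles. It is 132 + 1/4 with 132 = 12 * 11,
  so the value at s = 12 concerns the sum of 1 / (r^2 + 529/4); and it is the lower bound for x^2
  obtained from s = 2 and s = 4, which allows that sum to be compared with the sum of 1 / (r^2 +
  x^2). The Riemann Hypothesis makes every zero of K a negative real number. At positive arguments
  all factors of the product then exceed 1, and products can be compared factor by factor.\<close>

lemma two_cos_power_even:
  fixes \<alpha> :: real
  shows "(2 * cos \<alpha>) ^ (2 * m) =
    real (2 * m choose m) + 2 * (\<Sum>d=1..m. real (2 * m choose (m + d)) * cos (2 * real d * \<alpha>))"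
proof -
  let ?g = "\<lambda>k. real (2 * m choose k) * cos (2 * (real k - real m) * \<alpha>)"
  have "complex_of_real ((2 * cos \<alpha>) ^ (2 * m)) = (cis \<alpha> + cis (- \<alpha>)) ^ (2 * m)"
    by (simp add: complex_eq_iff cis.ctr Complex_eq)
  also have "\<dots> = (\<Sum>k\<le>2 * m. of_nat (2 * m choose k) * cis \<alpha> ^ k * cis (- \<alpha>) ^ (2 * m - k))"
    by (rule binomial_ring)
  also have "\<dots> = (\<Sum>k\<le>2 * m. of_nat (2 * m choose k) * cis (2 * (real k - real m) * \<alpha>))"
    by (intro sum.cong refl) (auto simp: Complex.DeMoivre cis_mult of_nat_diff algebra_simps)
  finally have "Re (complex_of_real ((2 * cos \<alpha>) ^ (2 * m))) = 
      Re (\<Sum>k\<le>2 * m. of_nat (2 * m choose k) * cis (2 * (real k - real m) * \<alpha>))" by simp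
  hence 1: "(2 * cos \<alpha>) ^ (2 * m) = sum ?g {..2*m}" by (simp only: Re_complex_of_real Re_sum) simp
  \<comment> \<open>The indices m - d and m + d have equal binomial coefficients and, the cosine
    being even, equal terms; this gives the factor 2.\<close>
  have "{..2*m} = ({..<m} \<union> {m}) \<union> {m<..2*m}" by auto
  hence "sum ?g {..2*m} = sum ?g {..<m} + ?g m + sum ?g {m<..2*m}"
    by (simp only:) (subst sum.union_disjoint; force)+
  also have "sum ?g {..<m} = (\<Sum>d=1..m. real (2 * m choose (m + d)) * cos (2 * real d * \<alpha>))"
  proof (rule sum.reindex_bij_witness[of _ "\<lambda>d. m - d" "\<lambda>k. m - k"])
    fix k assume "k \<in> {..<m}"
    hence k: "k < m" by simp
    have "(2 * m choose k) = (2 * m choose (2 * m - k))" using k by (intro binomial_symmetric) simp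
    also have "2 * m - k = m + (m - k)" using k by simp
    finally show "real (2 * m choose (m + (m - k))) * cos (2 * real (m - k) * \<alpha>) = ?g k"
      using k cos_minus[of "2 * (real k - real m) * \<alpha>"] by (simp add: of_nat_diff algebra_simps)
  qed auto
  also have "sum ?g {m<..2*m} = (\<Sum>d=1..m. real (2 * m choose (m + d)) * cos (2 * real d * \<alpha>))"
    by (rule sum.reindex_bij_witness[of _ "\<lambda>d. m + d" "\<lambda>k. k - m"]) (auto simp: of_nat_diff)
  finally show ?thesis using 1 by simp
qed

text \<open>Real part of a geometric sum over the powers of an \<open>l\<close>-th root of unity. It
  selects the frequencies divisible by \<open>l\<close> from the expansion above.\<close>

lemma sum_cos_roots:
  assumes "l > 0"
  shows "(\<Sum>j<l. cos (2 * real d * (pi * real j / real l))) = (if l dvd d then real l else 0)"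
proof -
  let ?z = "cis (2 * pi * real d / real l)"
  have 1: "?z ^ j = cis (2 * real d * (pi * real j / real l))" for j
    by (simp add: Complex.DeMoivre algebra_simps)
  have 2: "?z ^ l = 1"
  proof -
    have "?z ^ l = cis (2 * pi * real d)" using assms by (simp add: Complex.DeMoivre)
    also have "\<dots> = 1" using cis_multiple_2pi[of "real d"] by (simp add: mult_ac)
    finally show ?thesis .
  qed
  have 3: "?z = 1 \<longleftrightarrow> l dvd d"
  proof
    assume "l dvd d"
    then obtain q where "d = l * q" by blast
    thus "?z = 1" using assms cis_multiple_2pi[of "real q"] by (simp add: mult_ac)
  next
    assume "?z = 1"
    hence "cos (2 * pi * real d / real l) = 1" by (simp add: complex_eq_iff)
    then obtain x :: int where "2 * pi * real d / real l = of_int x * 2 * pi"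
      using cos_one_2pi_int by blast
    hence "real d = of_int x * real l" using assms by (simp add: field_simps)
    hence "real_of_int (int d) = real_of_int (x * int l)" by simp
    hence "int d = x * int l" by (simp only: of_int_eq_iff)
    hence "int l dvd int d" by simp
    thus "l dvd d" by simp
  qed
  have "(\<Sum>j<l. cos (2 * real d * (pi * real j / real l))) = Re (\<Sum>j<l. ?z ^ j)"
    by (simp add: 1)
  also have "(\<Sum>j<l. ?z ^ j) = (if l dvd d then of_nat l else 0)"
  proof (cases "l dvd d")
    case False
    thus ?thesis using 3 2 geometric_sum[of ?z l] by simp
  qed (use 3 in simp)
  finally show ?thesis by simp
qed

text \<open>
  Polya's proof of the theta inversion: summing the binomial expansion of
  \<open>(2 cos (\<pi> j / l)) ^ (2 * m)\<close> over \<open>j < l\<close> keeps only every \<open>l\<close>-th binomial coefficient. For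
  \<open>m = \<lfloor>c * l ^ 2\<rfloor>\<close> and \<open>l \<rightarrow> \<infinity>\<close> both sides tend to theta series.
\<close>

lemma polya_finite_identity:
  fixes p m :: nat
  defines "l \<equiv> 2 * p + 1"
  shows "1 + 2 * (\<Sum>j=1..p. cos (pi * real j / real l) ^ (2 * m)) =
    real l * real (2 * m choose m) / 4 ^ m *
     (1 + 2 * (\<Sum>n. real (2 * m choose (m + Suc n * l)) / real (2 * m choose m)))"
proof -
  have l: "l > 0" by (simp add: l_def)
  let ?C = "real (2 * m choose m)"
  have C: "?C > 0" by simp
  have "(\<Sum>j<l. (2 * cos (pi * real j / real l)) ^ (2 * m)) =
     (\<Sum>j<l. ?C + 2 * (\<Sum>d=1..m. real (2 * m choose (m + d)) * cos (2 * real d * (pi * real j / real l))))"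
    by (simp only: two_cos_power_even)
  also have "\<dots> = real l * ?C + 2 * (\<Sum>j<l. \<Sum>d=1..m. real (2 * m choose (m + d)) * cos (2 * real d * (pi * real j / real l)))"
    by (simp add: sum.distrib sum_distrib_left)
  also have "(\<Sum>j<l. \<Sum>d=1..m. real (2 * m choose (m + d)) * cos (2 * real d * (pi * real j / real l)))
     = (\<Sum>d=1..m. real (2 * m choose (m + d)) * (\<Sum>j<l. cos (2 * real d * (pi * real j / real l))))"
    by (subst sum.swap) (simp add: sum_distrib_left)
  also have "\<dots> = (\<Sum>d=1..m. real (2 * m choose (m + d)) * (if l dvd d then real l else 0))"
    using l by (simp only: sum_cos_roots)
  also have "\<dots> = real l * (\<Sum>d | d \<in> {1..m} \<and> l dvd d. real (2 * m choose (m + d)))"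
  proof -
    have "{d. d \<in> {1..m} \<and> l dvd d} = {1..m} \<inter> {d. l dvd d}" by auto
    thus ?thesis by (simp add: sum.inter_restrict sum_distrib_left mult_ac if_distrib cong: if_cong)
  qed
  also have "(\<Sum>d | d \<in> {1..m} \<and> l dvd d. real (2 * m choose (m + d))) =
     (\<Sum>n\<in>{n. Suc n * l \<le> m}. real (2 * m choose (m + Suc n * l)))"
  proof (rule sum.reindex_bij_witness[of _ "\<lambda>n. Suc n * l" "\<lambda>d. d div l - 1"])
    fix d assume "d \<in> {d \<in> {1..m}. l dvd d}"
    then obtain q where q: "d = l * q" "q \<ge> 1" "d \<le> m" by (auto elim!: dvdE simp: Suc_le_eq)
    thus "Suc (d div l - 1) * l = d" using l by (cases q) auto
    thus "d div l - 1 \<in> {n. Suc n * l \<le> m}" using q by simp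
    show "real (2 * m choose (m + Suc (d div l - 1) * l)) = real (2 * m choose (m + d))"
      by (simp only: \<open>Suc (d div l - 1) * l = d\<close>)
  qed (use l in auto)
  \<comment> \<open>All further coefficients vanish. The infinite form has an index set independent
    of \<open>m\<close> and \<open>l\<close>, as dominated convergence will require.\<close>
  also have "\<dots> = (\<Sum>n. real (2 * m choose (m + Suc n * l)))"
  proof (rule suminf_finite[symmetric])
    have "n \<le> m" if "Suc n * l \<le> m" for n
    proof -
      have "Suc n * 1 \<le> Suc n * l" using l by (intro mult_le_mono) auto
      thus ?thesis using that by simp
    qed
    hence "{n. Suc n * l \<le> m} \<subseteq> {..m}" by auto
    thus "finite {n. Suc n * l \<le> m}" using finite_subset by blast
  qed (auto intro!: binomial_eq_0)
  also have "\<dots> = ?C * (\<Sum>n. real (2 * m choose (m + Suc n * l)) / ?C)"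
  proof (subst suminf_mult[symmetric])
    show "summable (\<lambda>n. real (2 * m choose (m + Suc n * l)) / real (2 * m choose m))"
    proof (rule summable_finite[of "{..m}"])
      fix n assume "n \<notin> {..m}"
      hence "m < Suc n * 1" by simp
      also have "\<dots> \<le> Suc n * l" using l by (intro mult_le_mono) auto
      finally show "real (2 * m choose (m + Suc n * l)) / real (2 * m choose m) = 0"
        by (simp add: binomial_eq_0)
    qed simp
  qed (use C in simp)
  finally have A: "(\<Sum>j<l. (2 * cos (pi * real j / real l)) ^ (2 * m)) =
     real l * ?C * (1 + 2 * (\<Sum>n. real (2 * m choose (m + Suc n * l)) / ?C))"
    by (simp add: algebra_simps)
  have "(\<Sum>j<l. (2 * cos (pi * real j / real l)) ^ (2 * m)) =
     4 ^ m * (\<Sum>j<l. cos (pi * real j / real l) ^ (2 * m))"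
    by (simp add: power_mult_distrib sum_distrib_left power_mult)
  also have "(\<Sum>j<l. cos (pi * real j / real l) ^ (2 * m)) =
      1 + (\<Sum>j=1..p. cos (pi * real j / real l) ^ (2 * m)) +
        (\<Sum>j=p+1..<l. cos (pi * real j / real l) ^ (2 * m))"
  proof -
    have "{..<l} = ({0} \<union> {1..p}) \<union> {p+1..<l}" by (auto simp: l_def)
    thus ?thesis by (simp only:) (subst sum.union_disjoint; force)+
  qed
  \<comment> \<open>Because \<open>l\<close> is odd, j \<mapsto> l - j exchanges the indices below
    and above l / 2 without a fixed point; the even power hides the change of sign of the
    cosine.\<close>
  also have "(\<Sum>j=p+1..<l. cos (pi * real j / real l) ^ (2 * m)) = 
     (\<Sum>j=1..p. cos (pi * real j / real l) ^ (2 * m))"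
  proof (rule sum.reindex_bij_witness[of _ "\<lambda>j. l - j" "\<lambda>j. l - j"])
    fix j assume "j \<in> {p+1..<l}"
    hence "pi * real (l - j) / real l = pi - pi * real j / real l"
      using l by (simp add: of_nat_diff field_simps)
    thus "cos (pi * real (l - j) / real l) ^ (2 * m) = cos (pi * real j / real l) ^ (2 * m)"
      by (simp add: power_mult)
  qed (auto simp: l_def)
  finally have B: "(\<Sum>j<l. (2 * cos (pi * real j / real l)) ^ (2 * m)) =
      4 ^ m * (1 + (\<Sum>j=1..p. cos (pi * real j / real l) ^ (2 * m)) +
        (\<Sum>j=1..p. cos (pi * real j / real l) ^ (2 * m)))" .
  have "1 + 2 * x = u * v / 4 ^ m * w" if "a = 4 ^ m * (1 + x + x)" "a = u * v * w" for a x u v w :: real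
    using that by (simp add: field_simps)
  from this[OF B A] show ?thesis .
qed

text \<open>Both bounds are 1 + y \<le> exp y, for y = - z and for y = z / (1 - z). With z = sin^2
  they squeeze the even powers of cosines between Gaussians.\<close>

lemma one_minus_power_bounds:
  fixes z :: real
  assumes "0 \<le> z" "z < 1"
  shows "exp (- (real m * z / (1 - z))) \<le> (1 - z) ^ m" "(1 - z) ^ m \<le> exp (- (real m * z))"
proof -
  have "1 - z \<le> exp (- z)" using exp_ge_add_one_self[of "-z"] by simp
  hence "(1 - z) ^ m \<le> exp (- z) ^ m" using assms by (intro power_mono) auto
  thus "(1 - z) ^ m \<le> exp (- (real m * z))" by (simp flip: exp_of_nat_mult)
  have "1 / (1 - z) = 1 + z / (1 - z)" using assms by (simp add: field_simps)
  also have "\<dots> \<le> exp (z / (1 - z))" by (rule exp_ge_add_one_self)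
  finally have "exp (- (z / (1 - z))) \<le> 1 - z" using assms by (simp add: exp_minus field_simps)
  hence "exp (- (z / (1 - z))) ^ m \<le> (1 - z) ^ m" by (intro power_mono) auto
  thus "exp (- (real m * z / (1 - z))) \<le> (1 - z) ^ m" by (simp flip: exp_of_nat_mult)
qed

text \<open>Jordan's inequality, from the concavity of the sine. It supplies the majorant for the
  cosine side of the theta inversion.\<close>

lemma sin_ge_linear:
  assumes "0 \<le> x" "x \<le> pi / 2"
  shows "2 * x / pi \<le> sin x"
proof -
  have "concave_on {0..pi} sin"
  proof (rule f''_le0_imp_concave[where f' = cos and f'' = "\<lambda>x. - sin x"])
    show "((\<lambda>x. cos x) has_real_derivative - sin x) (at x)" for x :: real
      by (auto intro!: derivative_eq_intros)
  qed (auto intro: sin_ge_zero derivative_eq_intros)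
  hence "(1 - 2 * x / pi) * sin 0 + 2 * x / pi * sin (pi / 2) \<le> 
      sin ((1 - 2 * x / pi) *\<^sub>R 0 + (2 * x / pi) *\<^sub>R (pi / 2))"
    by (rule concave_onD) (use assms in \<open>auto simp: field_simps\<close>)
  thus ?thesis by simp
qed

section \<open>Gaussian asymptotics of binomial coefficients\<close>

lemma binomial_ratio_prod:
  assumes "k \<le> m"
  shows "real (2 * m choose (m + k)) / real (2 * m choose m) =
    (\<Prod>i=1..k. (real m - real i + 1) / (real m + real i))"
  using assms
proof (induction k)
  case (Suc k)
  define b where "b = m - Suc k"
  have b: "Suc (m + k + b) = 2 * m" "Suc b = m - k" using Suc.prems by (auto simp: b_def)
  have "Suc (m + k) * (2 * m choose Suc (m + k)) = (m - k) * (2 * m choose (m + k))"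
    using Suc_times_binomial_add[of "m + k" b] by (simp only: b)
  hence "real (Suc (m + k) * (2 * m choose Suc (m + k))) = real ((m - k) * (2 * m choose (m + k)))"
    by simp
  hence "real (2 * m choose (m + Suc k)) = real (2 * m choose (m + k)) * (real m - real k) / (real m + real k + 1)"
    using Suc.prems by (simp add: of_nat_diff field_simps)
  hence "real (2 * m choose (m + Suc k)) / real (2 * m choose m) = 
     real (2 * m choose (m + k)) / real (2 * m choose m) * ((real m - real k) / (real m + real k + 1))"
    by simp
  also have "\<dots> = (\<Prod>i=1..k. (real m - real i + 1) / (real m + real i)) * ((real m - real k) / (real m + real k + 1))"
    using Suc by simp
  finally show ?case by (simp add: add_ac)
qed auto

text \<open>Each factor of the product is 1 - (2 i - 1) / (m + i), and its reciprocal is 1 + (2 i -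
  1) / (m - i + 1). Bounding both by exponentials with a common denominator, the odd numbers 2 i - 1
  add up to k^2, which is the Gaussian exponent.\<close>

lemma binomial_ratio_bounds:
  assumes "k \<le> m" 
  shows "exp (- (real k ^ 2 / (real m - real k + 1))) \<le> real (2 * m choose (m + k)) / real (2 * m choose m)"
    and "real (2 * m choose (m + k)) / real (2 * m choose m) \<le> exp (- (real k ^ 2 / (real m + real k)))"
proof -
  have sq: "(\<Sum>i=Suc 0..k. 2 * real i - 1) = real k ^ 2" for k
    by (induction k) (auto simp: power2_eq_square algebra_simps)
  have "(\<Prod>i=1..k. (real m - real i + 1) / (real m + real i)) \<le> 
      (\<Prod>i=1..k. exp (- ((2 * real i - 1) / (real m + real k))))"
  proof (rule prod_mono, safe)
    fix i assume i: "i \<in> {1..k}"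
    have "(real m - real i + 1) / (real m + real i) = 1 + (- ((2 * real i - 1) / (real m + real i)))"
      using i by (simp add: field_simps)
    also have "\<dots> \<le> exp (- ((2 * real i - 1) / (real m + real i)))" by (rule exp_ge_add_one_self)
    also have "\<dots> \<le> exp (- ((2 * real i - 1) / (real m + real k)))"
      using i by (auto intro!: divide_left_mono mult_pos_pos)
    finally show "(real m - real i + 1) / (real m + real i) \<le> exp (- ((2 * real i - 1) / (real m + real k)))" .
  qed (use assms in auto)
  also have "\<dots> = exp (- (real k ^ 2 / (real m + real k)))"
    by (simp add: exp_sum[symmetric] sum_negf sum_divide_distrib[symmetric] sq)
  finally show "real (2 * m choose (m + k)) / real (2 * m choose m) \<le> exp (- (real k ^ 2 / (real m + real k)))"
    using binomial_ratio_prod[OF assms] by simp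
  have "exp (- (real k ^ 2 / (real m - real k + 1))) = 
      (\<Prod>i=1..k. exp (- ((2 * real i - 1) / (real m - real k + 1))))"
    by (simp add: exp_sum[symmetric] sum_negf sum_divide_distrib[symmetric] sq)
  also have "\<dots> \<le> (\<Prod>i=1..k. (real m - real i + 1) / (real m + real i))"
  proof (rule prod_mono, safe)
    fix i assume i: "i \<in> {1..k}"
    have "(real m + real i) / (real m - real i + 1) = 1 + (2 * real i - 1) / (real m - real i + 1)"
      using i assms by (simp add: field_simps)
    also have "\<dots> \<le> exp ((2 * real i - 1) / (real m - real i + 1))" by (rule exp_ge_add_one_self)
    also have "\<dots> \<le> exp ((2 * real i - 1) / (real m - real k + 1))"
      using i assms by (auto intro!: divide_left_mono mult_pos_pos)
    finally have le: "(real m + real i) / (real m - real i + 1) \<le> exp ((2 * real i - 1) / (real m - real k + 1))" .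
    have "0 < (real m + real i) / (real m - real i + 1)" using i assms by auto
    from le_imp_inverse_le[OF le this]
    show "exp (- ((2 * real i - 1) / (real m - real k + 1))) \<le> (real m - real i + 1) / (real m + real i)"
      by (simp only: exp_minus inverse_divide)
  qed auto
  finally show "exp (- (real k ^ 2 / (real m - real k + 1))) \<le> real (2 * m choose (m + k)) / real (2 * m choose m)"
    using binomial_ratio_prod[OF assms] by simp
qed

text \<open>The quotient of the binomial coefficient by 4^n is the Pochhammer symbol of 1/2 over n!.
  Up to the factor n / (n + 1/2) the sequence is therefore the reciprocal of Euler's limit formula
  for Gamma(1/2) = sqrt pi.\<close>

lemma central_binomial_limit:
  "(\<lambda>n. sqrt (real n) * real (2 * n choose n) / 4 ^ n) \<longlonglongrightarrow> 1 / sqrt pi"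
proof -
  have "(\<lambda>n. inverse (Gamma_series (1/2 :: real) n) * (real n / (real n + 1/2))) \<longlonglongrightarrow> inverse (Gamma (1/2)) * 1"
  proof (intro tendsto_mult tendsto_inverse Gamma_series_LIMSEQ)
    show "(\<lambda>n. real n / (real n + 1 / 2)) \<longlonglongrightarrow> 1" by real_asymp
  qed (simp add: Gamma_one_half_real)
  also have "inverse (Gamma (1/2)) * 1 = 1 / sqrt pi" by (simp add: Gamma_one_half_real field_simps)
  finally show ?thesis
  proof (rule Lim_transform_eventually)
    show "\<forall>\<^sub>F n in sequentially. inverse (Gamma_series (1/2 :: real) n) * (real n / (real n + 1/2)) = sqrt (real n) * real (2 * n choose n) / 4 ^ n"
      using eventually_gt_at_top[of 0]
    proof eventually_elim
      case (elim n)
      have "real (2 * n choose n) = fact (2 * n) / (fact n * fact n)"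
        by (simp add: binomial_fact)
      also have "\<dots> = 4 ^ n * pochhammer (1 / 2) n / fact n"
        by (subst fact_double) (simp add: power_mult)
      finally have 1: "real (2 * n choose n) / 4 ^ n = pochhammer (1 / 2) n / fact n" by simp
      have "exp (ln (real n) / 2) = sqrt (real n)" using elim
        by (simp add: powr_half_sqrt[symmetric] powr_def)
      hence "inverse (Gamma_series (1/2 :: real) n) = pochhammer (1/2) (n+1) / (fact n * sqrt (real n))"
        by (simp add: Gamma_series_def)
      also have "\<dots> = (1/2 + real n) * (pochhammer (1/2) n / fact n) / sqrt (real n)"
        by (simp add: pochhammer_Suc)
      finally have 2: "inverse (Gamma_series (1/2 :: real) n) =
          (1/2 + real n) * (pochhammer (1/2) n / fact n) / sqrt (real n)" .
      have "(1/2 + N) * q / s * (N / (N + 1/2)) = N / s * q" if "N > 0" for N q s :: real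
        using that by (simp add: add.commute)
      from this[of "real n"] have "inverse (Gamma_series (1/2 :: real) n) * (real n / (real n + 1/2)) =
          (real n / sqrt (real n)) * (pochhammer (1/2) n / fact n)"
        unfolding 2 using elim by simp
      also have "real n / sqrt (real n) = sqrt (real n)" using elim by (simp add: real_div_sqrt)
      finally show ?case by (simp only: 1[symmetric] times_divide_eq_right)
    qed
  qed
qed

lemma theta_inversion:
  fixes c :: real
  assumes c: "c > 0"
  shows "1 + 2 * (\<Sum>n. exp (- (pi\<^sup>2 * c * real (Suc n) ^ 2))) =
    1 / sqrt (pi * c) * (1 + 2 * (\<Sum>n. exp (- (real (Suc n) ^ 2 / c))))"
proof -
  define l where "l = (\<lambda>p::nat. 2 * p + 1)"
  define m where "m = (\<lambda>p. nat \<lfloor>c * real (l p) ^ 2\<rfloor>)"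
  have l_pos: "real (l p) > 0" for p by (simp add: l_def)
  have l_top: "filterlim (\<lambda>p. real (l p)) at_top sequentially" unfolding l_def by real_asymp
  have m_le: "real (m p) \<le> c * real (l p) ^ 2" for p
    unfolding m_def using c by (intro of_nat_floor) simp
  have m_ge: "real (m p) \<ge> c * real (l p) ^ 2 - 1" for p
    unfolding m_def using c real_of_int_floor_gt_diff_one[of "c * real (l p) ^ 2"] by simp
  have mlim: "(\<lambda>p. real (m p) / real (l p) ^ 2) \<longlonglongrightarrow> c"
  proof (rule tendsto_sandwich)
    show "\<forall>\<^sub>F p in sequentially. c - 1 / real (l p) ^ 2 \<le> real (m p) / real (l p) ^ 2"
    proof (intro always_eventually allI)
      fix p
      have "c - 1 / real (l p) ^ 2 = (c * real (l p) ^ 2 - 1) / real (l p) ^ 2"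
        using l_pos[of p] by (simp add: field_simps)
      also have "\<dots> \<le> real (m p) / real (l p) ^ 2" using m_ge by (intro divide_right_mono) auto
      finally show "c - 1 / real (l p) ^ 2 \<le> real (m p) / real (l p) ^ 2" .
    qed
    show "\<forall>\<^sub>F p in sequentially. real (m p) / real (l p) ^ 2 \<le> c"
      using m_le l_pos by (intro always_eventually allI) (simp add: field_simps)
    show "(\<lambda>p. c - 1 / real (l p) ^ 2) \<longlonglongrightarrow> c" unfolding l_def by real_asymp
  qed simp
  have m_half: "\<forall>\<^sub>F p in sequentially. real (m p) / real (l p) ^ 2 > c / 2"
    using c by (intro order_tendstoD(1)[OF mlim]) simp
  have sq_ge: "real (Suc n) ^ 2 \<ge> real (Suc n)" for n
    by (simp add: power2_eq_square)
  \<comment> \<open>The finite cosine sum is padded with zeros to a series over all n, so that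
    Tannery's theorem applies.\<close>
  define a where "a = (\<lambda>n p. if n < p then cos (pi * real (Suc n) / real (l p)) ^ (2 * m p) else 0)"
  define r where "r = (\<lambda>n p. real (2 * m p choose (m p + Suc n * l p)) / real (2 * m p choose m p))"
  have A: "(\<lambda>p. \<Sum>n. a n p) \<longlonglongrightarrow> (\<Sum>n. exp (- (pi\<^sup>2 * c * real (Suc n) ^ 2)))"
  proof (rule tannerys_theorem[THEN conjunct2, THEN conjunct2])
    \<comment> \<open>Origin of the majorant: eventually m > c l^2 / 2, and Jordan's inequality
      gives sin x \<ge> 2 (n + 1) / l, so m sin^2 x \<ge> 2 c (n + 1)^2 \<ge> 2 c (n + 1).\<close>
    show "summable (\<lambda>n. exp (- (2 * c)) ^ Suc n)"
      using c by (subst summable_Suc_iff) (simp add: summable_geometric)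
    have "\<forall>\<^sub>F p in sequentially. \<forall>n. norm (a n p) \<le> exp (- (2 * c)) ^ Suc n"
      using m_half
    proof eventually_elim
      case (elim p)
      show ?case
      proof
        fix n
        show "norm (a n p) \<le> exp (- (2 * c)) ^ Suc n"
        proof (cases "n < p")
          case True
          define x where "x = pi * real (Suc n) / real (l p)"
          have "real (Suc n) / real (l p) \<le> 1 / 2" using True by (simp add: l_def field_simps)
          hence "x \<le> pi / 2" unfolding x_def 
            using mult_left_mono[of "real (Suc n) / real (l p)" "1/2" pi] by simp
          moreover have "x \<ge> 0" by (simp add: x_def)
          ultimately have s: "2 * x / pi \<le> sin x" and s0: "sin x \<ge> 0" 
            by (auto intro!: sin_ge_linear sin_ge_zero)
          have "2 * x / pi = 2 * real (Suc n) / real (l p)" by (simp add: x_def)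
          with s have s1: "(2 * real (Suc n) / real (l p)) ^ 2 \<le> sin x ^ 2"
            by (intro power_mono) auto
          have "2 * c * real (Suc n) \<le> 2 * c * real (Suc n) ^ 2" 
            using sq_ge[of n] c by (intro mult_left_mono) auto
          also have "\<dots> \<le> real (m p) / real (l p) ^ 2 * (4 * real (Suc n) ^ 2)"
            using mult_right_mono[OF less_imp_le[OF elim], of "4 * real (Suc n) ^ 2"] by simp
          also have "\<dots> = real (m p) * (2 * real (Suc n) / real (l p)) ^ 2"
            by (simp add: power_divide power_mult_distrib del: of_nat_Suc)
          also have "\<dots> \<le> real (m p) * sin x ^ 2" using s1 by (intro mult_left_mono) auto
          finally have *: "2 * c * real (Suc n) \<le> real (m p) * sin x ^ 2" .
          have cs: "cos x ^ 2 = 1 - sin x ^ 2" by (simp add: cos_squared_eq)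
          have "cos x ^ (2 * m p) \<le> exp (- (real (m p) * sin x ^ 2))"
          proof (cases "sin x ^ 2 < 1")
            case True
            thus ?thesis using one_minus_power_bounds(2)[of "sin x ^ 2" "m p"] by (simp add: power_mult cs)
          next
            case False
            hence "cos x ^ 2 = 0" using cs zero_le_power2[of "cos x"] by linarith
            \<comment> \<open>With cos x = 0 the power vanishes only for a positive exponent, since
              0 ^ 0 = 1.\<close>
            moreover have "m p > 0" using elim c l_pos[of p] by (auto intro!: Nat.gr0I)
            ultimately show ?thesis by (simp add: power_mult zero_power)
          qed
          also have "\<dots> \<le> exp (- (2 * c * real (Suc n)))" using * by simp
          also have "\<dots> = exp (- (2 * c)) ^ Suc n" 
            by (subst exp_of_nat_mult[symmetric]) (simp add: algebra_simps)
          finally show ?thesis using True by (simp add: a_def x_def power_mult)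
        qed (auto simp: a_def)
      qed
    qed
    from eventually_prodI[OF eventually_True this]
    show "\<forall>\<^sub>F (n, p) in sequentially \<times>\<^sub>F sequentially. norm (a n p) \<le> exp (- (2 * c)) ^ Suc n"
      by (rule eventually_mono) auto
    fix n
    define z where "z = (\<lambda>p. sin (pi * real (Suc n) / real (l p)) ^ 2)"
    have dl: "(\<lambda>p. d / real (l p)) \<longlonglongrightarrow> 0" for d
      by (rule tendsto_divide_0[OF tendsto_const filterlim_at_top_imp_at_infinity[OF l_top]])
    have *: "(\<lambda>p. real (l p) * sin (d / real (l p))) \<longlonglongrightarrow> d" if d: "d > 0" for d :: real
    proof -
      have "(sin has_field_derivative cos 0) (at (0::real))" by (rule DERIV_sin)
      hence "((\<lambda>x::real. sin x / x) \<longlongrightarrow> 1) (at 0)" by (simp add: has_field_derivative_iff)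
      moreover have "filterlim (\<lambda>p. d / real (l p)) (at 0) sequentially"
        using dl l_pos d by (intro filterlim_atI always_eventually allI) (auto simp: less_imp_neq[symmetric] l_def)
      ultimately have "(\<lambda>p. sin (d / real (l p)) / (d / real (l p))) \<longlonglongrightarrow> 1" 
        by (rule filterlim_compose)
      hence "(\<lambda>p. d * (sin (d / real (l p)) / (d / real (l p)))) \<longlonglongrightarrow> d * 1" 
        by (rule tendsto_mult[OF tendsto_const])
      thus ?thesis using d by (simp add: mult_ac)
    qed
    have mz: "(\<lambda>p. real (m p) * z p) \<longlonglongrightarrow> pi\<^sup>2 * c * real (Suc n) ^ 2"
    proof -
      have "(\<lambda>p. real (m p) / real (l p) ^ 2 * (real (l p) * sin (pi * real (Suc n) / real (l p))) ^ 2)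
        \<longlonglongrightarrow> c * (pi * real (Suc n)) ^ 2"
        by (intro tendsto_intros mlim *) simp
      also have "(\<lambda>p. real (m p) / real (l p) ^ 2 * (real (l p) * sin (pi * real (Suc n) / real (l p))) ^ 2) =
         (\<lambda>p. real (m p) * z p)"
        using l_pos by (auto simp: fun_eq_iff z_def power_mult_distrib)
      finally show ?thesis by (simp add: power_mult_distrib mult_ac)
    qed
    have z0: "z \<longlonglongrightarrow> 0"
    proof -
      have "z \<longlonglongrightarrow> sin 0 ^ 2" unfolding z_def by (intro tendsto_intros dl)
      thus ?thesis by simp
    qed
    have z1: "\<forall>\<^sub>F p in sequentially. z p < 1" using z0 by (rule order_tendstoD) simp
    have ev: "\<forall>\<^sub>F p in sequentially. a n p = (1 - z p) ^ m p"
      using eventually_gt_at_top[of n]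
      by eventually_elim (simp add: a_def z_def power_mult cos_squared_eq)
    show "(\<lambda>p. a n p) \<longlonglongrightarrow> exp (- (pi\<^sup>2 * c * real (Suc n) ^ 2))"
    proof (rule tendsto_sandwich)
      show "\<forall>\<^sub>F p in sequentially. exp (- (real (m p) * z p / (1 - z p))) \<le> a n p"
        using ev z1 by eventually_elim (use one_minus_power_bounds in \<open>auto simp: z_def\<close>)
      show "\<forall>\<^sub>F p in sequentially. a n p \<le> exp (- (real (m p) * z p))"
        using ev z1 by eventually_elim (use one_minus_power_bounds in \<open>auto simp: z_def\<close>)
      show "(\<lambda>p. exp (- (real (m p) * z p))) \<longlonglongrightarrow> exp (- (pi\<^sup>2 * c * real (Suc n) ^ 2))"
        by (intro tendsto_intros mz)
      have "(\<lambda>p. exp (- (real (m p) * z p / (1 - z p)))) \<longlonglongrightarrow> exp (- (pi\<^sup>2 * c * real (Suc n) ^ 2 / (1 - 0)))"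
        by (intro tendsto_intros mz z0) simp
      thus "(\<lambda>p. exp (- (real (m p) * z p / (1 - z p)))) \<longlonglongrightarrow> exp (- (pi\<^sup>2 * c * real (Suc n) ^ 2))"
        by simp
    qed
  qed simp
  have B: "(\<lambda>p. \<Sum>n. r n p) \<longlonglongrightarrow> (\<Sum>n. exp (- (real (Suc n) ^ 2 / c)))"
  proof (rule tannerys_theorem[THEN conjunct2, THEN conjunct2])
    \<comment> \<open>Origin of the majorant: for k = (n + 1) l \<le> m the denominator m + k is at
      most 2 m \<le> 2 c l^2, so the exponent is at least (n + 1)^2 / (2 c); for k > m the binomial
      coefficient is 0.\<close>
    show "summable (\<lambda>n. exp (- (1 / (2 * c))) ^ Suc n)"
      using c by (subst summable_Suc_iff) (simp add: summable_geometric)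
    have "\<forall>\<^sub>F p in sequentially. \<forall>n. norm (r n p) \<le> exp (- (1 / (2 * c))) ^ Suc n"
      using m_half
    proof eventually_elim
      case (elim p)
      have mp: "m p > 0" using elim c l_pos[of p] by (auto intro!: Nat.gr0I)
      show ?case
      proof
        fix n
        define k where "k = Suc n * l p"
        show "norm (r n p) \<le> exp (- (1 / (2 * c))) ^ Suc n"
        proof (cases "k \<le> m p")
          case True
          have r_le: "norm (r n p) \<le> exp (- (real k ^ 2 / (real (m p) + real k)))"
            using binomial_ratio_bounds(2)[OF True] by (simp add: r_def k_def del: mult_Suc)
          have "real (Suc n) / (2 * c) \<le> real (Suc n) ^ 2 / (2 * c)"
            using sq_ge[of n] c by (intro divide_right_mono) auto
          also have "\<dots> = real k ^ 2 / (2 * (c * real (l p) ^ 2))"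
            using l_pos[of p] by (simp add: k_def power_mult_distrib del: of_nat_Suc mult_Suc)
          also have "\<dots> \<le> real k ^ 2 / (real (m p) + real k)"
            using True m_le[of p] mp c l_pos[of p] by (intro divide_left_mono) (auto intro!: mult_pos_pos)
          finally have "exp (- (real k ^ 2 / (real (m p) + real k))) \<le> exp (- (real (Suc n) / (2 * c)))" by simp
          with r_le have "norm (r n p) \<le> exp (- (real (Suc n) / (2 * c)))" by (rule order.trans)
          also have "\<dots> = exp (- (1 / (2 * c))) ^ Suc n" 
            by (subst exp_of_nat_mult[symmetric]) (simp add: algebra_simps)
          finally show ?thesis .
        next
          case False
          hence "r n p = 0" by (simp add: r_def k_def binomial_eq_0)
          thus ?thesis by simp
        qed
      qed
    qed
    from eventually_prodI[OF eventually_True this]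
    show "\<forall>\<^sub>F (n, p) in sequentially \<times>\<^sub>F sequentially. norm (r n p) \<le> exp (- (1 / (2 * c))) ^ Suc n"
      by (rule eventually_mono) auto
    fix n
    have l0: "(\<lambda>p. 1 / real (l p)) \<longlonglongrightarrow> 0" unfolding l_def by real_asymp
    have klim: "(\<lambda>p. real (m p) / real (l p) ^ 2 - real (Suc n) * (1 / real (l p))) \<longlonglongrightarrow> c - real (Suc n) * 0"
      by (intro tendsto_intros mlim l0)
    have kle: "\<forall>\<^sub>F p in sequentially. Suc n * l p \<le> m p"
    proof -
      have "\<forall>\<^sub>F p in sequentially. real (m p) / real (l p) ^ 2 - real (Suc n) * (1 / real (l p)) > 0"
        by (rule order_tendstoD(1)[OF klim]) (use c in simp)
      thus ?thesis
      proof eventually_elim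
        case (elim p)
        hence "real (Suc n) * (1 / real (l p)) * real (l p) ^ 2 < real (m p) / real (l p) ^ 2 * real (l p) ^ 2"
          using l_pos[of p] by (intro mult_strict_right_mono) auto
        also have "real (m p) / real (l p) ^ 2 * real (l p) ^ 2 = real (m p)"
          using l_pos[of p] by simp
        also have "real (Suc n) * (1 / real (l p)) * real (l p) ^ 2 = real (Suc n * l p)"
          using l_pos[of p] by (simp add: power2_eq_square del: of_nat_Suc mult_Suc)
        finally have "real (Suc n * l p) < real (m p)" .
        thus ?case by (simp only: of_nat_less_iff less_imp_le)
      qed
    qed
    have eq: "real (Suc n * l p) ^ 2 / x = real (Suc n) ^ 2 / (x / real (l p) ^ 2)" for x p
      by (simp add: power_mult_distrib del: of_nat_Suc mult_Suc)
    show "(\<lambda>p. r n p) \<longlonglongrightarrow> exp (- (real (Suc n) ^ 2 / c))"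
    proof (rule tendsto_sandwich)
      show "\<forall>\<^sub>F p in sequentially. exp (- (real (Suc n * l p) ^ 2 / (real (m p) - real (Suc n * l p) + 1))) \<le> r n p"
        using kle unfolding r_def by eventually_elim (rule binomial_ratio_bounds)
      show "\<forall>\<^sub>F p in sequentially. r n p \<le> exp (- (real (Suc n * l p) ^ 2 / (real (m p) + real (Suc n * l p))))"
        using kle unfolding r_def by eventually_elim (rule binomial_ratio_bounds)
      have e1: "(real (m p) - real (Suc n * l p) + 1) / real (l p) ^ 2 = 
         real (m p) / real (l p) ^ 2 - real (Suc n) * (1 / real (l p)) + (1 / real (l p)) ^ 2" for p
        using l_pos[of p] by (simp add: field_simps power2_eq_square)
      have e2: "(real (m p) + real (Suc n * l p)) / real (l p) ^ 2 = 
         real (m p) / real (l p) ^ 2 + real (Suc n) * (1 / real (l p))" for p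
        using l_pos[of p] by (simp add: field_simps power2_eq_square)
      have "(\<lambda>p. exp (- (real (Suc n) ^ 2 / (real (m p) / real (l p) ^ 2 - real (Suc n) * (1 / real (l p)) + (1 / real (l p)) ^ 2))))
         \<longlonglongrightarrow> exp (- (real (Suc n) ^ 2 / (c - real (Suc n) * 0 + 0 ^ 2)))"
        by (intro tendsto_exp tendsto_minus tendsto_divide tendsto_const tendsto_add tendsto_diff tendsto_mult tendsto_power mlim l0)
          (use c in simp)
      thus "(\<lambda>p. exp (- (real (Suc n * l p) ^ 2 / (real (m p) - real (Suc n * l p) + 1))))
         \<longlonglongrightarrow> exp (- (real (Suc n) ^ 2 / c))" by (simp only: eq e1) simp
      have "(\<lambda>p. exp (- (real (Suc n) ^ 2 / (real (m p) / real (l p) ^ 2 + real (Suc n) * (1 / real (l p))))))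
         \<longlonglongrightarrow> exp (- (real (Suc n) ^ 2 / (c + real (Suc n) * 0)))"
        by (intro tendsto_exp tendsto_minus tendsto_divide tendsto_const tendsto_add tendsto_diff tendsto_mult tendsto_power mlim l0)
          (use c in simp)
      thus "(\<lambda>p. exp (- (real (Suc n * l p) ^ 2 / (real (m p) + real (Suc n * l p)))))
         \<longlonglongrightarrow> exp (- (real (Suc n) ^ 2 / c))" by (simp only: eq e2) simp
    qed
  qed simp
  have C: "(\<lambda>p. real (l p) * real (2 * m p choose m p) / 4 ^ m p) \<longlonglongrightarrow> 1 / sqrt (pi * c)"
  proof -
    have m_top: "filterlim m at_top sequentially"
    proof -
      have "filterlim (\<lambda>p. c * real (l p) ^ 2 - 1) at_top sequentially"
        unfolding l_def using c by real_asymp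
      hence "filterlim (\<lambda>p. real (m p)) at_top sequentially"
        by (rule filterlim_at_top_mono) (use m_ge in auto)
      thus ?thesis by (simp add: filterlim_sequentially_iff_filterlim_real)
    qed
    have cb: "(\<lambda>p. sqrt (real (m p)) * real (2 * m p choose m p) / 4 ^ m p) \<longlonglongrightarrow> 1 / sqrt pi"
      using filterlim_compose[OF central_binomial_limit m_top] by simp
    \<comment> \<open>Here l = sqrt m / sqrt (m / l^2), and m / l^2 tends to c.\<close>
    have "(\<lambda>p. sqrt (real (m p)) * real (2 * m p choose m p) / 4 ^ m p / sqrt (real (m p) / real (l p) ^ 2)) 
       \<longlonglongrightarrow> 1 / sqrt pi / sqrt c"
      by (rule tendsto_divide[OF cb tendsto_real_sqrt[OF mlim]]) (use c in simp)
    also have "1 / sqrt pi / sqrt c = 1 / sqrt (pi * c)" by (simp add: real_sqrt_mult)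
    finally show ?thesis
    proof (rule Lim_transform_eventually)
      show "\<forall>\<^sub>F p in sequentially. sqrt (real (m p)) * real (2 * m p choose m p) / 4 ^ m p / 
          sqrt (real (m p) / real (l p) ^ 2) = real (l p) * real (2 * m p choose m p) / 4 ^ m p"
        using m_half
      proof eventually_elim
        case (elim p)
        have mp: "m p > 0" using elim c l_pos[of p] by (auto intro!: Nat.gr0I)
        thus ?case using l_pos[of p] by (simp add: real_sqrt_divide)
      qed
    qed
  qed
  have "(\<lambda>p. 1 + 2 * (\<Sum>n. a n p)) \<longlonglongrightarrow> 1 + 2 * (\<Sum>n. exp (- (pi\<^sup>2 * c * real (Suc n) ^ 2)))"
    by (intro tendsto_intros A)
  moreover have "(\<lambda>p. real (l p) * real (2 * m p choose m p) / 4 ^ m p * (1 + 2 * (\<Sum>n. r n p))) \<longlonglongrightarrow> 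
     1 / sqrt (pi * c) * (1 + 2 * (\<Sum>n. exp (- (real (Suc n) ^ 2 / c))))"
    by (intro tendsto_intros B C)
  moreover have "1 + 2 * (\<Sum>n. a n p) = real (l p) * real (2 * m p choose m p) / 4 ^ m p * (1 + 2 * (\<Sum>n. r n p))" for p
  proof -
    have "(\<Sum>n. a n p) = (\<Sum>n<p. a n p)"
      by (rule suminf_finite) (auto simp: a_def)
    also have "\<dots> = (\<Sum>j=1..p. cos (pi * real j / real (l p)) ^ (2 * m p))"
      by (rule sum.reindex_bij_witness[of _ "\<lambda>j. j - 1" Suc]) (auto simp: a_def)
    finally show ?thesis using polya_finite_identity[where p = p and m = "m p"] by (simp only: l_def r_def)
  qed
  ultimately show ?thesis using LIMSEQ_unique by simp blast
qed

text \<open>This is (theta(x) - 1) / 2 for the theta series theta(x), the sum of exp (- pi n^2 x)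
  over all integers n.\<close>

definition omega :: "real \<Rightarrow> real" where
  "omega x = (\<Sum>n. exp (- (pi * real (Suc n) ^ 2 * x)))"

lemma omega_inverse:
  assumes x: "x > 0"
  shows "omega (1 / x) = sqrt x * omega x + (sqrt x - 1) / 2"
proof -
  have "pi\<^sup>2 * (x / pi) * q = pi * q * x" "q / (x / pi) = pi * q * (1 / x)" for q
    by (simp_all add: power2_eq_square)
  moreover have "sqrt (pi * (x / pi)) = sqrt x" by simp
  ultimately have "1 + 2 * omega x = 1 / sqrt x * (1 + 2 * omega (1 / x))"
    using theta_inversion[of "x / pi"] x by (simp only: omega_def divide_pos_pos pi_gt_zero)
  moreover have "w = s * v + (s - 1) / 2" if "1 + 2 * v = 1 / s * (1 + 2 * w)" "s > 0" for s v w :: real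
    using that by (simp add: field_simps)
  ultimately show ?thesis using x by simp
qed

lemma omega_summable:
  assumes "x > 0"
  shows "summable (\<lambda>n. exp (- (pi * real (Suc n) ^ 2 * x)))"
proof (rule summable_comparison_test')
  show "summable (\<lambda>n. exp (- (pi * x)) ^ Suc n)"
    using assms by (subst summable_Suc_iff) (simp add: summable_geometric)
  fix n :: nat
  have "real (Suc n) \<le> real (Suc n) ^ 2" by (simp add: power2_eq_square)
  hence "pi * x * real (Suc n) \<le> pi * x * real (Suc n) ^ 2" using assms by (intro mult_left_mono) auto
  hence "exp (- (pi * real (Suc n) ^ 2 * x)) \<le> exp (- (pi * x * real (Suc n)))" by (simp add: mult_ac)
  also have "\<dots> = exp (- (pi * x)) ^ Suc n" 
    by (subst exp_of_nat_mult[symmetric]) (simp add: algebra_simps)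
  finally show "norm (exp (- (pi * real (Suc n) ^ 2 * x))) \<le> exp (- (pi * x)) ^ Suc n" by simp
qed

section \<open>The Mellin transform of the theta function\<close>

text \<open>The substitution x = 1 / y is made on [1 / b, 1]; then b tends to infinity through the
  continuity from below of the measures with these densities.\<close>

lemma nn_integral_inversion:
  fixes f :: "real \<Rightarrow> real"
  assumes [measurable]: "f \<in> borel_measurable borel"
  shows "(\<integral>\<^sup>+x. ennreal (f x) * indicator {0<..1} x \<partial>lborel) =
         (\<integral>\<^sup>+y. ennreal (f (1 / y) * (1 / y ^ 2)) * indicator {1..} y \<partial>lborel)"
proof -
  have fin: "(\<integral>\<^sup>+x. ennreal (f x) * indicator {1 / b..1} x \<partial>lborel) =
         (\<integral>\<^sup>+y. ennreal (f (1 / y) * (1 / y ^ 2)) * indicator {1..b} y \<partial>lborel)" if b: "b \<ge> 1" for b :: real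
  proof -
    \<comment> \<open>The substitution rule wants an increasing map. A reflection comes first, so
      that the decreasing 1 / y is replaced by the increasing - 1 / y.\<close>
    have "(\<integral>\<^sup>+x. ennreal (f x) * indicator {1 / b..1} x \<partial>lborel) = 
        \<bar>-1 :: real\<bar> * (\<integral>\<^sup>+x. ennreal (f (0 + (-1) * x)) * indicator {1 / b..1} (0 + (-1) * x) \<partial>lborel)"
      by (rule nn_integral_real_affine) auto
    also have "\<dots> = (\<integral>\<^sup>+x. ennreal ((\<lambda>x. f (- x)) x * indicator {(\<lambda>y. - (1 / y)) 1..(\<lambda>y. - (1 / y)) b} x) \<partial>lborel)"
      by (auto intro!: nn_integral_cong simp: indicator_def)
    also have "\<dots> = (\<integral>\<^sup>+y. ennreal ((\<lambda>x. f (- x)) ((\<lambda>y. - (1 / y)) y) * (1 / y ^ 2) * indicator {1..b} y) \<partial>lborel)"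
    proof (rule nn_integral_substitution)
      show "set_borel_measurable borel {- (1 / 1)..- (1 / b)} (\<lambda>x. f (- x))"
        unfolding set_borel_measurable_def by measurable
      show "((\<lambda>y. - (1 / y)) has_real_derivative 1 / x\<^sup>2) (at x)" if "x \<in> {1..b}" for x
        using that by (auto intro!: derivative_eq_intros simp: power2_eq_square)
      show "continuous_on {1..b} (\<lambda>x. 1 / x\<^sup>2)" by (auto intro!: continuous_intros)
    qed (use b in auto)
    also have "\<dots> = (\<integral>\<^sup>+y. ennreal (f (1 / y) * (1 / y ^ 2)) * indicator {1..b} y \<partial>lborel)"
      by (auto intro!: nn_integral_cong simp: indicator_def)
    finally show ?thesis .
  qed
  have lim: "(\<integral>\<^sup>+x. g x * indicator (\<Union>i. A i) x \<partial>lborel) = (SUP i. \<integral>\<^sup>+x. g x * indicator (A i) x \<partial>lborel)"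
    if [measurable]: "g \<in> borel_measurable borel" "\<And>i. A i \<in> sets borel" and "incseq A" for g A
  proof -
    have "(SUP i. emeasure (density lborel g) (A i)) = emeasure (density lborel g) (\<Union>i. A i)"
      using that by (intro SUP_emeasure_incseq) auto
    thus ?thesis by (simp add: emeasure_density)
  qed
  have U1: "(\<Union>i. {1 / real (Suc i)..1}) = {0<..(1::real)}"
  proof safe
    fix x :: real assume x: "x \<in> {0<..1}"
    obtain n where "inverse (real (Suc n)) < x" using x reals_Archimedean[of x] by auto
    thus "x \<in> (\<Union>i. {1 / real (Suc i)..1})" using x by (auto intro!: exI[of _ n] simp: inverse_eq_divide)
  next
    fix x :: real and i assume "x \<in> {1 / real (Suc i)..1}"
    thus "x \<in> {0<..1}" by (auto intro: less_le_trans[of 0 "1 / real (Suc i)"])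
  qed
  have U2: "(\<Union>i. {1..real (Suc i)}) = {(1::real)..}"
  proof (intro equalityI subsetI)
    fix x :: real assume x: "x \<in> {1..}"
    obtain n where "x < real n" using reals_Archimedean2 by blast
    hence "x \<in> {1..real (Suc n)}" using x by simp
    thus "x \<in> (\<Union>i. {1..real (Suc i)})" by blast
  qed auto
  have "(\<integral>\<^sup>+x. ennreal (f x) * indicator {0<..1} x \<partial>lborel) = 
      (SUP i. \<integral>\<^sup>+x. ennreal (f x) * indicator {1 / real (Suc i)..1} x \<partial>lborel)"
    unfolding U1[symmetric] by (rule lim) (auto simp: incseq_def intro!: frac_le elim: order.trans[rotated])
  also have "\<dots> = (SUP i. \<integral>\<^sup>+y. ennreal (f (1 / y) * (1 / y ^ 2)) * indicator {1..real (Suc i)} y \<partial>lborel)"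
    by (intro SUP_cong refl fin) auto
  also have "\<dots> = (\<integral>\<^sup>+y. ennreal (f (1 / y) * (1 / y ^ 2)) * indicator {1..} y \<partial>lborel)"
    unfolding U2[symmetric] by (rule lim[symmetric]) (auto simp: incseq_def)
  finally show ?thesis .
qed

lemma nn_integral_powr_exp:
  fixes a s :: real
  assumes "a > 0" "s > 0"
  shows "(\<integral>\<^sup>+x. ennreal (exp (- (a * x)) * x powr (s - 1)) * indicator {0<..} x \<partial>lborel) = ennreal (Gamma s / a powr s)"
proof -
  have "ennreal (Gamma s) = (\<integral>\<^sup>+t. ennreal (indicator {0..} t * t powr (s - 1) / exp t) \<partial>lborel)"
    by (rule Gamma_conv_nn_integral_real[OF assms(2)])
  also have "\<dots> = \<bar>a\<bar> * (\<integral>\<^sup>+t. ennreal (indicator {0..} (0 + a * t) * (0 + a * t) powr (s - 1) / exp (0 + a * t)) \<partial>lborel)"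
    using assms by (intro nn_integral_real_affine) auto
  also have "\<dots> = \<bar>a\<bar> * (\<integral>\<^sup>+t. ennreal (a powr (s - 1)) * (ennreal (exp (- (a * t)) * t powr (s - 1)) * indicator {0<..} t) \<partial>lborel)"
  proof (intro arg_cong2[where f = "(*)"] refl nn_integral_cong)
    fix t
    show "ennreal (indicator {0..} (0 + a * t) * (0 + a * t) powr (s - 1) / exp (0 + a * t)) = 
       ennreal (a powr (s - 1)) * (ennreal (exp (- (a * t)) * t powr (s - 1)) * indicator {0<..} t)"
      using assms by (cases "t > 0") 
        (auto simp: indicator_def zero_le_mult_iff powr_mult exp_minus field_simps ennreal_mult' [symmetric])
  qed
  also have "\<dots> = ennreal (a * a powr (s - 1)) * (\<integral>\<^sup>+t. (ennreal (exp (- (a * t)) * t powr (s - 1)) * indicator {0<..} t) \<partial>lborel)"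
    using assms by (subst nn_integral_cmult) (auto simp: ennreal_mult' mult.assoc)
  also have "a * a powr (s - 1) = a powr s" using assms by (simp add: powr_diff)
  finally have "ennreal (1 / a powr s) * ennreal (Gamma s) = ennreal (1 / a powr s) * ennreal (a powr s) * (\<integral>\<^sup>+t. (ennreal (exp (- (a * t)) * t powr (s - 1)) * indicator {0<..} t) \<partial>lborel)"
    by (simp add: mult.assoc)
  also have "ennreal (1 / a powr s) * ennreal (a powr s) = 1"
    using assms by (subst ennreal_mult'[symmetric]) auto
  finally show ?thesis using assms by (simp add: ennreal_mult'[symmetric])
qed

definition zeta_sum :: "real \<Rightarrow> real" where
  "zeta_sum s = (\<Sum>n. real (Suc n) powr (- s))"

lemma summable_zeta_sum: "s > 1 \<Longrightarrow> summable (\<lambda>n. real (Suc n) powr (- s))"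
  using summable_real_powr_iff[of "-s"] by (subst summable_Suc_iff[where f = "\<lambda>n. real n powr (-s)"]) simp

lemma omega_nonneg: "x > 0 \<Longrightarrow> omega x \<ge> 0"
  unfolding omega_def by (intro suminf_nonneg omega_summable) auto

lemma omega_measurable [measurable]: "omega \<in> borel_measurable borel"
  unfolding omega_def[abs_def] by measurable

text \<open>The Mellin transform of exp (- pi n^2 x) at s / 2 is pi^(-s/2) Gamma(s/2) n^(-s). All
  terms are nonnegative, so sum and integral can be exchanged.\<close>

lemma nn_integral_omega:
  fixes s :: real
  assumes s: "s > 1"
  shows "(\<integral>\<^sup>+x. ennreal (omega x * x powr (s / 2 - 1)) * indicator {0<..} x \<partial>lborel) =
    ennreal (pi powr (- s / 2) * Gamma (s / 2) * zeta_sum s)"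
proof -
  have "(\<integral>\<^sup>+x. ennreal (omega x * x powr (s / 2 - 1)) * indicator {0<..} x \<partial>lborel) =
     (\<integral>\<^sup>+x. (\<Sum>n. ennreal (exp (- (pi * real (Suc n) ^ 2 * x)) * x powr (s / 2 - 1)) * indicator {0<..} x) \<partial>lborel)"
  proof (intro nn_integral_cong)
    fix x :: real
    show "ennreal (omega x * x powr (s / 2 - 1)) * indicator {0<..} x =
      (\<Sum>n. ennreal (exp (- (pi * real (Suc n) ^ 2 * x)) * x powr (s / 2 - 1)) * indicator {0<..} x)"
    proof (cases "x > 0")
      case True
      have "omega x * x powr (s / 2 - 1) = (\<Sum>n. exp (- (pi * real (Suc n) ^ 2 * x)) * x powr (s / 2 - 1))"
        unfolding omega_def by (rule suminf_mult2[OF omega_summable[OF True]])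
      moreover have "summable (\<lambda>n. exp (- (pi * real (Suc n) ^ 2 * x)) * x powr (s / 2 - 1))"
        by (rule summable_mult2[OF omega_summable[OF True]])
      ultimately show ?thesis using True by (simp add: suminf_ennreal2)
    qed auto
  qed
  also have "\<dots> = (\<Sum>n. \<integral>\<^sup>+x. ennreal (exp (- (pi * real (Suc n) ^ 2 * x)) * x powr (s / 2 - 1)) * indicator {0<..} x \<partial>lborel)"
    by (rule nn_integral_suminf) measurable
  also have "\<dots> = (\<Sum>n. ennreal (Gamma (s / 2) / (pi * real (Suc n) ^ 2) powr (s / 2)))"
    using s by (subst nn_integral_powr_exp) auto
  also have "\<dots> = (\<Sum>n. ennreal (pi powr (- s / 2) * Gamma (s / 2) * real (Suc n) powr (- s)))"
  proof (intro suminf_cong arg_cong[where f = ennreal])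
    fix n
    have "(real (Suc n) ^ 2) powr (s / 2) = real (Suc n) powr s"
      using powr_powr[of "real (Suc n)" 2 "s / 2"] by (simp del: of_nat_Suc)
    hence "(pi * real (Suc n) ^ 2) powr (s / 2) = pi powr (s / 2) * real (Suc n) powr s"
      by (subst powr_mult) (auto simp del: of_nat_Suc)
    thus "Gamma (s / 2) / (pi * real (Suc n) ^ 2) powr (s / 2) = pi powr (- s / 2) * Gamma (s / 2) * real (Suc n) powr (- s)"
      by (simp add: powr_minus field_simps del: of_nat_Suc)
  qed
  also have "\<dots> = ennreal (\<Sum>n. pi powr (- s / 2) * Gamma (s / 2) * real (Suc n) powr (- s))"
    using s by (intro suminf_ennreal2 summable_mult summable_zeta_sum) (auto intro!: mult_nonneg_nonneg Gamma_real_nonneg)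
  also have "\<dots> = ennreal (pi powr (- s / 2) * Gamma (s / 2) * zeta_sum s)"
    unfolding zeta_sum_def using s by (subst suminf_mult[OF summable_zeta_sum]) auto
  finally show ?thesis .
qed

text \<open>Riemann's splitting at 1: the part over (0, 1] is carried to [1, \<infinity>) by x = 1 /
  y, where the theta inversion returns \<open>omega\<close> together with elementary powers that
  integrate to 1 / (s - 1) - 1 / s. The two exponents that remain are exchanged by s \<mapsto> 1 -
  s.\<close>

lemma nn_integral_omega_split:
  fixes s :: real
  assumes s: "s > 1"
  shows "ennreal (pi powr (- s / 2) * Gamma (s / 2) * zeta_sum s) = 
    (\<integral>\<^sup>+x. ennreal (omega x * (x powr (s / 2 - 1) + x powr (- s / 2 - 1 / 2))) * indicator {1..} x \<partial>lborel)
      + ennreal (1 / (s - 1) - 1 / s)"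
proof -
  let ?f = "\<lambda>x. omega x * x powr (s / 2 - 1)"
  have "ennreal (pi powr (- s / 2) * Gamma (s / 2) * zeta_sum s) = 
     (\<integral>\<^sup>+x. ennreal (?f x) * indicator {0<..} x \<partial>lborel)"
    by (rule nn_integral_omega[OF s, symmetric])
  also have "\<dots> = (\<integral>\<^sup>+x. (ennreal (?f x) * indicator {0<..1} x + ennreal (?f x) * indicator {1..} x) \<partial>lborel)"
  proof (rule nn_integral_cong_AE)
    show "AE x in lborel. ennreal (?f x) * indicator {0<..} x = ennreal (?f x) * indicator {0<..1} x + ennreal (?f x) * indicator {1..} x"
      using AE_lborel_singleton[of "1::real"] by eventually_elim (auto simp: indicator_def)
  qed
  also have "\<dots> = (\<integral>\<^sup>+x. ennreal (?f x) * indicator {0<..1} x \<partial>lborel) + (\<integral>\<^sup>+x. ennreal (?f x) * indicator {1..} x \<partial>lborel)"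
    by (rule nn_integral_add) measurable
  also have "(\<integral>\<^sup>+x. ennreal (?f x) * indicator {0<..1} x \<partial>lborel) = 
     (\<integral>\<^sup>+y. ennreal (?f (1 / y) * (1 / y ^ 2)) * indicator {1..} y \<partial>lborel)"
    by (rule nn_integral_inversion) measurable
  also have "\<dots> = (\<integral>\<^sup>+y. ennreal (omega y * y powr (- s / 2 - 1 / 2)) * indicator {1..} y + 
       ennreal ((y powr (- s / 2 - 1 / 2) - y powr (- s / 2 - 1)) / 2) * indicator {1..} y \<partial>lborel)"
  proof (intro nn_integral_cong)
    fix y :: real
    show "ennreal (?f (1 / y) * (1 / y ^ 2)) * indicator {1..} y = ennreal (omega y * y powr (- s / 2 - 1 / 2)) * indicator {1..} y + 
       ennreal ((y powr (- s / 2 - 1 / 2) - y powr (- s / 2 - 1)) / 2) * indicator {1..} y"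
    proof (cases "y \<ge> 1")
      case True
      hence y: "y > 0" by simp
      have 1: "(1 / y) powr (s / 2 - 1) * (1 / y ^ 2) = y powr (- s / 2 - 1)"
      proof -
        have "(1 / y) powr (s / 2 - 1) = y powr (- (s / 2 - 1))" 
          by (simp only: powr_minus) (simp add: powr_divide y less_imp_le inverse_eq_divide)
        moreover have "1 / y ^ 2 = y powr (- 2)" using y by (simp add: powr_minus inverse_eq_divide)
        moreover have "- (s / 2 - 1) + - 2 = - s / 2 - 1" by simp
        ultimately show ?thesis using y by (simp only: powr_add[symmetric])
      qed
      have 2: "sqrt y * y powr (- s / 2 - 1) = y powr (- s / 2 - 1 / 2)"
      proof -
        have "1 / 2 + (- s / 2 - 1) = - s / 2 - 1 / 2" by simp
        thus ?thesis using y by (simp only: powr_half_sqrt[symmetric] powr_add[symmetric] less_imp_le)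
      qed
      have "?f (1 / y) * (1 / y ^ 2) = omega (1 / y) * ((1 / y) powr (s / 2 - 1) * (1 / y ^ 2))" by simp
      also have "\<dots> = omega y * (sqrt y * y powr (- s / 2 - 1)) + (sqrt y * y powr (- s / 2 - 1) - y powr (- s / 2 - 1)) / 2"
        unfolding 1 omega_inverse[OF y] by (simp add: field_simps)
      finally have "?f (1 / y) * (1 / y ^ 2) = omega y * y powr (- s / 2 - 1 / 2) + (y powr (- s / 2 - 1 / 2) - y powr (- s / 2 - 1)) / 2"
        unfolding 2 .
      moreover have "y powr (- s / 2 - 1) \<le> y powr (- s / 2 - 1 / 2)" using True by (intro powr_mono) auto
      ultimately show ?thesis using True omega_nonneg[OF y] by (simp add: ennreal_plus[symmetric] del: ennreal_plus)
    qed auto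
  qed
  also have "\<dots> = (\<integral>\<^sup>+y. ennreal (omega y * y powr (- s / 2 - 1 / 2)) * indicator {1..} y \<partial>lborel) + 
       (\<integral>\<^sup>+y. ennreal ((y powr (- s / 2 - 1 / 2) - y powr (- s / 2 - 1)) / 2) * indicator {1..} y \<partial>lborel)"
    by (rule nn_integral_add) measurable
  also have "(\<integral>\<^sup>+y. ennreal ((y powr (- s / 2 - 1 / 2) - y powr (- s / 2 - 1)) / 2) * indicator {1..} y \<partial>lborel) = 
     ennreal (0 - (\<lambda>y. y powr (1 / 2 - s / 2) / (1 - s) + y powr (- s / 2) / s) 1)"
  proof (rule nn_integral_FTC_atLeast[where F = "\<lambda>y. y powr (1 / 2 - s / 2) / (1 - s) + y powr (- s / 2) / s"])
    fix x :: real assume x: "x \<ge> 1"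
    show "((\<lambda>y. y powr (1 / 2 - s / 2) / (1 - s) + y powr (- s / 2) / s) has_real_derivative 
       (x powr (- s / 2 - 1 / 2) - x powr (- s / 2 - 1)) / 2) (at x)"
    proof -
      have "(1 / 2 - s / 2) * q / (1 - s) = q / 2" for q using s by (simp add: field_simps)
      moreover have "x powr (- (1 / 2) - s / 2) = x powr (- (s / 2) - 1 / 2)" by (rule arg_cong) simp
      ultimately show ?thesis using x s
        by (auto intro!: derivative_eq_intros simp: diff_divide_distrib)
    qed
    show "0 \<le> (x powr (- s / 2 - 1 / 2) - x powr (- s / 2 - 1)) / 2" 
      using powr_mono[of "- s / 2 - 1" "- s / 2 - 1 / 2" x] x by simp
  next
    have "((\<lambda>y::real. y powr (- (s / 2 - 1 / 2)) / (1 - s) + y powr (- (s / 2)) / s) \<longlongrightarrow> 0 / (1 - s) + 0 / s) at_top"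
      using s by (intro tendsto_add tendsto_divide tendsto_neg_powr filterlim_ident tendsto_const) auto
    thus "((\<lambda>y. y powr (1 / 2 - s / 2) / (1 - s) + y powr (- s / 2) / s) \<longlongrightarrow> 0) at_top" by simp
  qed measurable
  also have "0 - (\<lambda>y. y powr (1 / 2 - s / 2) / (1 - s) + y powr (- s / 2) / s) 1 = 1 / (s - 1) - 1 / s"
    using s by (simp add: divide_simps)
  also have "(\<integral>\<^sup>+y. ennreal (omega y * y powr (- s / 2 - 1 / 2)) * indicator {1..} y \<partial>lborel) + ennreal (1 / (s - 1) - 1 / s) +
     (\<integral>\<^sup>+x. ennreal (?f x) * indicator {1..} x \<partial>lborel) = 
     ((\<integral>\<^sup>+x. ennreal (?f x) * indicator {1..} x \<partial>lborel) + 
     (\<integral>\<^sup>+y. ennreal (omega y * y powr (- s / 2 - 1 / 2)) * indicator {1..} y \<partial>lborel)) + ennreal (1 / (s - 1) - 1 / s)"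
    by (simp add: add_ac)
  also have "(\<integral>\<^sup>+x. ennreal (?f x) * indicator {1..} x \<partial>lborel) + 
     (\<integral>\<^sup>+y. ennreal (omega y * y powr (- s / 2 - 1 / 2)) * indicator {1..} y \<partial>lborel) =
     (\<integral>\<^sup>+x. ennreal (?f x) * indicator {1..} x + ennreal (omega x * x powr (- s / 2 - 1 / 2)) * indicator {1..} x \<partial>lborel)"
    by (rule nn_integral_add[symmetric]) measurable
  also have "\<dots> = (\<integral>\<^sup>+x. ennreal (omega x * (x powr (s / 2 - 1) + x powr (- s / 2 - 1 / 2))) * indicator {1..} x \<partial>lborel)"
    by (intro nn_integral_cong) 
      (auto simp: indicator_def ennreal_plus[symmetric] omega_nonneg distrib_left simp del: ennreal_plus)
  finally show ?thesis .
qed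

text \<open>
  The integral of \<open>omega x * (x powr (s / 2 - 1) + x powr (- s / 2 - 1 / 2))\<close> over \<open>[1, \<infinity>)\<close> is a
  cosh transform, hence a power series in \<open>(s - 1 / 2)\<^sup>2\<close>. Its coefficients are nonnegative, so
  Tonelli applies without any integrability condition, and the growth of the resulting entire
  function can be read off from its values at real \<open>s > 1\<close>.
\<close>

definition phi_coeff_nn :: "nat \<Rightarrow> ennreal" where
  "phi_coeff_nn k = (\<integral>\<^sup>+x. ennreal (omega x * (x powr (- 3 / 4) * (2 * ((ln x / 2) ^ (2 * k) / fact (2 * k))))) * indicator {1..} x \<partial>lborel)"

definition phi_coeff :: "nat \<Rightarrow> real" where
  "phi_coeff k = enn2real (phi_coeff_nn k)"

lemma phi_coeff_nonneg: "phi_coeff k \<ge> 0"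
  by (simp add: phi_coeff_def)

lemma cosh_even_sums: "(\<lambda>k. x ^ (2 * k) / fact (2 * k)) sums cosh (x :: real)"
proof -
  have "(\<lambda>k. (\<lambda>n. if even n then x ^ n /\<^sub>R fact n else 0) (2 * k)) sums cosh x"
    by (subst sums_mono_reindex[of "\<lambda>k. 2 * k"]) (auto simp: strict_mono_def cosh_converges elim!: evenE)
  thus ?thesis by (simp add: divide_inverse mult.commute)
qed

text \<open>The exponents s / 2 - 1 and - s / 2 - 1 / 2 lie symmetrically about - 3 / 4 at distance
  (s - 1 / 2) / 2. The sum of the two powers is thus 2 x^(-3/4) cosh ((s - 1/2) ln x / 2), with only
  even powers of s - 1/2 in its expansion.\<close>

lemma phi_coeff_sums:
  fixes s :: real
  assumes s: "s > 1"
  shows "(\<lambda>k. phi_coeff k * (s - 1 / 2) ^ (2 * k)) sums 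
     (pi powr (- s / 2) * Gamma (s / 2) * zeta_sum s - (1 / (s - 1) - 1 / s))"
proof -
  define y where "y = s - 1 / 2"
  have y: "y > 0" using s by (simp add: y_def)
  let ?F = "pi powr (- s / 2) * Gamma (s / 2) * zeta_sum s"
  have "(\<integral>\<^sup>+x. ennreal (omega x * (x powr (s / 2 - 1) + x powr (- s / 2 - 1 / 2))) * indicator {1..} x \<partial>lborel) =
     (\<integral>\<^sup>+x. (\<Sum>k. ennreal (y ^ (2 * k)) * (ennreal (omega x * (x powr (- 3 / 4) * (2 * ((ln x / 2) ^ (2 * k) / fact (2 * k))))) * indicator {1..} x)) \<partial>lborel)"
  proof (intro nn_integral_cong)
    fix x :: real
    show "ennreal (omega x * (x powr (s / 2 - 1) + x powr (- s / 2 - 1 / 2))) * indicator {1..} x =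
     (\<Sum>k. ennreal (y ^ (2 * k)) * (ennreal (omega x * (x powr (- 3 / 4) * (2 * ((ln x / 2) ^ (2 * k) / fact (2 * k))))) * indicator {1..} x))"
    proof (cases "x \<ge> 1")
      case True
      hence x: "x > 0" by simp
      have "(\<lambda>k. omega x * (x powr (- 3 / 4) * (2 * ((y * ln x / 2) ^ (2 * k) / fact (2 * k))))) sums 
         (omega x * (x powr (- 3 / 4) * (2 * cosh (y * ln x / 2))))"
        by (intro sums_mult cosh_even_sums)
      also have "(\<lambda>k. omega x * (x powr (- 3 / 4) * (2 * ((y * ln x / 2) ^ (2 * k) / fact (2 * k))))) = 
        (\<lambda>k. y ^ (2 * k) * (omega x * (x powr (- 3 / 4) * (2 * ((ln x / 2) ^ (2 * k) / fact (2 * k))))))"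
        by (simp add: fun_eq_iff power_mult_distrib power_divide)
      also have "x powr (- 3 / 4) * (2 * cosh (y * ln x / 2)) = x powr (- 3 / 4) * (x powr (y / 2) + x powr (- y / 2))"
        using x by (simp add: cosh_field_def powr_def)
      also have "\<dots> = x powr (s / 2 - 1) + x powr (- s / 2 - 1 / 2)"
      proof -
        have "- 3 / 4 + y / 2 = s / 2 - 1" "- 3 / 4 + - y / 2 = - s / 2 - 1 / 2"
          by (simp_all add: y_def field_simps)
        thus ?thesis using x by (simp only: distrib_left powr_add[symmetric])
      qed
      finally have sm: "(\<lambda>k. y ^ (2 * k) * (omega x * (x powr (- 3 / 4) * (2 * ((ln x / 2) ^ (2 * k) / fact (2 * k)))))) sums
         (omega x * (x powr (s / 2 - 1) + x powr (- s / 2 - 1 / 2)))" .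
      have nn: "0 \<le> omega x * (x powr (- 3 / 4) * (2 * ((ln x / 2) ^ (2 * k) / fact (2 * k))))" for k
        using omega_nonneg[OF x] by (auto intro!: mult_nonneg_nonneg divide_nonneg_nonneg)
      have "ennreal (omega x * (x powr (s / 2 - 1) + x powr (- s / 2 - 1 / 2))) = 
         (\<Sum>k. ennreal (y ^ (2 * k) * (omega x * (x powr (- 3 / 4) * (2 * ((ln x / 2) ^ (2 * k) / fact (2 * k)))))))"
        using sm y by (subst suminf_ennreal2[OF mult_nonneg_nonneg[OF _ nn]]) (auto simp: sums_iff)
      also have "\<dots> = (\<Sum>k. ennreal (y ^ (2 * k)) * ennreal (omega x * (x powr (- 3 / 4) * (2 * ((ln x / 2) ^ (2 * k) / fact (2 * k))))))"
        using nn by (intro suminf_cong ennreal_mult) auto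
      finally show ?thesis using True by simp
    qed auto
  qed
  also have "\<dots> = (\<Sum>k. ennreal (y ^ (2 * k)) * phi_coeff_nn k)"
    unfolding phi_coeff_nn_def by (subst nn_integral_suminf; (subst nn_integral_cmult)?) simp_all
  finally have eq: "ennreal ?F = (\<Sum>k. ennreal (y ^ (2 * k)) * phi_coeff_nn k) + ennreal (1 / (s - 1) - 1 / s)"
    using nn_integral_omega_split[OF s] by simp
  have F: "?F \<ge> 0" using s
    by (auto intro!: mult_nonneg_nonneg Gamma_real_nonneg suminf_nonneg summable_zeta_sum simp: zeta_sum_def simp del: of_nat_Suc)
  have fin: "(\<Sum>k. ennreal (y ^ (2 * k)) * phi_coeff_nn k) < top"
  proof -
    have "(\<Sum>k. ennreal (y ^ (2 * k)) * phi_coeff_nn k) \<le> ennreal ?F" unfolding eq by simp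
    thus ?thesis by (rule le_less_trans) simp
  qed
  have t: "ennreal (y ^ (2 * k)) * phi_coeff_nn k = ennreal (phi_coeff k * y ^ (2 * k))" for k
  proof -
    \<comment> \<open>\<open>enn2real\<close> would turn an infinite coefficient into 0. A single
      convergent evaluation at y > 0 shows that every coefficient is finite, so nothing is
      lost.\<close>
    have "ennreal (y ^ (2 * k)) * phi_coeff_nn k < top"
      using fin by (rule ennreal_suminf_lessD)
    hence "phi_coeff_nn k < top" using y by (auto simp: ennreal_mult_less_top)
    hence "phi_coeff_nn k = ennreal (phi_coeff k)" by (simp add: phi_coeff_def)
    thus ?thesis using y phi_coeff_nonneg by (simp add: ennreal_mult'' mult.commute)
  qed
  have nn: "phi_coeff k * y ^ (2 * k) \<ge> 0" for k using y phi_coeff_nonneg by (auto intro!: mult_nonneg_nonneg)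
  have sm: "summable (\<lambda>k. phi_coeff k * y ^ (2 * k))"
    using fin unfolding t by (intro summable_suminf_not_top nn) auto
  have "1 / (s - 1) - 1 / s \<ge> 0" using s by (simp add: field_simps)
  hence "ennreal ?F = ennreal ((\<Sum>k. phi_coeff k * y ^ (2 * k)) + (1 / (s - 1) - 1 / s))"
    using eq unfolding t suminf_ennreal2[OF nn sm] by (subst ennreal_plus) (auto intro!: suminf_nonneg sm nn)
  hence "?F = (\<Sum>k. phi_coeff k * y ^ (2 * k)) + (1 / (s - 1) - 1 / s)"
    using F \<open>1 / (s - 1) - 1 / s \<ge> 0\<close> suminf_nonneg[OF sm nn] by (subst (asm) ennreal_inj) auto
  thus ?thesis using sm unfolding y_def by (simp add: sums_iff)
qed

section \<open>Analytic continuation of the zeta function\<close>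

text \<open>In the variable v = (s - 1/2)^2 this is the completed zeta function with its polar terms
  1 / (s - 1) - 1 / s removed.\<close>

definition Phi :: "complex \<Rightarrow> complex" where
  "Phi v = (\<Sum>k. of_real (phi_coeff k) * v ^ k)"

lemma summable_phi_coeff: "summable (\<lambda>k. phi_coeff k * r ^ k)" if "r \<ge> 0" for r :: real
proof -
  \<comment> \<open>This makes s - 1/2 = sqrt r + 1, so s > 1 and r \<le> (s - 1/2)^2.\<close>
  define s where "s = sqrt r + 3 / 2"
  have s: "s > 1" using that real_sqrt_ge_zero[OF that] unfolding s_def by linarith
  have "summable (\<lambda>k. phi_coeff k * (s - 1 / 2) ^ (2 * k))"
    using phi_coeff_sums[OF s] by (simp add: sums_iff)
  thus ?thesis
  proof (rule summable_comparison_test'[where N = 0])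
    fix k
    have "r = sqrt r ^ 2" using that by simp
    also have "\<dots> \<le> (s - 1 / 2) ^ 2" unfolding s_def using that by (intro power_mono) auto
    finally have "r ^ k \<le> ((s - 1 / 2) ^ 2) ^ k" using that by (intro power_mono)
    thus "norm (phi_coeff k * r ^ k) \<le> phi_coeff k * (s - 1 / 2) ^ (2 * k)"
      using phi_coeff_nonneg[of k] that by (simp add: power_mult mult_left_mono)
  qed
qed

lemma Phi_summable_norm: "summable (\<lambda>k. norm (of_real (phi_coeff k) * v ^ k :: complex))"
  using summable_phi_coeff[of "norm v"] by (simp add: norm_mult norm_power phi_coeff_nonneg)

lemma Phi_sums: "(\<lambda>k. of_real (phi_coeff k) * v ^ k) sums Phi v"
  unfolding Phi_def using summable_norm_cancel[OF Phi_summable_norm] by (rule summable_sums)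

lemma Phi_holomorphic: "Phi holomorphic_on A"
proof -
  have "Phi holomorphic_on ball 0 r" for r
    by (rule power_series_holomorphic[where a = "\<lambda>k. of_real (phi_coeff k)"]) (use Phi_sums in simp)
  hence "\<exists>f'. (Phi has_field_derivative f') (at z)" for z
    using holomorphic_derivI[of Phi "ball 0 (norm z + 1)" z] by auto
  thus ?thesis by (intro holomorphic_onI) (auto simp: field_differentiable_def intro: has_field_derivative_at_within)
qed

lemma Phi_of_real:
  assumes s: "s > 1"
  shows "Phi (of_real ((s - 1 / 2) ^ 2)) = of_real (pi powr (- s / 2) * Gamma (s / 2) * zeta_sum s - (1 / (s - 1) - 1 / s))"
proof -
  have "(\<lambda>k. complex_of_real (phi_coeff k * (s - 1 / 2) ^ (2 * k))) sums 
     of_real (pi powr (- s / 2) * Gamma (s / 2) * zeta_sum s - (1 / (s - 1) - 1 / s))"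
    using phi_coeff_sums[OF s] by (rule sums_of_real)
  also have "(\<lambda>k. complex_of_real (phi_coeff k * (s - 1 / 2) ^ (2 * k))) =
     (\<lambda>k. of_real (phi_coeff k) * of_real ((s - 1 / 2) ^ 2) ^ k)"
    by (simp add: power_mult)
  finally show ?thesis using Phi_sums sums_unique2 by blast
qed

text \<open>With nonnegative coefficients the modulus on a disc about 0 is bounded by the value at
  its positive real boundary point, and there \<open>Phi\<close> is known explicitly.\<close>

lemma norm_Phi_le:
  assumes s: "s > 1" and v: "norm v \<le> (s - 1 / 2) ^ 2"
  shows "norm (Phi v) \<le> pi powr (- s / 2) * Gamma (s / 2) * zeta_sum s"
proof -
  have "norm (Phi v) \<le> (\<Sum>k. norm (of_real (phi_coeff k) * v ^ k :: complex))"
    unfolding Phi_def by (rule summable_norm[OF Phi_summable_norm])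
  also have "\<dots> \<le> (\<Sum>k. phi_coeff k * (s - 1 / 2) ^ (2 * k))"
  proof (intro suminf_le Phi_summable_norm)
    show "summable (\<lambda>k. phi_coeff k * (s - 1 / 2) ^ (2 * k))"
      using phi_coeff_sums[OF s] by (simp add: sums_iff)
    show "norm (of_real (phi_coeff k) * v ^ k :: complex) \<le> phi_coeff k * (s - 1 / 2) ^ (2 * k)" for k
      using power_mono[OF v, of k] phi_coeff_nonneg[of k] by (simp add: norm_mult norm_power power_mult mult_left_mono)
  qed
  also have "\<dots> = pi powr (- s / 2) * Gamma (s / 2) * zeta_sum s - (1 / (s - 1) - 1 / s)"
    using phi_coeff_sums[OF s] by (simp add: sums_iff)
  also have "\<dots> \<le> pi powr (- s / 2) * Gamma (s / 2) * zeta_sum s"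
    using s by (simp add: field_simps)
  finally show ?thesis .
qed

text \<open>
  \<open>reduced_xi (s * (s - 1))\<close> is \<open>s * (s - 1) * \<pi> powr (- s / 2) * \<Gamma>(s / 2) * \<zeta>(s)\<close>. The variable
  \<open>s * (s - 1)\<close> builds in the functional equation and halves the order of growth, so that no
  exponential factor survives in the product formula.
\<close>

definition reduced_xi :: "complex \<Rightarrow> complex" where
  "reduced_xi w = 1 + w * Phi (w + 1 / 4)"

lemma reduced_xi_0 [simp]: "reduced_xi 0 = 1"
  by (simp add: reduced_xi_def)

lemma reduced_xi_holomorphic [holomorphic_intros]:
  "f holomorphic_on A \<Longrightarrow> (\<lambda>x. reduced_xi (f x)) holomorphic_on A"
  unfolding reduced_xi_def
  by (intro holomorphic_intros holomorphic_on_compose_gen[OF _ Phi_holomorphic[of UNIV], unfolded o_def]) auto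

text \<open>The polar terms 1 / (s - 1) - 1 / s equal 1 / (s (s - 1)); multiplied by s (s - 1) they
  are the summand 1 in \<open>reduced_xi\<close>.\<close>

lemma reduced_xi_of_real:
  assumes s: "s > 1"
  shows "reduced_xi (of_real (s * (s - 1))) = of_real (s * (s - 1) * (pi powr (- s / 2) * Gamma (s / 2) * zeta_sum s))"
proof -
  have "complex_of_real (s * (s - 1)) + 1 / 4 = of_real (s * (s - 1) + 1 / 4)" by simp
  also have "s * (s - 1) + 1 / 4 = (s - 1 / 2) ^ 2" by (simp add: power2_eq_square algebra_simps)
  finally have arg: "complex_of_real (s * (s - 1)) + 1 / 4 = of_real ((s - 1 / 2) ^ 2)" .
  have "reduced_xi (of_real (s * (s - 1))) = 
     of_real (1 + s * (s - 1) * (pi powr (- s / 2) * Gamma (s / 2) * zeta_sum s - (1 / (s - 1) - 1 / s)))"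
    unfolding reduced_xi_def arg Phi_of_real[OF s] by simp
  also have "1 + s * (s - 1) * (pi powr (- s / 2) * Gamma (s / 2) * zeta_sum s - (1 / (s - 1) - 1 / s)) =
     s * (s - 1) * (pi powr (- s / 2) * Gamma (s / 2) * zeta_sum s)"
    using s by (simp add: right_diff_distrib) (simp add: field_simps)
  finally show ?thesis .
qed

lemma norm_reduced_xi_le:
  assumes s: "s > 1" and v: "norm w \<le> s * (s - 1)"
  shows "norm (reduced_xi w) \<le> 1 + s ^ 2 * (pi powr (- s / 2) * Gamma (s / 2) * zeta_sum s)"
proof -
  have "norm (w + 1 / 4) \<le> s * (s - 1) + 1 / 4" using v norm_triangle_ineq[of w "1/4"] by (simp add: norm_divide)
  also have "\<dots> = (s - 1 / 2) ^ 2" by (simp add: power2_eq_square algebra_simps)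
  finally have "norm (Phi (w + 1 / 4)) \<le> pi powr (- s / 2) * Gamma (s / 2) * zeta_sum s"
    by (rule norm_Phi_le[OF s])
  moreover have "norm w \<le> s ^ 2" using v s by (simp add: power2_eq_square algebra_simps)
  ultimately have "norm (w * Phi (w + 1 / 4)) \<le> s ^ 2 * (pi powr (- s / 2) * Gamma (s / 2) * zeta_sum s)"
    unfolding norm_mult by (intro mult_mono) auto
  thus ?thesis unfolding reduced_xi_def using norm_triangle_ineq[of 1 "w * Phi (w + 1 / 4)"] by simp
qed

text \<open>The completed zeta function divided by its Gamma factor. The pole at s = 0 is absorbed
  by rGamma(s/2) / s = rGamma(s/2 + 1) / 2, so the formula is holomorphic off 1. The value 0 at 1 is
  the convention of \<open>zeta\<close>.\<close>

definition zeta_cont :: "complex \<Rightarrow> complex" where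
  "zeta_cont s = (if s = 1 then 0 else of_real pi powr (s / 2) *
     (rGamma (s / 2) * (Phi (s * (s - 1) + 1 / 4) - 1 / (1 - s)) - rGamma (s / 2 + 1) / 2))"

lemma zeta_cont_holomorphic: "zeta_cont holomorphic_on (- {1})"
proof -
  have "(\<lambda>s. of_real pi powr (s / 2) *
     (rGamma (s / 2) * (Phi (s * (s - 1) + 1 / 4) - 1 / (1 - s)) - rGamma (s / 2 + 1) / 2)) holomorphic_on (- {1})"
    by (intro holomorphic_intros holomorphic_on_compose_gen[OF _ Phi_holomorphic[of UNIV], unfolded o_def]) auto
  thus ?thesis by (rule holomorphic_transform) (auto simp: zeta_cont_def)
qed

lemma zeta_cont_eq_reduced_xi:
  assumes "s \<noteq> 0" "s \<noteq> 1"
  shows "zeta_cont s = of_real pi powr (s / 2) * rGamma (s / 2) * reduced_xi (s * (s - 1)) / (s * (s - 1))"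
proof -
  have "rGamma (s / 2 + 1) / 2 = rGamma (s / 2) / s"
    using rGamma_plus1[of "s / 2"] assms by (simp add: field_simps)
  moreover have "Phi (s * (s - 1) + 1 / 4) - 1 / (1 - s) - 1 / s = reduced_xi (s * (s - 1)) / (s * (s - 1))"
    using assms by (simp add: reduced_xi_def divide_simps) (simp add: algebra_simps)
  moreover have "r * p - r / s = r * q" if "p - 1 / s = q" for r p q :: complex
    using that by (auto simp: right_diff_distrib)
  ultimately have "rGamma (s / 2) * (Phi (s * (s - 1) + 1 / 4) - 1 / (1 - s)) - rGamma (s / 2 + 1) / 2 =
     rGamma (s / 2) * (reduced_xi (s * (s - 1)) / (s * (s - 1)))"
    by simp
  thus ?thesis using assms by (simp add: zeta_cont_def)
qed

lemma zeta_cont_of_real: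
  assumes s: "s > 1"
  shows "zeta_cont (of_real s) = of_real (zeta_sum s)"
proof -
  have "zeta_cont (of_real s) = of_real (pi powr (s / 2)) * of_real (rGamma (s / 2)) * reduced_xi (of_real (s * (s - 1))) / of_real (s * (s - 1))"
    using s zeta_cont_eq_reduced_xi[of "of_real s"] rGamma_complex_of_real[of "s / 2"] powr_of_real[of pi "s / 2"] by simp
  also have "\<dots> = of_real (pi powr (s / 2) * rGamma (s / 2) * (pi powr (- s / 2) * Gamma (s / 2) * zeta_sum s))"
    unfolding reduced_xi_of_real[OF s] using s by simp
  also have "pi powr (s / 2) * rGamma (s / 2) * (pi powr (- s / 2) * Gamma (s / 2) * zeta_sum s) = zeta_sum s"
  proof -
    have "Gamma (s / 2) > 0" using s by (intro Gamma_real_pos) simp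
    thus ?thesis by (simp add: powr_minus rGamma_inverse_Gamma field_simps)
  qed
  finally show ?thesis .
qed

section \<open>Agreement with the Dirichlet series\<close>

lemma norm_zeta_term: "norm (of_nat (Suc n) powr (- s) :: complex) = real (Suc n) powr (- Re s)"
  by (subst norm_powr_real_powr) auto

lemma dirichlet_series_summable:
  assumes "Re s > 1"
  shows "summable (\<lambda>n. of_nat (Suc n) powr (- s) :: complex)"
  by (rule summable_norm_cancel) (unfold norm_zeta_term, rule summable_zeta_sum[OF assms])

lemma dirichlet_series_holomorphic:
  "(\<lambda>s. \<Sum>n. of_nat (Suc n) powr (- s) :: complex) holomorphic_on {s. Re s > 1}"
proof (rule holomorphic_uniform_sequence[where f = "\<lambda>N s. \<Sum>n<N. of_nat (Suc n) powr (- s)"])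
  show "open {s. 1 < Re s}" by (rule open_halfspace_Re_gt)
  show "(\<lambda>s. \<Sum>n<N. of_nat (Suc n) powr (- s) :: complex) holomorphic_on {s. 1 < Re s}" for N
    by (intro holomorphic_intros) (auto simp del: of_nat_Suc)
  fix x :: complex assume x: "x \<in> {s. 1 < Re s}"
  define d where "d = (Re x - 1) / 2"
  have d: "d > 0" using x by (simp add: d_def)
  have re: "Re y \<ge> 1 + d" if "y \<in> cball x d" for y
    using that abs_Re_le_cmod[of "x - y"] by (simp add: dist_norm d_def field_simps abs_le_iff)
  have "uniform_limit (cball x d) (\<lambda>N s. \<Sum>n<N. of_nat (Suc n) powr (- s) :: complex) (\<lambda>s. \<Sum>n. of_nat (Suc n) powr (- s)) sequentially"
  proof (rule Weierstrass_m_test)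
    show "summable (\<lambda>n. real (Suc n) powr (- (1 + d)))" using d by (intro summable_zeta_sum) simp
    show "norm (of_nat (Suc n) powr (- s) :: complex) \<le> real (Suc n) powr (- (1 + d))" if "s \<in> cball x d" for n s
      unfolding norm_zeta_term using re[OF that] by (intro powr_mono) auto
  qed
  moreover have "cball x d \<subseteq> {s. 1 < Re s}" using re d by force
  ultimately show "\<exists>d>0. cball x d \<subseteq> {s. 1 < Re s} \<and> uniform_limit (cball x d) (\<lambda>N s. \<Sum>n<N. of_nat (Suc n) powr (- s) :: complex) (\<lambda>s. \<Sum>n. of_nat (Suc n) powr (- s)) sequentially"
    using d by blast
qed

text \<open>The integral representation was obtained for real s > 1 only. Both sides are holomorphic
  on the half-plane, so the identity theorem carries the equality over from the half-line.\<close>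

lemma zeta_cont_sums:
  assumes s: "Re s > 1"
  shows "(\<lambda>n. of_nat (Suc n) powr (- s)) sums zeta_cont s"
proof -
  have "zeta_cont s - (\<Sum>n. of_nat (Suc n) powr (- s)) = 0"
  proof (rule analytic_continuation[where f = "\<lambda>s. zeta_cont s - (\<Sum>n. of_nat (Suc n) powr (- s))" and U = "of_real ` {1<..}" and S = "{s. Re s > 1}" and \<xi> = 2])
    show "(\<lambda>s. zeta_cont s - (\<Sum>n. of_nat (Suc n) powr - s)) holomorphic_on {s. 1 < Re s}"
      by (intro holomorphic_on_diff dirichlet_series_holomorphic holomorphic_on_subset[OF zeta_cont_holomorphic]) auto
    show "open {s. 1 < Re s}" by (rule open_halfspace_Re_gt)
    show "connected {s. 1 < Re s}" by (intro convex_connected convex_halfspace_Re_gt)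
    have "(2 :: real) islimpt {1<..}" by (intro open_imp_islimpt) auto
    hence "complex_of_real 2 islimpt of_real ` {1<..}"
      unfolding islimpt_approachable
      by (metis (no_types, lifting) dist_of_real image_eqI of_real_eq_iff)
    thus "2 islimpt complex_of_real ` {1<..}" by simp
  next
    fix z :: complex assume "z \<in> of_real ` {1<..}"
    then obtain x where x: "z = of_real x" "x > 1" by auto
    have "(\<lambda>n. complex_of_real (real (Suc n) powr (- x))) sums of_real (zeta_sum x)"
      unfolding zeta_sum_def using summable_zeta_sum[OF x(2)] by (intro sums_of_real summable_sums)
    also have "(\<lambda>n. complex_of_real (real (Suc n) powr (- x))) = (\<lambda>n. of_nat (Suc n) powr (- of_real x))"
    proof
      fix n show "complex_of_real (real (Suc n) powr (- x)) = of_nat (Suc n) powr (- of_real x)"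
        using powr_of_real[of "real (Suc n)" "-x"] by (simp del: of_nat_Suc)
    qed
    finally show "zeta_cont z - (\<Sum>n. of_nat (Suc n) powr - z) = 0"
      using zeta_cont_of_real[OF x(2)] x by (simp add: sums_iff)
  qed (use s in auto)
  thus ?thesis using dirichlet_series_summable[OF s] by (simp add: sums_iff)
qed

lemma zeta_eq_zeta_cont: "zeta = zeta_cont"
  unfolding zeta_def
proof (rule the_equality)
  show "zeta_cont holomorphic_on (- {1}) \<and> zeta_cont 1 = 0 \<and>
             (\<forall>s. Re s > 1 \<longrightarrow> (\<lambda>n. of_nat (Suc n) powr (- s)) sums zeta_cont s)"
    using zeta_cont_holomorphic zeta_cont_sums by (simp add: zeta_cont_def)
next
  fix f assume f: "f holomorphic_on (- {1}) \<and> f 1 = 0 \<and> (\<forall>s. Re s > 1 \<longrightarrow> (\<lambda>n. of_nat (Suc n) powr (- s)) sums f s)"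
  show "f = zeta_cont"
  proof
    fix z show "f z = zeta_cont z"
    proof (cases "z = 1")
      case False
      show ?thesis
      proof (rule analytic_continuation_open[where s = "{s. Re s > 1}" and s' = "- {1}" and f = f and g = zeta_cont and z = z])
        show "{s. 1 < Re s} \<noteq> {}" by (auto intro!: exI[of _ 2])
        show "connected (- {1 :: complex})" by (intro connected_punctured_universe) simp
        show "f z = zeta_cont z" if "z \<in> {s. 1 < Re s}" for z
          using that f zeta_cont_sums[of z] sums_unique2 by blast
      qed (use f False zeta_cont_holomorphic open_halfspace_Re_gt in auto)
    qed (use f in \<open>simp add: zeta_cont_def\<close>)
  qed
qed

lemma zeta_eq_reduced_xi:
  assumes "s \<noteq> 0" "s \<noteq> 1"
  shows "zeta s = of_real pi powr (s / 2) * rGamma (s / 2) * reduced_xi (s * (s - 1)) / (s * (s - 1))"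
  unfolding zeta_eq_zeta_cont by (rule zeta_cont_eq_reduced_xi[OF assms])

lemma reduced_xi_zero_RH:
  assumes RH: Riemann_Hypothesis and a: "reduced_xi a = 0"
  obtains t :: real where "a = - of_real (t ^ 2 + 1 / 4)" "t \<ge> 0"
proof -
  \<comment> \<open>The principal root gives Re s \<ge> 1/2, away from 0 and from the trivial zeros.
    The value s = 1 would mean a = 0, where \<open>reduced_xi\<close> is 1.\<close>
  define s where "s = 1 / 2 + csqrt (1 / 4 + a)"
  have sa: "s * (s - 1) = a" 
    using power2_csqrt[of "1 / 4 + a"] by (simp add: s_def power2_eq_square algebra_simps)
  have Re: "Re s \<ge> 1 / 2" using Re_csqrt[of "1 / 4 + a"] by (simp add: s_def)
  have s0: "s \<noteq> 0" using Re by auto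
  have s1: "s \<noteq> 1" using sa a by auto
  have "zeta s = 0" using zeta_eq_reduced_xi[OF s0 s1] sa a by simp
  moreover have "s \<noteq> - 2 * of_nat n" for n using Re by (auto simp: complex_eq_iff)
  ultimately have "nontrivial_zeta_zero s" using s1 by (simp add: nontrivial_zeta_zero_def)
  hence "Re s = 1 / 2" using RH by (simp add: Riemann_Hypothesis_def)
  hence s: "s = Complex (1 / 2) (Im s)" by (simp add: complex_eq_iff)
  have "s * (s - 1) = - of_real (Im s ^ 2 + 1 / 4)"
    by (subst (1 2) s) (simp add: complex_eq_iff power2_eq_square)
  thus ?thesis using that[of "\<bar>Im s\<bar>"] sa by simp
qed

section \<open>The product formula\<close>

lemma entire_factor_zero:
  fixes f :: "complex \<Rightarrow> complex"
  assumes f: "f holomorphic_on UNIV" and nz: "f w0 \<noteq> 0"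
  obtains g n where "g holomorphic_on UNIV" "g a \<noteq> 0" "\<And>z. f z = g z * (z - a) ^ n" 
proof -
  define n where "n = nat (zorder f a)"
  define h where "h = zor_poly f a"
  have "\<exists>w\<in>UNIV. f w \<noteq> 0" using nz by auto
  from zorder_exist_zero[OF f open_UNIV connected_UNIV UNIV_I this, of a] 
  obtain r where r: "r > 0" "h holomorphic_on cball a r"
      "\<And>w. w \<in> cball a r \<Longrightarrow> f w = h w * (w - a) ^ n \<and> h w \<noteq> 0"
    unfolding n_def h_def by blast
  define g where "g = (\<lambda>z. if z = a then h a else f z / (z - a) ^ n)"
  have gh: "g z = h z" if "z \<in> cball a r" for z using r(3)[OF that] by (auto simp: g_def)
  have "g holomorphic_on ball a r"
    by (rule holomorphic_transform[OF holomorphic_on_subset[OF r(2)]]) (use gh in auto)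
  moreover have "g holomorphic_on (- {a})"
  proof (rule holomorphic_transform)
    show "(\<lambda>z. f z / (z - a) ^ n) holomorphic_on (- {a})"
      by (intro holomorphic_intros holomorphic_on_subset[OF f]) auto
  qed (auto simp: g_def)
  ultimately have "g holomorphic_on (ball a r \<union> - {a})"
    by (intro holomorphic_on_Un) auto
  also have "ball a r \<union> - {a} = UNIV" using r by auto
  finally have "g holomorphic_on UNIV" .
  moreover have "g a \<noteq> 0" using gh[of a] r by auto
  moreover have "f z = g z * (z - a) ^ n" for z
  proof (cases "z = a")
    case True
    thus ?thesis using r(3)[of a] r(1) by (simp add: g_def)
  qed (simp add: g_def)
  ultimately show ?thesis using that by blast
qed

lemma entire_factor_zeros:
  fixes f :: "complex \<Rightarrow> complex"
  assumes f: "f holomorphic_on UNIV" and nz: "f w0 \<noteq> 0" and A: "finite A"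
  obtains g where "g holomorphic_on UNIV" "\<And>a. a \<in> A \<Longrightarrow> g a \<noteq> 0" 
    "\<And>z. f z = g z * (\<Prod>a\<in>A. (z - a) ^ nat (zorder f a))" 
proof -
  have "\<exists>g n. g holomorphic_on UNIV \<and> (\<forall>a\<in>A. g a \<noteq> 0) \<and> (\<forall>z. f z = g z * (\<Prod>a\<in>A. (z - a) ^ n a))"
    using A
  proof induction
    case empty
    show ?case using f by auto
  next
    case (insert b A)
    then obtain g n where g: "g holomorphic_on UNIV" "\<forall>a\<in>A. g a \<noteq> 0" "\<forall>z. f z = g z * (\<Prod>a\<in>A. (z - a) ^ n a)"
      by blast
    have "g w0 \<noteq> 0" using nz g(3) by auto
    then obtain h k where h: "h holomorphic_on UNIV" "h b \<noteq> 0" "\<And>z. g z = h z * (z - b) ^ k"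
      using entire_factor_zero[OF g(1)] by metis
    have "\<forall>a\<in>insert b A. h a \<noteq> 0" using h g(2) by auto
    moreover have "f z = h z * (\<Prod>a\<in>insert b A. (z - a) ^ (n(b := k)) a)" for z
    proof -
      have "(\<Prod>a\<in>A. (z - a) ^ (n(b := k)) a) = (\<Prod>a\<in>A. (z - a) ^ n a)"
        using insert.hyps by (intro prod.cong) auto
      thus ?thesis using insert.hyps g(3) h(3) by (simp add: mult_ac)
    qed
    ultimately show ?case using h(1) by blast
  qed
  then obtain g n where g: "g holomorphic_on UNIV" "\<And>a. a \<in> A \<Longrightarrow> g a \<noteq> 0"
    "\<And>z. f z = g z * (\<Prod>a\<in>A. (z - a) ^ n a)" by blast
  \<comment> \<open>The exponents produced by the induction are forced to be the orders of
    \<open>f\<close>, since the cofactor does not vanish on \<open>A\<close>.\<close>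
  have zo: "zorder f a = int (n a)" if a: "a \<in> A" for a
  proof (rule zorder_eqI)
    show "(\<lambda>z. g z * (\<Prod>a\<in>A - {a}. (z - a) ^ n a)) holomorphic_on UNIV"
      by (intro holomorphic_intros g)
    show "g a * (\<Prod>x\<in>A - {a}. (a - x) ^ n x) \<noteq> 0" using g(2)[OF a] A by auto
    show "f w = g w * (\<Prod>a\<in>A - {a}. (w - a) ^ n a) * (w - a) powi int (n a)" for w
      using a A by (simp add: g(3) prod.remove[of A a] mult_ac)
  qed auto
  show ?thesis by (rule that[OF g(1,2)]) (simp_all add: g(3) zo)
qed

text \<open>Schwarz's lemma for L / (4 B - L), rescaled to the unit disc. From Re L \<le> B the
  value L is strictly closer to 0 than to 4 B; using 4 B in place of 2 B provides the strictness.
  Then |L| \<le> |z| / R (4 B + |L|), and |z| / R \<le> 1/2 allows |L| to be moved to the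
  left.\<close>

lemma borel_caratheodory:
  fixes L :: "complex \<Rightarrow> complex"
  assumes L: "L holomorphic_on ball 0 R" and R: "R > 0" and B: "B > 0"
    and L0: "L 0 = 0" and Re: "\<And>z. norm z < R \<Longrightarrow> Re (L z) \<le> B"
    and z: "norm z \<le> R / 2"
  shows "norm (L z) \<le> 8 * B / R * norm z"
proof -
  define \<phi> where "\<phi> = (\<lambda>u. L (of_real R * u) / (of_real (4 * B) - L (of_real R * u)))"
  have mem: "of_real R * u \<in> ball 0 R" if "norm u < 1" for u :: complex
    using that R by (simp add: norm_mult)
  have ne: "of_real (4 * B) - L (of_real R * u) \<noteq> 0" if "norm u < 1" for u
  proof
    assume "of_real (4 * B) - L (of_real R * u) = 0"
    hence "Re (L (of_real R * u)) = 4 * B" by (simp add: complex_eq_iff)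
    thus False using Re[of "of_real R * u"] mem[OF that] B by auto
  qed
  have "norm (\<phi> (z / of_real R)) \<le> norm (z / of_real R)"
  proof (rule Schwarz_Lemma)
    show "\<phi> holomorphic_on ball 0 1" unfolding \<phi>_def
      using mem ne by (intro holomorphic_intros holomorphic_on_compose_gen[OF _ L, unfolded o_def]) auto
    show "\<phi> 0 = 0" by (simp add: \<phi>_def L0)
    show "norm (\<phi> u) < 1" if u: "norm u < 1" for u
    proof -
      define w where "w = L (of_real R * u)"
      have "Re w \<le> B" unfolding w_def using mem[OF u] by (intro Re) auto
      have "norm w ^ 2 < norm (of_real (4 * B) - w) ^ 2"
      proof -
        have "norm (of_real (4 * B) - w) ^ 2 - norm w ^ 2 = 8 * B * (2 * B - Re w)"
          unfolding cmod_power2 by (simp add: power2_eq_square algebra_simps)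
        also have "\<dots> > 0" using B \<open>Re w \<le> B\<close> by (intro mult_pos_pos) auto
        finally show ?thesis by simp
      qed
      hence "norm w < norm (of_real (4 * B) - w)" by (rule power2_less_imp_less) simp
      thus ?thesis by (simp add: \<phi>_def w_def norm_divide divide_less_eq)
    qed
    show "norm (z / of_real R) < 1" using z R by (simp add: norm_divide field_simps)
  qed
  moreover have n1: "norm (z / of_real R) < 1" using z R by (simp add: norm_divide field_simps)
  ultimately have "norm (L z) \<le> norm z / R * norm (of_real (4 * B) - L z)"
    using R ne[OF n1] by (simp add: \<phi>_def norm_divide divide_le_eq)
  also have "\<dots> \<le> norm z / R * (4 * B + norm (L z))"
    using R B norm_triangle_ineq4[of "of_real (4 * B)" "L z"] by (intro mult_left_mono) auto
  also have "\<dots> \<le> norm z / R * (4 * B) + norm (L z) / 2"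
    using R z mult_right_mono[of "norm z / R" "1 / 2" "norm (L z)"] by (simp add: algebra_simps field_simps)
  finally have "norm (L z) \<le> 2 * (norm z / R * (4 * B))" by simp
  thus ?thesis by (simp add: mult_ac)
qed

text \<open>The zeros in the disc of radius \<open>R\<close> are divided out, but the growth is
  measured on the circle of radius 2 \<open>R\<close>. There |z / a| \<ge> 2, so every factor 1 - z
  / a has modulus at least 1 and the quotient inherits the bound of \<open>f\<close>; the maximum
  principle brings it inside. The quotient is zero-free in the disc, so it has a logarithm to which
  Borel-Caratheodory applies.\<close>

lemma entire_zeros_times_exp:
  fixes f :: "complex \<Rightarrow> complex"
  assumes f: "f holomorphic_on UNIV" and f0: "f 0 = 1" and R: "R > 0" and B: "B > 0"
    and bound: "\<And>z. norm z = 2 * R \<Longrightarrow> norm (f z) \<le> exp B"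
  defines "A \<equiv> {a. norm a \<le> R \<and> f a = 0}"
  shows "finite A"
    and "\<exists>L. L holomorphic_on ball 0 R \<and> 
      (\<forall>z\<in>ball 0 R. f z = (\<Prod>a\<in>A. (1 - z / a) ^ nat (zorder f a)) * exp (L z)) \<and>
      (\<forall>z. norm z \<le> R / 2 \<longrightarrow> norm (L z) \<le> 8 * B / R * norm z)"
proof -
  show fin: "finite A"
  proof (cases "f constant_on UNIV")
    case True
    hence "A = {}" using f0 by (auto simp: A_def constant_on_def)
    thus ?thesis by simp
  next
    case False
    have "finite {z \<in> cball 0 R. f z = 0}"
      by (rule holomorphic_compact_finite_zeros[OF f]) (use False in auto)
    thus ?thesis by (simp add: A_def)
  qed
  have A0: "a \<noteq> 0" if "a \<in> A" for a using that f0 by (auto simp: A_def)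
  have "f 0 \<noteq> 0" using f0 by simp
  from entire_factor_zeros[OF f this fin] obtain g0 where g0: "g0 holomorphic_on UNIV"
    "\<And>a. a \<in> A \<Longrightarrow> g0 a \<noteq> 0" "\<And>z. f z = g0 z * (\<Prod>a\<in>A. (z - a) ^ nat (zorder f a))" by metis
  define P where "P = (\<lambda>z. \<Prod>a\<in>A. (1 - z / a) ^ nat (zorder f a))"
  define c where "c = (\<Prod>a\<in>A. (- a) ^ nat (zorder f a))"
  define g where "g = (\<lambda>z. g0 z * c)"
  have c0: "c \<noteq> 0" using A0 fin by (simp add: c_def)
  have fP: "f z = P z * g z" for z
  proof -
    have "(z - a) ^ nat (zorder f a) = (- a) ^ nat (zorder f a) * (1 - z / a) ^ nat (zorder f a)" if "a \<in> A" for a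
      using A0[OF that] by (simp add: power_mult_distrib[symmetric] algebra_simps)
    hence "(\<Prod>a\<in>A. (z - a) ^ nat (zorder f a)) = c * P z"
      unfolding c_def P_def prod.distrib[symmetric] by (intro prod.cong) auto
    thus ?thesis by (simp add: g0(3) g_def)
  qed
  have g_hol: "g holomorphic_on UNIV" unfolding g_def by (intro holomorphic_intros g0)
  have P0: "P 0 = 1" by (simp add: P_def)
  have g1: "g 0 = 1" using fP[of 0] f0 P0 by simp
  have P_ge: "norm (P z) \<ge> 1" if z: "norm z = 2 * R" for z
  proof -
    have "norm (1 - z / a) \<ge> 1" if a: "a \<in> A" for a
    proof -
      have "norm (z / a) \<ge> 2" using a A0[OF a] z by (simp add: norm_divide field_simps A_def)
      thus ?thesis using norm_triangle_ineq2[of "z / a" 1] by (simp add: norm_minus_commute)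
    qed
    hence "(\<Prod>a\<in>A. norm (1 - z / a) ^ nat (zorder f a)) \<ge> 1" by (intro prod_ge_1 one_le_power) auto
    thus ?thesis by (simp add: P_def prod_norm[symmetric] norm_power)
  qed
  have g_le: "norm (g z) \<le> exp B" if "norm z \<le> 2 * R" for z
  proof (rule maximum_modulus_frontier[where S = "cball 0 (2 * R)" and f = g])
    show "norm (g w) \<le> exp B" if "w \<in> frontier (cball 0 (2 * R))" for w
    proof -
      have w: "norm w = 2 * R" using that R by (simp add: frontier_cball)
      have "norm (g w) \<le> norm (P w) * norm (g w)" using P_ge[OF w] mult_right_mono[of 1 "norm (P w)" "norm (g w)"] by simp
      also have "\<dots> = norm (f w)" by (simp add: fP norm_mult)
      also have "\<dots> \<le> exp B" by (rule bound[OF w])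
      finally show ?thesis .
    qed
  qed (use that in \<open>auto intro: holomorphic_on_subset[OF g_hol] holomorphic_on_imp_continuous_on\<close>)
  have g_nz: "g z \<noteq> 0" if "norm z \<le> R" for z
    using that fP[of z] g0(2)[of z] c0 by (cases "z \<in> A") (auto simp: A_def g_def)
  have "g holomorphic_on ball 0 R" by (rule holomorphic_on_subset[OF g_hol]) auto
  then obtain L0 where L0: "L0 holomorphic_on ball 0 R" "\<And>z. z \<in> ball 0 R \<Longrightarrow> g z = exp (L0 z)"
    using contractible_imp_holomorphic_log[of g "ball 0 R"] g_nz convex_imp_contractible[of "ball 0 R"]
    by (metis convex_ball less_imp_le mem_ball_0)
  define L where "L = (\<lambda>z. L0 z - L0 0)"
  have L: "L holomorphic_on ball 0 R" unfolding L_def by (intro holomorphic_intros L0)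
  have "exp (L0 0) = 1" using L0(2)[of 0] R g1 by simp
  hence expL: "g z = exp (L z)" if "z \<in> ball 0 R" for z
    using L0(2)[OF that] by (simp add: L_def exp_diff)
  have ReL: "Re (L z) \<le> B" if z: "norm z < R" for z
  proof -
    have "exp (Re (L z)) = norm (g z)" using expL[of z] z by simp
    also have "\<dots> \<le> exp B" using z R by (intro g_le) auto
    finally show ?thesis by simp
  qed
  have "norm (L z) \<le> 8 * B / R * norm z" if "norm z \<le> R / 2" for z
    by (rule borel_caratheodory[OF L R B _ ReL that]) (auto simp: L_def)
  thus "\<exists>L. L holomorphic_on ball 0 R \<and> 
      (\<forall>z\<in>ball 0 R. f z = (\<Prod>a\<in>A. (1 - z / a) ^ nat (zorder f a)) * exp (L z)) \<and>
      (\<forall>z. norm z \<le> R / 2 \<longrightarrow> norm (L z) \<le> 8 * B / R * norm z)"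
    using L expL fP by (intro exI[of _ L]) (auto simp: P_def)
qed

text \<open>Half of s (s - 1) for s = 2 (n + 1). The circle of twice this radius then corresponds to
  an even integer s, where Gamma(s / 2) is n!.\<close>

definition xi_radius :: "nat \<Rightarrow> real" where
  "xi_radius n = real (Suc n) * (2 * real (Suc n) - 1)"

definition xi_zeros_upto :: "nat \<Rightarrow> complex set" where
  "xi_zeros_upto n = {a. norm a \<le> xi_radius n \<and> reduced_xi a = 0}"

abbreviation xi_mult :: "complex \<Rightarrow> nat" where
  "xi_mult a \<equiv> nat (zorder reduced_xi a)"

lemma xi_radius_ge: "xi_radius n \<ge> real (Suc n) ^ 2"
  by (simp add: xi_radius_def power2_eq_square algebra_simps)

lemma xi_radius_pos: "xi_radius n > 0"
  using xi_radius_ge[of n] by (intro less_le_trans[OF _ xi_radius_ge]) auto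

section \<open>Growth and factorisation of the reduced xi function\<close>

lemma zeta_sum_ge_1: "s > 1 \<Longrightarrow> zeta_sum s \<ge> 1"
  using sum_le_suminf[OF summable_zeta_sum, of s "{0}"] by (simp add: zeta_sum_def)

lemma zeta_sum_antimono:
  assumes "1 < s" "s \<le> t"
  shows "zeta_sum t \<le> zeta_sum s"
  unfolding zeta_sum_def using assms by (intro suminf_le summable_zeta_sum powr_mono) auto

lemma zeta_sum_2: "zeta_sum 2 = pi ^ 2 / 6"
proof -
  have "(\<lambda>n. real (Suc n) powr (- 2)) = (\<lambda>n. 1 / real ((n + 1)\<^sup>2))"
    by (auto simp: powr_minus inverse_eq_divide add.commute)
  thus ?thesis using inverse_squares_sums by (simp only: zeta_sum_def sums_iff)
qed

text \<open>The logarithm grows like n ln n while the radius grows like n^2: this is order 1/2 in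
  explicit form, coming from n! \<le> n^n.\<close>

lemma norm_reduced_xi_le_radius:
  assumes "norm w = 2 * xi_radius n"
  shows "norm (reduced_xi w) \<le> exp (ln 9 + (real n + 3) * ln (real n + 1))"
proof -
  define s where "s = 2 * real (Suc n)"
  have s: "s > 1" "s \<ge> 2" by (simp_all add: s_def)
  have "pi ^ 2 / 6 \<le> 2"
  proof -
    have "pi ^ 2 \<le> (32 / 10) ^ 2" using pi_approx by (intro power_mono) auto
    thus ?thesis by (simp add: power2_eq_square)
  qed
  hence z: "zeta_sum s \<le> 2" using zeta_sum_antimono[of 2 s] s by (simp add: zeta_sum_2)
  have "s / 2 = 1 + real n" by (simp add: s_def)
  hence "Gamma (s / 2) = fact n" using Gamma_fact[of n, where 'a = real] by (simp only:)
  also have "(fact n :: real) \<le> real n ^ n" using fact_le_power[where ?'a = real, of n] by simp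
  also have "\<dots> \<le> (real n + 1) ^ n" by (intro power_mono) auto
  finally have G: "Gamma (s / 2) \<le> (real n + 1) ^ n" .
  have p: "pi powr (- s / 2) \<le> 1" using s pi_gt3 powr_mono[of "- s / 2" 0 pi] by simp
  have "norm (reduced_xi w) \<le> 1 + s ^ 2 * (pi powr (- s / 2) * Gamma (s / 2) * zeta_sum s)"
    using assms by (intro norm_reduced_xi_le s) (simp add: s_def xi_radius_def)
  also have "pi powr (- s / 2) * Gamma (s / 2) * zeta_sum s \<le> 1 * (real n + 1) ^ n * 2"
    using G p z zeta_sum_ge_1[OF s(1)] s by (intro mult_mono mult_nonneg_nonneg Gamma_real_nonneg) auto
  also have "1 + s ^ 2 * (1 * (real n + 1) ^ n * 2) = 1 + 8 * (real n + 1) ^ (n + 2)"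
    by (simp add: s_def power_add power2_eq_square algebra_simps)
  also have "\<dots> \<le> 9 * (real n + 1) ^ (n + 2)" using one_le_power[of "real n + 1" "n + 2"] by simp
  also have "\<dots> \<le> 9 * (real n + 1) ^ (n + 3)" by (intro mult_left_mono power_increasing) auto
  also have "\<dots> = exp (ln 9 + (real n + 3) * ln (real n + 1))"
    using exp_of_nat_mult[of "n + 3" "ln (real n + 1)"] by (simp add: exp_add add.commute)
  finally show ?thesis by (simp add: mult_left_mono)
qed

text \<open>The error satisfies |L n z| \<le> 8 B / R |z| with B of size n ln n and R of size n^2,
  so it tends to 0. The convergence is uniform on discs, which later allows passing to second
  derivatives of \<open>L n\<close>.\<close>

lemma reduced_xi_hadamard:
  obtains L where "\<And>n. finite (xi_zeros_upto n)" "\<And>n. L n holomorphic_on ball 0 (xi_radius n)"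
    "\<And>n z. z \<in> ball 0 (xi_radius n) \<Longrightarrow> 
       reduced_xi z = (\<Prod>a\<in>xi_zeros_upto n. (1 - z / a) ^ xi_mult a) * exp (L n z)"
    "\<And>r. uniform_limit (ball 0 r) L (\<lambda>_. 0) sequentially"
proof -
  define B where "B n = ln 9 + (real n + 3) * ln (real n + 1)" for n
  have B: "B n > 0" for n unfolding B_def by (intro add_pos_nonneg) auto
  have hol: "reduced_xi holomorphic_on UNIV" using reduced_xi_holomorphic[OF holomorphic_on_ident] by simp
  note fac = entire_zeros_times_exp[OF hol reduced_xi_0 xi_radius_pos B norm_reduced_xi_le_radius[folded B_def]]
  have fin: "finite (xi_zeros_upto n)" for n
    unfolding xi_zeros_upto_def by (rule fac(1)[of n n]) auto
  have "\<forall>n. \<exists>L. L holomorphic_on ball 0 (xi_radius n) \<and>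
      (\<forall>z\<in>ball 0 (xi_radius n). reduced_xi z = (\<Prod>a\<in>xi_zeros_upto n. (1 - z / a) ^ xi_mult a) * exp (L z)) \<and>
      (\<forall>z. norm z \<le> xi_radius n / 2 \<longrightarrow> norm (L z) \<le> 8 * B n / xi_radius n * norm z)"
    unfolding xi_zeros_upto_def by (intro allI fac(2)) auto
  then obtain L where L: "\<And>n. L n holomorphic_on ball 0 (xi_radius n)"
      "\<And>n z. z \<in> ball 0 (xi_radius n) \<Longrightarrow> reduced_xi z = (\<Prod>a\<in>xi_zeros_upto n. (1 - z / a) ^ xi_mult a) * exp (L n z)"
      "\<And>n z. norm z \<le> xi_radius n / 2 \<Longrightarrow> norm (L n z) \<le> 8 * B n / xi_radius n * norm z"
    by metis
  have "uniform_limit (ball 0 r) L (\<lambda>_. 0) sequentially" for r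
  proof (rule uniform_limitI)
    fix e :: real assume e: "e > 0"
    have "filterlim (\<lambda>n. real (Suc n) ^ 2) at_top sequentially" by real_asymp
    hence ev1: "\<forall>\<^sub>F n in sequentially. real (Suc n) ^ 2 \<ge> 2 * r" by (simp add: filterlim_at_top)
    have "(\<lambda>n. 8 * B n / real (Suc n) ^ 2 * r) \<longlonglongrightarrow> 0" unfolding B_def by real_asymp
    hence ev2: "\<forall>\<^sub>F n in sequentially. 8 * B n / real (Suc n) ^ 2 * r < e" using e by (rule order_tendstoD)
    show "\<forall>\<^sub>F n in sequentially. \<forall>x\<in>ball 0 r. dist (L n x) 0 < e"
      using ev1 ev2
    proof eventually_elim
      case (elim n)
      show ?case
      proof
        fix x :: complex assume x: "x \<in> ball 0 r"
        have "norm (L n x) \<le> 8 * B n / xi_radius n * norm x"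
          using x elim(1) xi_radius_ge[of n] by (intro L(3)) auto
        also have "\<dots> \<le> 8 * B n / real (Suc n) ^ 2 * r"
          using x B[of n] xi_radius_ge[of n] xi_radius_pos[of n]
          by (intro mult_mono divide_left_mono mult_pos_pos divide_nonneg_nonneg) auto
        finally show "dist (L n x) 0 < e" using elim(2) by simp
      qed
    qed
  qed
  thus ?thesis using that[of L] fin L(1,2) by blast
qed

section \<open>Numerical information on the zeros\<close>

lemma zeta_sum_4_ge: "zeta_sum 4 \<ge> 1082 / 1000"
proof -
  have "(\<Sum>n<10. real (Suc n) powr (- 4)) \<le> zeta_sum 4"
    unfolding zeta_sum_def by (rule sum_le_suminf[OF summable_zeta_sum]) auto
  moreover have "(\<Sum>n<10. real (Suc n) powr (- 4)) = (\<Sum>n<10. 1 / real (Suc n) ^ 4)"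
    by (intro sum.cong refl) (simp add: powr_minus inverse_eq_divide del: of_nat_Suc)
  moreover have "(\<Sum>n<10. 1 / real (Suc n) ^ 4) \<ge> 1082 / 1000"
    by (simp add: lessThan_nat_numeral lessThan_Suc eval_nat_numeral)
  ultimately show ?thesis by linarith
qed

text \<open>Pulling a factor 2^10 out of each term with base at least 2 leaves the tail of zeta(2),
  whose value is known.\<close>

lemma zeta_sum_12_le: "zeta_sum 12 \<le> 1001 / 1000"
proof -
  have sm: "summable (\<lambda>n. real (Suc n) powr (- 12))" "summable (\<lambda>n. real (Suc n) powr (- 2))"
    by (rule summable_zeta_sum; simp)+
  have "zeta_sum 12 = (\<Sum>n. real (Suc (Suc n)) powr (- 12)) + 1"
    unfolding zeta_sum_def using suminf_split_head[OF sm(1)] by simp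
  also have "(\<Sum>n. real (Suc (Suc n)) powr (- 12)) \<le> (\<Sum>n. real (Suc (Suc n)) powr (- 2) / 1024)"
  proof (intro suminf_le)
    fix n
    have "real (Suc (Suc n)) powr (- 12) = real (Suc (Suc n)) powr (- 2) / real (Suc (Suc n)) powr 10"
      by (subst powr_diff[symmetric]) simp
    also have "\<dots> \<le> real (Suc (Suc n)) powr (- 2) / 2 powr 10"
      by (intro divide_left_mono powr_mono2 mult_pos_pos) auto
    finally show "real (Suc (Suc n)) powr (- 12) \<le> real (Suc (Suc n)) powr (- 2) / 1024" by simp
  next
    show "summable (\<lambda>n. real (Suc (Suc n)) powr (- 12))"
      using sm(1) by (subst summable_Suc_iff[of "\<lambda>n. real (Suc n) powr (- 12)"])
    show "summable (\<lambda>n. real (Suc (Suc n)) powr (- 2) / 1024)"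
      using sm(2) by (intro summable_divide) (subst summable_Suc_iff[of "\<lambda>n. real (Suc n) powr (- 2)"])
  qed
  also have "(\<Sum>n. real (Suc (Suc n)) powr (- 2) / 1024) = (\<Sum>n. real (Suc (Suc n)) powr (- 2)) / 1024"
    using sm(2) by (intro suminf_divide) (subst summable_Suc_iff[of "\<lambda>n. real (Suc n) powr (- 2)"])
  also have "(\<Sum>n. real (Suc (Suc n)) powr (- 2)) = zeta_sum 2 - 1"
    unfolding zeta_sum_def by (subst suminf_split_head[OF sm(2)]) simp
  also have "(zeta_sum 2 - 1) / 1024 + 1 \<le> 1001 / 1000"
  proof -
    have "pi ^ 2 \<le> (315 / 100) ^ 2" using pi_approx by (intro power_mono) auto
    thus ?thesis unfolding zeta_sum_2 by (simp add: power2_eq_square field_simps)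
  qed
  finally show ?thesis by simp
qed

definition xi_real :: "real \<Rightarrow> real" where
  "xi_real x = Re (reduced_xi (of_real x))"

lemma xi_real_eq: "s > 1 \<Longrightarrow> xi_real (s * (s - 1)) = s * (s - 1) * (pi powr (- s / 2) * Gamma (s / 2) * zeta_sum s)"
  unfolding xi_real_def by (subst reduced_xi_of_real) auto

text \<open>The arguments 2, 12, 132 and 182 are s (s - 1) for s = 2, 4, 12 and 14; at even s the
  Gamma factor is a factorial.\<close>

lemma xi_real_2: "xi_real 2 = pi / 3"
  using xi_real_eq[of 2] by (simp add: zeta_sum_2 powr_minus power2_eq_square field_simps)

lemma xi_real_12: "xi_real 12 = 12 * zeta_sum 4 / pi ^ 2"
  using xi_real_eq[of 4] Gamma_fact[of 1, where 'a = real] by (simp add: powr_minus field_simps)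

lemma xi_real_132: "xi_real 132 = 132 * 120 * zeta_sum 12 / pi ^ 6"
  using xi_real_eq[of 12] Gamma_fact[of 5, where 'a = real] by (simp add: powr_minus field_simps fact_numeral)

lemma xi_real_182: "xi_real 182 = 182 * 720 * zeta_sum 14 / pi ^ 7"
  using xi_real_eq[of 14] Gamma_fact[of 6, where 'a = real] by (simp add: powr_minus field_simps fact_numeral)

text \<open>Here 50 = 182 - 132, and 10/529 is the size for which 2 * (529/4) * (10/529) = 5 in the
  later count. The quotient of the two values is about 2.63, the exponential about 2.57.\<close>

lemma xi_real_ratio: "exp (50 * (10 / 529)) * xi_real 132 < xi_real 182"
proof -
  have e: "exp (50 * (10 / 529) :: real) \<le> 258 / 100"
  proof -
    \<comment> \<open>An upper bound for exp x with x near 1: exp (1 - x) \<ge> 2 - x, so exp x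
      \<le> e / (2 - x).\<close>
    have "exp (50 * (10 / 529) :: real) * exp (1 - 50 * (10 / 529)) = exp 1"
      by (subst exp_add[symmetric]) simp
    moreover have "exp (1 - 50 * (10 / 529) :: real) \<ge> 1 + (1 - 50 * (10 / 529))"
      by (rule exp_ge_add_one_self)
    ultimately have "exp (50 * (10 / 529) :: real) * (1 + (1 - 50 * (10 / 529))) \<le> exp 1"
      by (metis exp_ge_zero mult_left_mono)
    thus ?thesis using e_less_272 by simp
  qed
  have "exp (50 * (10 / 529)) * xi_real 132 \<le> 258 / 100 * (132 * 120 * (1001 / 1000) / pi ^ 6)"
    unfolding xi_real_132 using e zeta_sum_12_le zeta_sum_ge_1[of 12]
    by (intro mult_mono divide_right_mono) auto
  also have "\<dots> = (258 / 100 * 132 * 120 * (1001 / 1000) * pi) / pi ^ 7" by (simp add: field_simps power_numeral_reduce)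
  also have "\<dots> < 182 * 720 * 1 / pi ^ 7"
    using pi_approx by (intro divide_strict_right_mono) auto
  also have "\<dots> \<le> xi_real 182"
    unfolding xi_real_182 using zeta_sum_ge_1[of 14] by (intro divide_right_mono mult_left_mono) auto
  finally show ?thesis .
qed

text \<open>The number \<open>xi_real 2 ^ 6\<close> exceeds \<open>xi_real 12\<close> by only about
  0.2 percent, while (1 + 2/b)^6 exceeds 1 + 12/b by about 60 / b^2; hence b cannot be small. The
  bound 265/2 is 529/4 + 1/4.\<close>

lemma xi_real_small_ineq:
  fixes b :: real
  assumes b: "b > 0" and le: "xi_real 12 * (1 + 2 / b) ^ 6 \<le> xi_real 2 ^ 6 * (1 + 12 / b)"
  shows "b > 265 / 2"
proof (rule ccontr)
  assume "\<not> b > 265 / 2"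
  define u where "u = 1 / b"
  have u: "u \<ge> 1 / (265 / 2)" "u > 0" using b \<open>\<not> b > 265 / 2\<close> by (auto simp: u_def field_simps)
  have pos: "1 + 12 * u > 0" using u by linarith
  have "pi ^ 8 \<le> (31415927 / 10000000) ^ 8" using pi_approx by (intro power_mono) auto
  also have "\<dots> \<le> 474427 / 50" by (simp add: power_numeral_reduce)
  finally have p8: "pi ^ 8 \<le> 474427 / 50" .
  \<comment> \<open>Multiplication by pi^2 clears the denominator of \<open>xi_real 12\<close>;
    together with (pi / 3)^6 on the other side this leaves pi^8 / 729.\<close>
  have "12 * zeta_sum 4 * (1 + 2 * u) ^ 6 = pi ^ 2 * (xi_real 12 * (1 + 2 / b) ^ 6)"
    unfolding xi_real_12 u_def by (simp add: field_simps)
  also have "\<dots> \<le> pi ^ 2 * (xi_real 2 ^ 6 * (1 + 12 / b))" by (intro mult_left_mono le) auto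
  also have "\<dots> = pi ^ 8 / 729 * (1 + 12 * u)"
    unfolding xi_real_2 u_def by (simp add: power_divide power_numeral_reduce)
  also have "\<dots> \<le> 474427 / 50 / 729 * (1 + 12 * u)" using p8 pos by (intro mult_right_mono divide_right_mono) auto
  finally have 1: "12 * zeta_sum 4 * (1 + 2 * u) ^ 6 \<le> 474427 / 50 / 729 * (1 + 12 * u)" .
  have "12 * (1082 / 1000) * (1 + 2 * u) ^ 6 \<le> 12 * zeta_sum 4 * (1 + 2 * u) ^ 6"
    using zeta_sum_4_ge u by (intro mult_right_mono) auto
  with 1 have 2: "12 * (1082 / 1000) * (1 + 2 * u) ^ 6 \<le> 474427 / 50 / 729 * (1 + 12 * u)" by linarith
  have "(1 + 2 * u) ^ 6 \<ge> 1 + 12 * u + 60 * u ^ 2 + 160 * u ^ 3"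
  proof -
    have "(1 + 2 * u) ^ 6 = 1 + 12 * u + 60 * u ^ 2 + 160 * u ^ 3 + (240 * u ^ 4 + 192 * u ^ 5 + 64 * u ^ 6)"
      by (simp add: power_numeral_reduce algebra_simps)
    thus ?thesis using u by simp
  qed
  hence 3: "12 * (1082 / 1000) * (1 + 12 * u + 60 * u ^ 2 + 160 * u ^ 3) \<le> 474427 / 50 / 729 * (1 + 12 * u)"
    by (intro order.trans[OF mult_left_mono 2]) auto
  \<comment> \<open>The assumed lower bound for u turns the quadratic and cubic terms into multiples
    of u. The resulting linear inequality is false for such u.\<close>
  have "u ^ 2 \<ge> u / (265 / 2)" using mult_left_mono[OF u(1), of u] u by (simp add: power2_eq_square)
  moreover have "u ^ 3 \<ge> u / (265 / 2) ^ 2"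
    using mult_mono[OF u(1) u(1)] u mult_left_mono[of "1 / (265 / 2) * (1 / (265 / 2))" "u * u" u]
    by (simp add: power_numeral_reduce)
  ultimately have "12 * (1082 / 1000) * (1 + 12 * u + 60 * (u / (265 / 2)) + 160 * (u / (265 / 2) ^ 2)) \<le> 474427 / 50 / 729 * (1 + 12 * u)"
    by (intro order.trans[OF mult_left_mono 3] add_mono mult_left_mono) auto
  thus False using u by (simp add: field_simps)
qed

lemma xi_zeros_upto_RH:
  assumes Riemann_Hypothesis "a \<in> xi_zeros_upto n"
  shows "a = of_real (Re a)" "Re a \<le> - 1 / 4" "xi_mult a > 0"
proof -
  have "reduced_xi a = 0" using assms by (simp add: xi_zeros_upto_def)
  then obtain t :: real where t: "a = - of_real (t ^ 2 + 1 / 4)" "t \<ge> 0"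
    using reduced_xi_zero_RH[OF assms(1)] by metis
  show "a = of_real (Re a)" "Re a \<le> - 1 / 4" using t by (simp_all add: complex_eq_iff)
  have "reduced_xi holomorphic_on UNIV" using reduced_xi_holomorphic[OF holomorphic_on_ident] by simp
  moreover have "\<exists>w\<in>UNIV. reduced_xi w \<noteq> 0" by (intro bexI[of _ 0]) auto
  ultimately show "xi_mult a > 0"
    using zorder_exist_zero[of reduced_xi UNIV a] \<open>reduced_xi a = 0\<close> by (auto split: if_splits)
qed

section \<open>Finite products over the zeros at real arguments\<close>

definition xi_prod :: "nat \<Rightarrow> real \<Rightarrow> real" where
  "xi_prod n x = (\<Prod>a\<in>xi_zeros_upto n. (1 + x / (- Re a)) ^ xi_mult a)"

lemma xi_prod_limit:
  assumes RH: Riemann_Hypothesis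
  shows "(\<lambda>n. xi_prod n x) \<longlonglongrightarrow> xi_real x"
proof -
  obtain L where L: "\<And>n. finite (xi_zeros_upto n)" "\<And>n. L n holomorphic_on ball 0 (xi_radius n)"
    "\<And>n z. z \<in> ball 0 (xi_radius n) \<Longrightarrow> 
       reduced_xi z = (\<Prod>a\<in>xi_zeros_upto n. (1 - z / a) ^ xi_mult a) * exp (L n z)"
    "\<And>r. uniform_limit (ball 0 r) L (\<lambda>_. 0) sequentially"
    using reduced_xi_hadamard by blast
  have "of_real x \<in> ball (0 :: complex) (\<bar>x\<bar> + 1)" by simp
  from tendsto_uniform_limitI[OF L(4) this] have "(\<lambda>n. L n (of_real x)) \<longlonglongrightarrow> 0" by simp
  hence "(\<lambda>n. reduced_xi (of_real x) * exp (- L n (of_real x))) \<longlonglongrightarrow> reduced_xi (of_real x) * exp (- 0)"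
    by (intro tendsto_intros)
  moreover have "\<forall>\<^sub>F n in sequentially. reduced_xi (of_real x) * exp (- L n (of_real x)) = of_real (xi_prod n x)"
  proof -
    have "filterlim (\<lambda>n. real (Suc n) ^ 2) at_top sequentially" by real_asymp
    hence "\<forall>\<^sub>F n in sequentially. real (Suc n) ^ 2 > \<bar>x\<bar>" by (simp add: filterlim_at_top_dense)
    thus ?thesis
    proof eventually_elim
      case (elim n)
      hence "of_real x \<in> ball (0 :: complex) (xi_radius n)" using xi_radius_ge[of n] by simp
      from L(3)[OF this] have "reduced_xi (of_real x) * exp (- L n (of_real x)) = 
          (\<Prod>a\<in>xi_zeros_upto n. (1 - of_real x / a) ^ xi_mult a)"
        by (simp add: exp_minus)
      also have "\<dots> = (\<Prod>a\<in>xi_zeros_upto n. of_real ((1 + x / (- Re a)) ^ xi_mult a))"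
      proof (rule prod.cong[OF refl])
        fix a assume "a \<in> xi_zeros_upto n"
        then obtain r where r: "a = of_real r" using xi_zeros_upto_RH(1)[OF RH] by blast
        show "(1 - of_real x / a) ^ xi_mult a = of_real ((1 + x / (- Re a)) ^ xi_mult a)"
          unfolding r by simp
      qed
      finally show ?case by (simp add: xi_prod_def)
    qed
  qed
  ultimately have "(\<lambda>n. complex_of_real (xi_prod n x)) \<longlonglongrightarrow> reduced_xi (of_real x)"
    by (simp add: tendsto_cong)
  thus ?thesis unfolding xi_real_def by (auto dest: tendsto_Re)
qed

lemma finite_xi_zeros_upto: "finite (xi_zeros_upto n)"
  using reduced_xi_hadamard by blast

text \<open>
  Since \<open>12 = 6 * 2\<close>, Bernoulli's inequality gives \<open>1 + 12 / b \<le> (1 + 2 / b) ^ 6\<close> for every factor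
  of the product; keeping one factor exact turns the near-equality of \<open>xi_real 12\<close> and
  \<open>xi_real 2 ^ 6\<close> into a lower bound for the corresponding zero.
\<close>

lemma reduced_xi_zero_large:
  assumes RH: Riemann_Hypothesis and a: "reduced_xi a = 0"
  shows "- Re a > 265 / 2"
proof -
  obtain n0 where n0: "norm a < real n0" using reals_Archimedean2 by blast
  have mem: "a \<in> xi_zeros_upto n" if "n \<ge> n0" for n
  proof -
    have "norm a \<le> real (Suc n) ^ 2" using n0 that power_increasing[of 1 2 "real (Suc n)"] by simp
    thus ?thesis using a xi_radius_ge[of n] by (simp add: xi_zeros_upto_def)
  qed
  define b where "b = - Re a"
  have b: "b > 0" using xi_zeros_upto_RH(2)[OF RH mem[of n0]] by (simp add: b_def)
  have "xi_prod n 12 * (1 + 2 / b) ^ 6 \<le> xi_prod n 2 ^ 6 * (1 + 12 / b)" if n: "n \<ge> n0" for n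
  proof -
    let ?A = "xi_zeros_upto n" and ?m = "xi_mult"
    have bern: "1 + 12 / c \<le> (1 + 2 / c) ^ 6" if "c > 0" for c :: real
      using Bernoulli_inequality[of "2 / c" 6] that by (simp add: order_trans[of "-1" 0])
    have re: "- Re x > 0" if "x \<in> ?A" for x using xi_zeros_upto_RH(2)[OF RH that] by simp
    \<comment> \<open>One copy of the factor of \<open>a\<close> is separated even when
      \<open>a\<close> is a multiple zero; the other copies are estimated together with the
      remaining zeros.\<close>
    have split: "xi_prod n y = (1 + y / b) * ((1 + y / b) ^ (?m a - 1) * (\<Prod>x\<in>?A - {a}. (1 + y / (- Re x)) ^ ?m x))" for y
    proof -
      have "xi_prod n y = (1 + y / (- Re a)) ^ ?m a * (\<Prod>x\<in>?A - {a}. (1 + y / (- Re x)) ^ ?m x)"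
        unfolding xi_prod_def by (rule prod.remove[OF finite_xi_zeros_upto mem[OF n]])
      also have "(1 + y / (- Re a)) ^ ?m a = (1 + y / b) * (1 + y / b) ^ (?m a - 1)"
        using xi_zeros_upto_RH(3)[OF RH mem[OF n]] unfolding b_def by (cases "?m a") auto
      finally show ?thesis by (simp only: mult.assoc)
    qed
    have pm: "(1 + 12 / c) ^ k \<le> ((1 + 2 / c) ^ k) ^ 6" if "c > 0" for c :: real and k
      using power_mono[OF bern[OF that], of k] that by (simp add: power_mult[symmetric] mult.commute)
    have "(1 + 12 / b) ^ (?m a - 1) * (\<Prod>x\<in>?A - {a}. (1 + 12 / (- Re x)) ^ ?m x) \<le>
        ((1 + 2 / b) ^ (?m a - 1)) ^ 6 * (\<Prod>x\<in>?A - {a}. ((1 + 2 / (- Re x)) ^ ?m x) ^ 6)"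
    proof (rule mult_mono)
      show "(\<Prod>x\<in>?A - {a}. (1 + 12 / (- Re x)) ^ ?m x) \<le> (\<Prod>x\<in>?A - {a}. ((1 + 2 / (- Re x)) ^ ?m x) ^ 6)"
      proof (intro prod_mono conjI)
        fix x assume "x \<in> ?A - {a}"
        hence x: "- Re x > 0" using re by auto
        show "(1 + 12 / (- Re x)) ^ ?m x \<le> ((1 + 2 / (- Re x)) ^ ?m x) ^ 6" by (rule pm[OF x])
        show "0 \<le> (1 + 12 / (- Re x)) ^ ?m x" 
          using x by (intro zero_le_power add_nonneg_nonneg divide_nonneg_pos) auto
      qed
      show "0 \<le> (\<Prod>x\<in>?A - {a}. (1 + 12 / (- Re x)) ^ ?m x)"
      proof (intro prod_nonneg zero_le_power)
        fix x assume "x \<in> ?A - {a}"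
        hence x: "- Re x > 0" using re by auto
        thus "0 \<le> 1 + 12 / (- Re x)" by (intro add_nonneg_nonneg divide_nonneg_pos) auto
      qed
    qed (use b pm[OF b] in auto)
    hence "(1 + 12 / b) * ((1 + 12 / b) ^ (?m a - 1) * (\<Prod>x\<in>?A - {a}. (1 + 12 / (- Re x)) ^ ?m x)) * (1 + 2 / b) ^ 6 \<le>
        (1 + 12 / b) * (((1 + 2 / b) ^ (?m a - 1)) ^ 6 * (\<Prod>x\<in>?A - {a}. ((1 + 2 / (- Re x)) ^ ?m x) ^ 6)) * (1 + 2 / b) ^ 6"
      using b by (intro mult_right_mono mult_left_mono) auto
    also have "\<dots> = xi_prod n 2 ^ 6 * (1 + 12 / b)"
      unfolding split[of 2] by (simp add: power_mult_distrib prod_power_distrib mult_ac)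
    finally show ?thesis unfolding split[of 12] .
  qed
  hence "xi_real 12 * (1 + 2 / b) ^ 6 \<le> xi_real 2 ^ 6 * (1 + 12 / b)"
    by (intro LIMSEQ_le[of "\<lambda>n. xi_prod n 12 * (1 + 2 / b) ^ 6" _ "\<lambda>n. xi_prod n 2 ^ 6 * (1 + 12 / b)"] tendsto_intros xi_prod_limit[OF RH]) auto
  from xi_real_small_ineq[OF b this] show ?thesis by (simp add: b_def)
qed

text \<open>For a zero - b one has (1 + 182/b) / (1 + 132/b) = 1 + 50 / (132 + b) \<le> exp (50 /
  (132 + b)). The quotient of the two products is therefore at most the exponential of 50 times the
  sum, and \<open>xi_real_ratio\<close> bounds it from below in the limit. In terms of an ordinate
  r, the denominator 132 + b is r^2 + 529/4.\<close>

lemma xi_zero_sum_large: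
  assumes RH: Riemann_Hypothesis
  shows "\<forall>\<^sub>F n in sequentially. 10 / 529 < (\<Sum>a\<in>xi_zeros_upto n. real (xi_mult a) / (132 - Re a))"
proof -
  define T where "T = (\<lambda>n. \<Sum>a\<in>xi_zeros_upto n. real (xi_mult a) / (132 - Re a))"
  have le: "xi_prod n 182 \<le> exp (50 * T n) * xi_prod n 132" and pos: "xi_prod n 132 > 0" for n
  proof -
    have re: "- Re x > 0" if "x \<in> xi_zeros_upto n" for x using xi_zeros_upto_RH(2)[OF RH that] by simp
    show "xi_prod n 132 > 0" unfolding xi_prod_def
      using re by (intro prod_pos zero_less_power ballI add_pos_pos divide_pos_pos) auto
    have "xi_prod n 182 \<le> (\<Prod>a\<in>xi_zeros_upto n. exp (50 * (real (xi_mult a) / (132 - Re a))) * (1 + 132 / (- Re a)) ^ xi_mult a)"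
      unfolding xi_prod_def
    proof (intro prod_mono conjI)
      fix a assume a: "a \<in> xi_zeros_upto n"
      define b where "b = - Re a"
      have b: "b > 0" using re[OF a] by (simp add: b_def)
      show "0 \<le> (1 + 182 / (- Re a)) ^ xi_mult a" using re[OF a]
        by (intro zero_le_power add_nonneg_nonneg divide_nonneg_pos) auto
      have "1 + 50 / (132 + b) = (182 + b) / (132 + b)" "1 + 132 / b = (132 + b) / b" "1 + 182 / b = (182 + b) / b"
        using b by (simp_all add: field_simps)
      hence "1 + 182 / b = (1 + 50 / (132 + b)) * (1 + 132 / b)" using b by simp
      also have "\<dots> \<le> exp (50 / (132 + b)) * (1 + 132 / b)"
        using b by (intro mult_right_mono exp_ge_add_one_self) auto
      finally have "(1 + 182 / b) ^ xi_mult a \<le> (exp (50 / (132 + b)) * (1 + 132 / b)) ^ xi_mult a"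
        using b by (intro power_mono) auto
      also have "\<dots> = exp (50 * (real (xi_mult a) / (132 + b))) * (1 + 132 / b) ^ xi_mult a"
        by (simp add: power_mult_distrib exp_of_nat_mult[symmetric] mult_ac)
      finally show "(1 + 182 / (- Re a)) ^ xi_mult a \<le> exp (50 * (real (xi_mult a) / (132 - Re a))) * (1 + 132 / (- Re a)) ^ xi_mult a"
        by (simp add: b_def)
    qed
    thus "xi_prod n 182 \<le> exp (50 * T n) * xi_prod n 132"
      by (simp add: prod.distrib xi_prod_def T_def exp_sum finite_xi_zeros_upto sum_distrib_left)
  qed
  have lim: "(\<lambda>n. xi_prod n 182 - exp (50 * (10 / 529)) * xi_prod n 132) \<longlonglongrightarrow> 
      xi_real 182 - exp (50 * (10 / 529)) * xi_real 132"
    by (intro tendsto_intros xi_prod_limit RH)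
  have "\<forall>\<^sub>F n in sequentially. xi_prod n 182 - exp (50 * (10 / 529)) * xi_prod n 132 > 0"
    by (rule order_tendstoD(1)[OF lim]) (use xi_real_ratio in simp)
  thus ?thesis
  proof eventually_elim
    case (elim n)
    hence "exp (50 * (10 / 529)) * xi_prod n 132 < exp (50 * T n) * xi_prod n 132" using le[of n] by linarith
    hence "exp (50 * (10 / 529)) < exp (50 * T n)" using pos[of n] by (simp only: mult_less_cancel_right_pos)
    hence "50 * (10 / 529) < 50 * T n" by (simp only: exp_less_cancel_iff)
    thus ?case unfolding T_def by simp
  qed
qed

section \<open>Hardy's function and second logarithmic derivatives\<close>

text \<open>\<open>(log f)''\<close>, without choosing a branch of the logarithm.\<close>

definition log_deriv2 :: "(complex \<Rightarrow> complex) \<Rightarrow> complex \<Rightarrow> complex" where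
  "log_deriv2 f z = (deriv ^^ 2) f z / f z - (deriv f z / f z)\<^sup>2"

lemma log_deriv2_mult:
  assumes "f analytic_on {z}" "g analytic_on {z}" "f z \<noteq> 0" "g z \<noteq> 0"
  shows "log_deriv2 (\<lambda>w. f w * g w) z = log_deriv2 f z + log_deriv2 g z"
proof -
  have 1: "deriv (\<lambda>w. f w * g w) z = f z * deriv g z + deriv f z * g z"
    using higher_deriv_mult_at[OF assms(1,2), of 1] by simp
  have 2: "(deriv ^^ 2) (\<lambda>w. f w * g w) z = f z * (deriv ^^ 2) g z + 2 * deriv f z * deriv g z + (deriv ^^ 2) f z * g z"
    using higher_deriv_mult_at[OF assms(1,2), of 2] by (simp add: numeral_2_eq_2)
  show ?thesis unfolding log_deriv2_def 1 2 using assms(3,4)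
    by (simp add: field_simps power2_eq_square)
qed

lemma log_deriv2_const [simp]: "log_deriv2 (\<lambda>_. c) z = 0"
  by (simp add: log_deriv2_def numeral_2_eq_2)

lemma log_deriv2_power:
  assumes "f analytic_on {z}" "f z \<noteq> 0"
  shows "log_deriv2 (\<lambda>w. f w ^ n) z = of_nat n * log_deriv2 f z"
proof (induction n)
  case (Suc n)
  have "log_deriv2 (\<lambda>w. f w * f w ^ n) z = log_deriv2 f z + log_deriv2 (\<lambda>w. f w ^ n) z"
    using assms by (intro log_deriv2_mult analytic_intros) auto
  thus ?case using Suc by (simp add: algebra_simps)
qed simp

lemma log_deriv2_prod:
  assumes "finite A" "\<And>x. x \<in> A \<Longrightarrow> f x analytic_on {z}" "\<And>x. x \<in> A \<Longrightarrow> f x z \<noteq> 0"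
  shows "log_deriv2 (\<lambda>w. \<Prod>x\<in>A. f x w) z = (\<Sum>x\<in>A. log_deriv2 (f x) z)"
  using assms
proof (induction A)
  case (insert a A)
  have "log_deriv2 (\<lambda>w. f a w * (\<Prod>x\<in>A. f x w)) z = log_deriv2 (f a) z + log_deriv2 (\<lambda>w. \<Prod>x\<in>A. f x w) z"
    using insert by (intro log_deriv2_mult analytic_intros) auto
  thus ?case using insert by simp
qed simp

lemma log_deriv2_linear: "log_deriv2 (\<lambda>w. w - c) z = - 1 / (z - c) ^ 2"
proof -
  have "deriv (\<lambda>w. w - c) = (\<lambda>_. 1)" by (auto intro!: DERIV_imp_deriv derivative_eq_intros)
  thus ?thesis by (simp add: log_deriv2_def numeral_2_eq_2 power_divide)
qed

lemma log_deriv2_exp: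
  assumes M: "M holomorphic_on S" and S: "open S" "z \<in> S"
  shows "log_deriv2 (\<lambda>w. exp (M w)) z = (deriv ^^ 2) M z"
proof -
  have 1: "((\<lambda>w. exp (M w)) has_field_derivative exp (M w) * deriv M w) (at w)" if "w \<in> S" for w
    using holomorphic_derivI[OF M S(1) that] by (auto intro!: derivative_eq_intros)
  have M': "deriv M holomorphic_on S" using M S(1) by (rule holomorphic_deriv)
  have 2: "((\<lambda>w. exp (M w) * deriv M w) has_field_derivative exp (M z) * (deriv M z ^ 2 + deriv (deriv M) z)) (at z)"
    using DERIV_mult[OF 1[OF S(2)] holomorphic_derivI[OF M' S]] by (simp add: algebra_simps power2_eq_square)
  have "\<forall>\<^sub>F w in nhds z. deriv (\<lambda>w. exp (M w)) w = exp (M w) * deriv M w"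
    using eventually_nhds_in_open[OF S] by eventually_elim (rule DERIV_imp_deriv[OF 1])
  from deriv_cong_ev[OF this refl] have "(deriv ^^ 2) (\<lambda>w. exp (M w)) z = exp (M z) * (deriv M z ^ 2 + deriv (deriv M) z)"
    using DERIV_imp_deriv[OF 2] by (simp add: numeral_2_eq_2)
  thus ?thesis using DERIV_imp_deriv[OF 1[OF S(2)]]
    by (simp add: log_deriv2_def numeral_2_eq_2)
qed

lemma log_deriv2_cong:
  assumes "\<forall>\<^sub>F w in nhds z. f w = g w"
  shows "log_deriv2 f z = log_deriv2 g z"
  unfolding log_deriv2_def using higher_deriv_cong_ev[OF assms refl, of 2] higher_deriv_cong_ev[OF assms refl, of 1]
    higher_deriv_cong_ev[OF assms refl, of 0] by simp

lemma higher_deriv_minus_const: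
  "(deriv ^^ n) (\<lambda>w. w - c) z = (if n = 0 then z - c else if n = 1 then 1 else (0 :: complex))"
proof -
  have d: "deriv (\<lambda>w. w - c) = (\<lambda>_. 1)" by (auto intro!: DERIV_imp_deriv derivative_eq_intros)
  have "(deriv ^^ Suc (Suc n)) (\<lambda>w. w - c) = (\<lambda>_. 0)" for n
    by (induction n) (auto simp: d)
  thus ?thesis by (cases n rule: nat.exhaust; cases "n - 1") (auto simp: d)
qed

text \<open>By Leibniz's rule the first three derivatives of (w - z) k(w) at z are k, 2 k' and 3
  k''. The coefficient 3/4 cancels the square of the 2, so that the expression becomes - 3 times
  (log k)''.\<close>

lemma simple_zero_derivs:
  assumes k: "k analytic_on {z}" and kz: "k z \<noteq> 0" and f: "\<forall>\<^sub>F w in nhds z. f w = (w - z) * k w"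
  shows "- ((deriv ^^ 3) f z / deriv f z) + 3 / 4 * ((deriv ^^ 2) f z / deriv f z)\<^sup>2 = - 3 * log_deriv2 k z"
proof -
  have lin: "(\<lambda>w. w - z) analytic_on {z}" by (intro analytic_intros)
  have eq: "(deriv ^^ n) f z = of_nat n * (deriv ^^ (n - 1)) k z" if "n \<in> {1, 2, 3}" for n
  proof -
    have "(deriv ^^ n) f z = (\<Sum>i = 0..n. of_nat (n choose i) * (deriv ^^ i) (\<lambda>w. w - z) z * (deriv ^^ (n - i)) k z)"
      using higher_deriv_cong_ev[OF f refl] higher_deriv_mult_at[OF lin k] by simp
    also have "\<dots> = (\<Sum>i \<in> {1}. of_nat (n choose i) * (deriv ^^ i) (\<lambda>w. w - z) z * (deriv ^^ (n - i)) k z)"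
      using that by (intro sum.mono_neutral_right) (auto simp: higher_deriv_minus_const)
    finally show ?thesis by (simp add: higher_deriv_minus_const)
  qed
  have "deriv f z = k z" "(deriv ^^ 2) f z = 2 * deriv k z" "(deriv ^^ 3) f z = 3 * (deriv ^^ 2) k z"
    using eq[of 1] eq[of 2] eq[of 3] by simp_all
  thus ?thesis using kz by (simp add: log_deriv2_def power_divide field_simps)
qed

text \<open>The denominator \<open>B\<close> in \<open>Z(t) = K(- t\<^sup>2 - 1/4) / B(t)\<close>; it is considered on the strip where
  both arguments of \<open>ln_Gamma\<close> have positive real part.\<close>

definition hardy_den :: "complex \<Rightarrow> complex" where
  "hardy_den t = - (t - \<i> / 2) * (t - (- (\<i> / 2))) * 
     exp ((ln_Gamma (1 / 4 + \<i> * t / 2) + ln_Gamma (1 / 4 - \<i> * t / 2)) / 2 - of_real (ln pi) / 4)"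

definition hardy_strip :: "complex set" where
  "hardy_strip = {t. \<bar>Im t\<bar> < 1 / 2}"

lemma open_hardy_strip: "open hardy_strip"
proof -
  have eq: "hardy_strip = {t. Im t < 1 / 2} \<inter> {t. Im t > - 1 / 2}" by (auto simp: hardy_strip_def)
  show ?thesis unfolding eq by (intro open_Int open_halfspace_Im_lt open_halfspace_Im_gt)
qed

lemma of_real_in_hardy_strip [simp]: "of_real x \<in> hardy_strip"
  by (simp add: hardy_strip_def)

lemma hardy_strip_args:
  assumes "t \<in> hardy_strip"
  shows "1 / 4 + \<i> * t / 2 \<notin> \<real>\<^sub>\<le>\<^sub>0" "1 / 4 - \<i> * t / 2 \<notin> \<real>\<^sub>\<le>\<^sub>0"
    "1 / 4 + \<i> * t / 2 \<notin> \<int>\<^sub>\<le>\<^sub>0" "1 / 4 - \<i> * t / 2 \<notin> \<int>\<^sub>\<le>\<^sub>0" 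
    "t \<noteq> \<i> / 2" "t \<noteq> - (\<i> / 2)"
proof -
  show a: "1 / 4 + \<i> * t / 2 \<notin> \<real>\<^sub>\<le>\<^sub>0" "1 / 4 - \<i> * t / 2 \<notin> \<real>\<^sub>\<le>\<^sub>0"
    using assms by (auto simp: complex_nonpos_Reals_iff hardy_strip_def)
  show "1 / 4 + \<i> * t / 2 \<notin> \<int>\<^sub>\<le>\<^sub>0" "1 / 4 - \<i> * t / 2 \<notin> \<int>\<^sub>\<le>\<^sub>0"
    using a nonpos_Ints_subset_nonpos_Reals by blast+
  have "Im t \<noteq> Im (\<i> / 2)" "Im t \<noteq> Im (- (\<i> / 2))" using assms by (auto simp: hardy_strip_def)
  thus "t \<noteq> \<i> / 2" "t \<noteq> - (\<i> / 2)" by blast+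
qed

lemma hardy_den_nonzero: "t \<in> hardy_strip \<Longrightarrow> hardy_den t \<noteq> 0"
  using hardy_strip_args[of t] by (auto simp: hardy_den_def add_eq_0_iff2)

definition hardy_log :: "complex \<Rightarrow> complex" where
  "hardy_log t = (ln_Gamma (1 / 4 + \<i> * t / 2) + ln_Gamma (1 / 4 - \<i> * t / 2)) / 2 - of_real (ln pi) / 4"

lemma hardy_log_deriv:
  assumes "t \<in> hardy_strip"
  shows "(hardy_log has_field_derivative \<i> / 4 * (Digamma (1 / 4 + \<i> * t / 2) - Digamma (1 / 4 - \<i> * t / 2))) (at t)"
  unfolding hardy_log_def[abs_def] using hardy_strip_args[OF assms]
  by (auto intro!: derivative_eq_intros simp: field_simps)

lemma hardy_log_holomorphic: "hardy_log holomorphic_on hardy_strip"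
  using hardy_log_deriv open_hardy_strip by (auto simp: holomorphic_on_open)

lemma hardy_log_deriv2:
  assumes t: "t \<in> hardy_strip"
  shows "(deriv ^^ 2) hardy_log t = - 1 / 8 * (Polygamma 1 (1 / 4 + \<i> * t / 2) + Polygamma 1 (1 / 4 - \<i> * t / 2))"
proof -
  have "((\<lambda>t. \<i> / 4 * (Digamma (1 / 4 + \<i> * t / 2) - Digamma (1 / 4 - \<i> * t / 2))) has_field_derivative
     - 1 / 8 * (Polygamma 1 (1 / 4 + \<i> * t / 2) + Polygamma 1 (1 / 4 - \<i> * t / 2))) (at t)"
    using hardy_strip_args[OF t] by (auto intro!: derivative_eq_intros simp: field_simps)
  note d = this
  have "\<forall>\<^sub>F w in nhds t. deriv hardy_log w = \<i> / 4 * (Digamma (1 / 4 + \<i> * w / 2) - Digamma (1 / 4 - \<i> * w / 2))"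
    using eventually_nhds_in_open[OF open_hardy_strip t] by eventually_elim (rule DERIV_imp_deriv[OF hardy_log_deriv])
  from deriv_cong_ev[OF this refl] DERIV_imp_deriv[OF d] show ?thesis by (simp add: numeral_2_eq_2)
qed

lemma hardy_den_holomorphic: "hardy_den holomorphic_on hardy_strip"
  unfolding hardy_den_def[abs_def] hardy_log_def[symmetric] 
  by (intro holomorphic_intros hardy_log_holomorphic)

lemma log_deriv2_hardy_den:
  assumes t: "t \<in> hardy_strip"
  shows "log_deriv2 hardy_den t = - 1 / (t - \<i> / 2) ^ 2 - 1 / (t + \<i> / 2) ^ 2
    - 1 / 8 * (Polygamma 1 (1 / 4 + \<i> * t / 2) + Polygamma 1 (1 / 4 - \<i> * t / 2))"
proof -
  have an: "(\<lambda>t. exp (hardy_log t)) analytic_on {t}"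
    using hardy_log_holomorphic open_hardy_strip t
    by (intro analytic_intros) (auto simp: analytic_at intro!: exI[of _ hardy_strip])
  have eq: "hardy_den = (\<lambda>t. ((-1) * (t - \<i> / 2)) * (t - (- (\<i> / 2))) * exp (hardy_log t))"
    by (simp add: hardy_den_def hardy_log_def fun_eq_iff)
  have "log_deriv2 hardy_den t = log_deriv2 (\<lambda>t. ((-1) * (t - \<i> / 2)) * (t - (- (\<i> / 2)))) t + log_deriv2 (\<lambda>t. exp (hardy_log t)) t"
    unfolding eq using hardy_strip_args(5,6)[OF t] by (intro log_deriv2_mult an analytic_intros) (auto simp: add_eq_0_iff2)
  also have "log_deriv2 (\<lambda>t. ((-1) * (t - \<i> / 2)) * (t - (- (\<i> / 2)))) t = 
      log_deriv2 (\<lambda>t. ((-1) * (t - \<i> / 2))) t + log_deriv2 (\<lambda>t. (t - (- (\<i> / 2)))) t"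
    using hardy_strip_args(5,6)[OF t] by (intro log_deriv2_mult analytic_intros) (auto simp: add_eq_0_iff2)
  also have "log_deriv2 (\<lambda>t. ((-1) * (t - \<i> / 2))) t = log_deriv2 (\<lambda>t. - 1) t + log_deriv2 (\<lambda>t. t - \<i> / 2) t"
    using hardy_strip_args(5,6)[OF t] by (intro log_deriv2_mult analytic_intros) (auto simp: add_eq_0_iff2)
  also have "log_deriv2 (\<lambda>t. exp (hardy_log t)) t = (deriv ^^ 2) hardy_log t"
    by (rule log_deriv2_exp[OF hardy_log_holomorphic open_hardy_strip t])
  finally show ?thesis using log_deriv2_linear[of "- (\<i> / 2)" t] log_deriv2_linear[of "\<i> / 2" t]
    by (simp add: hardy_log_deriv2[OF t])
qed

text \<open>With s = 1/2 + i t one has s (s - 1) = - (t^2 + 1/4), and i theta(t) plus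
  \<open>hardy_log t\<close> equals ln_Gamma(s/2) - (s/2) ln pi. All exponential factors thus
  cancel.\<close>

lemma hardy_Z_times_den:
  assumes t: "t \<in> hardy_strip"
  shows "hardy_Z t * hardy_den t = reduced_xi (- (t ^ 2 + 1 / 4))"
proof -
  define s where "s = 1 / 2 + \<i> * t"
  have s01: "s \<noteq> 0" "s \<noteq> 1" using t by (auto simp: s_def hardy_strip_def complex_eq_iff)
  have ss: "s * (s - 1) = - (t ^ 2 + 1 / 4)" by (simp add: s_def power2_eq_square algebra_simps)
  have s2: "s / 2 = 1 / 4 + \<i> * t / 2" by (simp add: s_def field_simps)
  have "hardy_den t = s * (s - 1) * exp (hardy_log t)"
    unfolding ss hardy_den_def hardy_log_def by (simp add: power2_eq_square algebra_simps)
  moreover have "zeta s = exp (s / 2 * of_real (ln pi)) * exp (- ln_Gamma (s / 2)) * reduced_xi (s * (s - 1)) / (s * (s - 1))"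
    using zeta_eq_reduced_xi[OF s01] hardy_strip_args(3)[OF t] 
    by (simp add: powr_def rGamma_complex_altdef s2 Ln_of_real mult.commute)
  ultimately have "hardy_Z t * hardy_den t = 
     exp (\<i> * hardy_theta t) * exp (s / 2 * of_real (ln pi)) * exp (- ln_Gamma (s / 2)) * exp (hardy_log t) * reduced_xi (s * (s - 1))"
    using s01 by (simp add: hardy_Z_def s_def[symmetric])
  also have "exp (\<i> * hardy_theta t) * exp (s / 2 * of_real (ln pi)) * exp (- ln_Gamma (s / 2)) * exp (hardy_log t) = 
     exp (\<i> * hardy_theta t + s / 2 * of_real (ln pi) - ln_Gamma (s / 2) + hardy_log t)"
    by (simp only: exp_add[symmetric] add_uminus_conv_diff)
  also have "\<i> * hardy_theta t + s / 2 * of_real (ln pi) - ln_Gamma (s / 2) + hardy_log t = 0"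
    unfolding s2 hardy_theta_def hardy_log_def by (simp add: field_simps)
  finally show ?thesis by (simp add: ss)
qed

lemma hardy_Z_eq: "t \<in> hardy_strip \<Longrightarrow> hardy_Z t = reduced_xi (- (t ^ 2 + 1 / 4)) / hardy_den t"
  using hardy_Z_times_den[of t] hardy_den_nonzero[of t] by (simp add: field_simps)

section \<open>The zeros of Hardy's function\<close>

lemma mem_Z_zeros_iff: "\<gamma> \<in> Z_zeros \<longleftrightarrow> reduced_xi (- of_real (\<gamma> ^ 2 + 1 / 4)) = 0"
  using hardy_Z_eq[of "of_real \<gamma>"] hardy_den_nonzero[of "of_real \<gamma>"] by (simp add: Z_zeros_def)

lemma minus_in_Z_zeros_iff [simp]: "- \<gamma> \<in> Z_zeros \<longleftrightarrow> \<gamma> \<in> Z_zeros"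
  by (simp add: mem_Z_zeros_iff)

lemma Z_zero_large:
  assumes "Riemann_Hypothesis" "\<gamma> \<in> Z_zeros"
  shows "\<gamma> ^ 2 > 529 / 4"
  using reduced_xi_zero_large[OF assms(1), of "- of_real (\<gamma> ^ 2 + 1 / 4)"] assms(2)
  by (simp add: mem_Z_zeros_iff)

text \<open>The map t \<mapsto> - (t^2 + 1/4) is unramified at \<gamma> because \<gamma> \<noteq> 0,
  so it preserves the order of the zero; the denominator is zero-free on the strip.\<close>

lemma Z_mult_eq:
  assumes RH: Riemann_Hypothesis and \<gamma>: "\<gamma> \<in> Z_zeros"
  shows "Z_mult \<gamma> = int (xi_mult (- of_real (\<gamma> ^ 2 + 1 / 4)))"
proof -
  define a :: complex where "a = - of_real (\<gamma> ^ 2 + 1 / 4)"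
  define m where "m = xi_mult a"
  have hol: "reduced_xi holomorphic_on UNIV" using reduced_xi_holomorphic[OF holomorphic_on_ident] by simp
  obtain g where g: "g holomorphic_on UNIV" "g a \<noteq> 0" "\<And>z. reduced_xi z = g z * (z - a) ^ m"
    using entire_factor_zeros[OF hol, of 0 "{a}"] unfolding m_def by auto
  have g0: "\<gamma> \<noteq> 0" using Z_zero_large[OF RH \<gamma>] by auto
  have "zorder hardy_Z (of_real \<gamma>) = int m"
  proof (rule zorder_eqI)
    show "(\<lambda>t. g (- (t ^ 2 + 1 / 4)) * (- (t + of_real \<gamma>)) ^ m / hardy_den t) holomorphic_on hardy_strip"
      using hardy_den_nonzero
      by (intro holomorphic_intros hardy_den_holomorphic holomorphic_on_compose_gen[OF _ g(1), unfolded o_def]) auto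
    show "g (- ((of_real \<gamma>) ^ 2 + 1 / 4)) * (- (of_real \<gamma> + of_real \<gamma>)) ^ m / hardy_den (of_real \<gamma>) \<noteq> 0"
      using g(2) g0 hardy_den_nonzero[of "of_real \<gamma>"] by (simp add: a_def)
    fix t assume t: "t \<in> hardy_strip"
    have "(- (t ^ 2 + 1 / 4) - a) = (- (t + of_real \<gamma>)) * (t - of_real \<gamma>)"
      by (simp add: a_def power2_eq_square algebra_simps)
    thus "hardy_Z t = g (- (t ^ 2 + 1 / 4)) * (- (t + of_real \<gamma>)) ^ m / hardy_den t * (t - of_real \<gamma>) powi int m"
      by (simp only: hardy_Z_eq[OF t] g(3) power_mult_distrib) simp
  qed (use open_hardy_strip in auto)
  thus ?thesis by (simp add: Z_mult_def m_def a_def)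
qed

section \<open>Zeros of the reduced xi function and pairs of ordinates\<close>

definition Z_zeros_upto :: "nat \<Rightarrow> real set" where
  "Z_zeros_upto n = {\<gamma> \<in> Z_zeros. \<gamma> ^ 2 + 1 / 4 \<le> xi_radius n}"

abbreviation ordinate :: "complex \<Rightarrow> real" where
  "ordinate a \<equiv> sqrt (- Re a - 1 / 4)"

lemma ordinate:
  assumes RH: Riemann_Hypothesis and a: "a \<in> xi_zeros_upto n"
  shows "a = - of_real (ordinate a ^ 2 + 1 / 4)" "ordinate a > 0" "ordinate a \<in> Z_zeros_upto n"
    "Z_mult (ordinate a) = int (xi_mult a)" "Z_mult (- ordinate a) = int (xi_mult a)"
proof -
  have z: "reduced_xi a = 0" "norm a \<le> xi_radius n" using a by (auto simp: xi_zeros_upto_def)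
  have "- Re a - 1 / 4 > 0" using reduced_xi_zero_large[OF RH z(1)] by simp
  thus *: "a = - of_real (ordinate a ^ 2 + 1 / 4)" "ordinate a > 0"
    using xi_zeros_upto_RH(1)[OF RH a] by (auto simp: complex_eq_iff)
  have "norm a = norm (- complex_of_real (ordinate a ^ 2 + 1 / 4))" by (rule arg_cong[OF *(1)])
  also have "\<dots> = \<bar>ordinate a ^ 2 + 1 / 4\<bar>" by (simp only: norm_minus_cancel norm_of_real)
  finally have le: "ordinate a ^ 2 + 1 / 4 \<le> xi_radius n" using z(2) by linarith
  have "reduced_xi (- of_real (ordinate a ^ 2 + 1 / 4)) = 0" using z(1) *(1) by (rule back_subst[of "\<lambda>x. reduced_xi x = 0"])
  with le show "ordinate a \<in> Z_zeros_upto n" unfolding Z_zeros_upto_def mem_Z_zeros_iff by blast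
  hence o: "ordinate a \<in> Z_zeros" "- ordinate a \<in> Z_zeros" by (simp_all add: Z_zeros_upto_def)
  show "Z_mult (ordinate a) = int (xi_mult a)" "Z_mult (- ordinate a) = int (xi_mult a)"
    using Z_mult_eq[OF RH o(1)] Z_mult_eq[OF RH o(2)] unfolding power2_minus *(1)[symmetric] by blast+
qed

lemma Z_zeros_upto_eq:
  assumes RH: Riemann_Hypothesis
  shows "Z_zeros_upto n = ordinate ` xi_zeros_upto n \<union> (\<lambda>a. - ordinate a) ` xi_zeros_upto n"
proof (intro equalityI subsetI)
  fix \<gamma> assume g: "\<gamma> \<in> Z_zeros_upto n"
  define a :: complex where "a = - of_real (\<gamma> ^ 2 + 1 / 4)"
  have "norm a = \<gamma> ^ 2 + 1 / 4" unfolding a_def norm_minus_cancel norm_of_real by simp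
  hence "a \<in> xi_zeros_upto n" using g by (auto simp: Z_zeros_upto_def mem_Z_zeros_iff xi_zeros_upto_def a_def)
  moreover have "ordinate a = \<bar>\<gamma>\<bar>" by (simp add: a_def)
  ultimately show "\<gamma> \<in> ordinate ` xi_zeros_upto n \<union> (\<lambda>a. - ordinate a) ` xi_zeros_upto n"
    by (cases "\<gamma> \<ge> 0") (force intro!: image_eqI[of _ _ a])+
next
  fix \<gamma> assume "\<gamma> \<in> ordinate ` xi_zeros_upto n \<union> (\<lambda>a. - ordinate a) ` xi_zeros_upto n"
  thus "\<gamma> \<in> Z_zeros_upto n" using ordinate(3)[OF RH] by (auto simp: Z_zeros_upto_def)
qed

lemma Z_zeros_upto_parts:
  assumes RH: Riemann_Hypothesis
  shows "inj_on ordinate (xi_zeros_upto n)" "inj_on (\<lambda>a. - ordinate a) (xi_zeros_upto n)"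
    "ordinate ` xi_zeros_upto n \<inter> (\<lambda>a. - ordinate a) ` xi_zeros_upto n = {}"
    "finite (Z_zeros_upto n)"
proof -
  show i: "inj_on ordinate (xi_zeros_upto n)"
  proof (rule inj_onI)
    fix x y assume x: "x \<in> xi_zeros_upto n" and y: "y \<in> xi_zeros_upto n" and e: "ordinate x = ordinate y"
    have "x = - of_real (ordinate x ^ 2 + 1 / 4)" by (rule ordinate(1)[OF RH x])
    also have "\<dots> = - of_real (ordinate y ^ 2 + 1 / 4)" by (simp only: e)
    also have "\<dots> = y" by (rule ordinate(1)[OF RH y, symmetric])
    finally show "x = y" .
  qed
  thus "inj_on (\<lambda>a. - ordinate a) (xi_zeros_upto n)" by (auto simp: inj_on_def)
  have "ordinate x \<noteq> - ordinate y" if "x \<in> xi_zeros_upto n" "y \<in> xi_zeros_upto n" for x y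
    using ordinate(2)[OF RH that(1)] ordinate(2)[OF RH that(2)] by linarith
  thus "ordinate ` xi_zeros_upto n \<inter> (\<lambda>a. - ordinate a) ` xi_zeros_upto n = {}" by blast
  show "finite (Z_zeros_upto n)" unfolding Z_zeros_upto_eq[OF RH] using finite_xi_zeros_upto by auto
qed

lemma sum_Z_zeros_upto:
  assumes RH: Riemann_Hypothesis
  shows "sum f (Z_zeros_upto n) = (\<Sum>a\<in>xi_zeros_upto n. f (ordinate a) + f (- ordinate a))"
  unfolding Z_zeros_upto_eq[OF RH] using Z_zeros_upto_parts[OF RH, of n] finite_xi_zeros_upto[of n]
  by (subst sum.union_disjoint) (auto simp: sum.reindex sum.distrib)

lemma prod_Z_zeros_upto:
  assumes RH: Riemann_Hypothesis
  shows "prod f (Z_zeros_upto n) = (\<Prod>a\<in>xi_zeros_upto n. f (ordinate a) * f (- ordinate a))"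
  unfolding Z_zeros_upto_eq[OF RH] using Z_zeros_upto_parts[OF RH, of n] finite_xi_zeros_upto[of n]
  by (subst prod.union_disjoint) (auto simp: prod.reindex prod.distrib)

lemma xi_prod_eq_Z_prod:
  assumes RH: Riemann_Hypothesis
  obtains C where "C \<noteq> 0" "\<And>t. (\<Prod>a\<in>xi_zeros_upto n. (1 - (- (t ^ 2 + 1 / 4)) / a) ^ xi_mult a) =
    C * (\<Prod>\<gamma>\<in>Z_zeros_upto n. (t - of_real \<gamma>) ^ nat (Z_mult \<gamma>))"
proof
  show "(\<Prod>a\<in>xi_zeros_upto n. (1 / a) ^ xi_mult a) \<noteq> (0 :: complex)"
    using finite_xi_zeros_upto by (auto simp: xi_zeros_upto_def)
  fix t :: complex
  have "(\<Prod>\<gamma>\<in>Z_zeros_upto n. (t - of_real \<gamma>) ^ nat (Z_mult \<gamma>)) = 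
     (\<Prod>a\<in>xi_zeros_upto n. ((t - of_real (ordinate a)) * (t + of_real (ordinate a))) ^ xi_mult a)"
    unfolding prod_Z_zeros_upto[OF RH] by (intro prod.cong refl) (simp add: ordinate(4,5)[OF RH] power_mult_distrib)
  also have "(\<Prod>a\<in>xi_zeros_upto n. (1 / a) ^ xi_mult a) * \<dots> = 
     (\<Prod>a\<in>xi_zeros_upto n. (1 - (- (t ^ 2 + 1 / 4)) / a) ^ xi_mult a)"
    unfolding prod.distrib[symmetric] power_mult_distrib[symmetric]
  proof (rule prod.cong[OF refl])
    fix a assume a: "a \<in> xi_zeros_upto n"
    hence a0: "a \<noteq> 0" by (auto simp: xi_zeros_upto_def)
    define r where "r = ordinate a"
    have ar: "a = - (of_real r ^ 2 + 1 / 4)" using ordinate(1)[OF RH a] by (simp add: r_def)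
    have "1 - (- (t ^ 2 + 1 / 4)) / a = (a + (t ^ 2 + 1 / 4)) / a" using a0 by (simp add: field_simps)
    also have "a + (t ^ 2 + 1 / 4) = (t - of_real r) * (t + of_real r)"
      by (subst ar) (simp add: power2_eq_square algebra_simps)
    finally show "(1 / a * ((t - of_real (ordinate a)) * (t + of_real (ordinate a)))) ^ xi_mult a = (1 - (- (t ^ 2 + 1 / 4)) / a) ^ xi_mult a"
      by (simp add: r_def)
  qed
  finally show "(\<Prod>a\<in>xi_zeros_upto n. (1 - (- (t ^ 2 + 1 / 4)) / a) ^ xi_mult a) =
    (\<Prod>a\<in>xi_zeros_upto n. (1 / a) ^ xi_mult a) * (\<Prod>\<gamma>\<in>Z_zeros_upto n. (t - of_real \<gamma>) ^ nat (Z_mult \<gamma>))" by (rule sym)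
qed

section \<open>The second logarithmic derivative at a simple zero\<close>

definition den_log_curvature :: "real \<Rightarrow> real" where
  "den_log_curvature t = - Re (log_deriv2 hardy_den (of_real t))"

lemma filterlim_xi_radius: "filterlim xi_radius at_top sequentially"
proof (rule filterlim_at_top_mono)
  show "filterlim (\<lambda>n. real (Suc n) ^ 2) at_top sequentially" by real_asymp
qed (use xi_radius_ge in auto)

text \<open>At each large finite stage the identity is exact: near \<open>g\<close>, Z(t) = (t - g)
  k(t) with k = C P exp(M) / B, where P collects the other zeros of that stage. Taking (log k)''
  leaves the second derivative of M as the only error. It tends to 0, because M tends to 0 uniformly
  on a bounded neighbourhood of \<open>g\<close>.\<close>

lemma F_hat_limit:
  assumes RH: Riemann_Hypothesis and g: "simple_Z_zero g"
  shows "(\<lambda>n. \<Sum>\<gamma>\<in>Z_zeros_upto n - {g}. of_int (Z_mult \<gamma>) / (\<gamma> - g) ^ 2) \<longlonglongrightarrow> F_hat g / 3 + den_log_curvature g"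
proof -
  obtain L where L: "\<And>n. finite (xi_zeros_upto n)" "\<And>n. L n holomorphic_on ball 0 (xi_radius n)"
    "\<And>n z. z \<in> ball 0 (xi_radius n) \<Longrightarrow> 
       reduced_xi z = (\<Prod>a\<in>xi_zeros_upto n. (1 - z / a) ^ xi_mult a) * exp (L n z)"
    "\<And>r. uniform_limit (ball 0 r) L (\<lambda>_. 0) sequentially"
    using reduced_xi_hadamard by blast
  have gZ: "g \<in> Z_zeros" "Z_mult g = 1" using g by (auto simp: simple_Z_zero_def)
  define S where "S = hardy_strip \<inter> ball 0 (\<bar>g\<bar> + 1)"
  have S: "open S" "of_real g \<in> S" unfolding S_def using open_hardy_strip by auto
  define r where "r = (\<bar>g\<bar> + 1) ^ 2 + 1"
  define w :: "complex \<Rightarrow> complex" where "w = (\<lambda>t. - (t ^ 2 + 1 / 4))"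
  have wr: "w t \<in> ball 0 r" if "t \<in> S" for t
  proof -
    have "norm t ^ 2 \<le> (\<bar>g\<bar> + 1) ^ 2" using that by (intro power_mono) (auto simp: S_def)
    moreover have "norm (t ^ 2 + 1 / 4) \<le> norm t ^ 2 + 1 / 4"
      using norm_triangle_ineq[of "t ^ 2" "1 / 4"] by (simp add: norm_power norm_divide)
    ultimately have "norm (t ^ 2 + 1 / 4) < r" unfolding r_def by linarith
    thus ?thesis unfolding w_def mem_ball_0 norm_minus_cancel .
  qed
  define M where "M = (\<lambda>n t. L n (w t))"
  have uM: "uniform_limit S M (\<lambda>_. 0) sequentially"
    unfolding M_def by (rule uniform_limit_compose'[OF L(4)[of r]]) (use wr in auto)
  have ev: "\<forall>\<^sub>F n in sequentially. xi_radius n > r" 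
    using filterlim_xi_radius by (simp add: filterlim_at_top_dense)
  have M_hol: "M n holomorphic_on S" if n: "xi_radius n > r" for n
  proof -
    have "w holomorphic_on S" unfolding w_def by (intro holomorphic_intros)
    thus ?thesis unfolding M_def 
      by (rule holomorphic_on_compose_gen[OF _ L(2), unfolded o_def]) (use wr n in force)
  qed
  have "(\<lambda>n. (deriv ^^ 2) (M n) (of_real g)) \<longlonglongrightarrow> (deriv ^^ 2) (\<lambda>_. 0) (of_real g)"
    by (rule higher_deriv_complex_uniform_limit[OF uM _ _ S]) 
      (use ev M_hol in \<open>auto elim!: eventually_mono\<close>)
  hence lim: "(\<lambda>n. (deriv ^^ 2) (M n) (of_real g)) \<longlonglongrightarrow> 0" by simp
  have eq: "(\<Sum>\<gamma>\<in>Z_zeros_upto n - {g}. of_int (Z_mult \<gamma>) / (\<gamma> - g) ^ 2) = F_hat g / 3 + den_log_curvature g + Re ((deriv ^^ 2) (M n) (of_real g))"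
    if n: "xi_radius n > r" for n
  proof -
    have "g ^ 2 \<le> (\<bar>g\<bar> + 1) ^ 2" by (rule power2_le_iff_abs_le[THEN iffD2]) auto
    hence gn: "g \<in> Z_zeros_upto n" using gZ n by (simp add: Z_zeros_upto_def r_def)
    have finG: "finite (Z_zeros_upto n)" by (rule Z_zeros_upto_parts(4)[OF RH])
    obtain C where C: "C \<noteq> 0" "\<And>t. (\<Prod>a\<in>xi_zeros_upto n. (1 - (- (t ^ 2 + 1 / 4)) / a) ^ xi_mult a) =
      C * (\<Prod>\<gamma>\<in>Z_zeros_upto n. (t - of_real \<gamma>) ^ nat (Z_mult \<gamma>))" using xi_prod_eq_Z_prod[OF RH] by blast
    define P where "P = (\<lambda>t::complex. \<Prod>\<gamma>\<in>Z_zeros_upto n - {g}. (t - of_real \<gamma>) ^ nat (Z_mult \<gamma>))"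
    define k where "k = (\<lambda>t. C * P t * exp (M n t) / hardy_den t)"
    have Zk: "hardy_Z t = (t - of_real g) * k t" if t: "t \<in> S" for t
    proof -
      have "t \<in> hardy_strip" using t by (simp add: S_def)
      hence "hardy_Z t = reduced_xi (w t) / hardy_den t" by (simp add: hardy_Z_eq w_def)
      also have "reduced_xi (w t) = C * (\<Prod>\<gamma>\<in>Z_zeros_upto n. (t - of_real \<gamma>) ^ nat (Z_mult \<gamma>)) * exp (M n t)"
        using L(3)[of "w t" n] wr[OF t] n by (simp add: M_def C(2)[symmetric] w_def)
      also have "(\<Prod>\<gamma>\<in>Z_zeros_upto n. (t - of_real \<gamma>) ^ nat (Z_mult \<gamma>)) = (t - of_real g) * P t"
        unfolding P_def by (subst prod.remove[OF finG gn]) (simp add: gZ)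
      finally show ?thesis by (simp add: k_def)
    qed
    have an_exp: "(\<lambda>t. exp (M n t)) analytic_on {of_real g}"
      using M_hol[OF n] S by (intro analytic_intros) (auto simp: analytic_at)
    have an_den: "hardy_den analytic_on {of_real g}"
      using hardy_den_holomorphic open_hardy_strip by (auto simp: analytic_at intro!: exI[of _ hardy_strip])
    have an_P: "P analytic_on {of_real g}" unfolding P_def by (intro analytic_intros)
    have P0: "P (of_real g) \<noteq> 0" unfolding P_def using finG by auto
    have den0: "hardy_den (of_real g) \<noteq> 0" by (simp add: hardy_den_nonzero)
    have an_k: "k analytic_on {of_real g}" unfolding k_def
      by (intro analytic_intros an_exp an_den an_P) (use den0 in auto)
    have k0: "k (of_real g) \<noteq> 0" using C(1) P0 den0 by (simp add: k_def)
    have "\<forall>\<^sub>F t in nhds (of_real g). hardy_Z t = (t - of_real g) * k t"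
      using eventually_nhds_in_open[OF S] by eventually_elim (rule Zk)
    from simple_zero_derivs[OF an_k k0 this] have F: "F_hat g = - 3 * Re (log_deriv2 k (of_real g))"
      by (simp add: F_hat_def Let_def)
    have "\<forall>\<^sub>F t in nhds (of_real g). k t * hardy_den t = C * P t * exp (M n t)"
      using eventually_nhds_in_open[OF open_hardy_strip of_real_in_hardy_strip]
      by eventually_elim (use hardy_den_nonzero in \<open>simp add: k_def\<close>)
    from log_deriv2_cong[OF this] have 
      "log_deriv2 k (of_real g) + log_deriv2 hardy_den (of_real g) = log_deriv2 (\<lambda>t. C * P t * exp (M n t)) (of_real g)"
      by (simp add: log_deriv2_mult[OF an_k an_den k0 den0])
    also have "\<dots> = log_deriv2 (\<lambda>t. C * P t) (of_real g) + log_deriv2 (\<lambda>t. exp (M n t)) (of_real g)"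
      by (intro log_deriv2_mult analytic_intros an_exp an_P) (use C(1) P0 in auto)
    also have "log_deriv2 (\<lambda>t. C * P t) (of_real g) = log_deriv2 (\<lambda>t. C) (of_real g) + log_deriv2 P (of_real g)"
      by (intro log_deriv2_mult analytic_intros an_exp an_P) (use C(1) P0 in auto)
    also have "log_deriv2 P (of_real g) = (\<Sum>\<gamma>\<in>Z_zeros_upto n - {g}. log_deriv2 (\<lambda>t. (t - of_real \<gamma>) ^ nat (Z_mult \<gamma>)) (of_real g))"
      unfolding P_def by (intro log_deriv2_prod analytic_intros) (use finG in auto)
    also have "\<dots> = (\<Sum>\<gamma>\<in>Z_zeros_upto n - {g}. - of_real (of_int (Z_mult \<gamma>) / (\<gamma> - g) ^ 2))"
    proof (rule sum.cong[OF refl])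
      fix \<gamma> assume \<gamma>: "\<gamma> \<in> Z_zeros_upto n - {g}"
      have "\<gamma> \<in> Z_zeros" using \<gamma> by (simp add: Z_zeros_upto_def)
      hence m: "Z_mult \<gamma> \<ge> 0" using Z_mult_eq[OF RH] by simp
      have "log_deriv2 (\<lambda>t. (t - of_real \<gamma>) ^ nat (Z_mult \<gamma>)) (of_real g) = of_nat (nat (Z_mult \<gamma>)) * log_deriv2 (\<lambda>t. t - of_real \<gamma>) (of_real g)"
        by (intro log_deriv2_power analytic_intros) (use \<gamma> in auto)
      also have "\<dots> = - of_real (of_int (Z_mult \<gamma>) / (g - \<gamma>) ^ 2)"
        using m by (simp add: log_deriv2_linear of_nat_nat)
      finally show "log_deriv2 (\<lambda>t. (t - of_real \<gamma>) ^ nat (Z_mult \<gamma>)) (of_real g) = - of_real (of_int (Z_mult \<gamma>) / (\<gamma> - g) ^ 2)"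
        by (simp only: power2_commute)
    qed
    also have "\<dots> = - of_real (\<Sum>\<gamma>\<in>Z_zeros_upto n - {g}. of_int (Z_mult \<gamma>) / (\<gamma> - g) ^ 2)"
      by (simp only: sum_negf of_real_sum)
    also have "log_deriv2 (\<lambda>t. exp (M n t)) (of_real g) = (deriv ^^ 2) (M n) (of_real g)"
      by (rule log_deriv2_exp[OF M_hol[OF n] S])
    finally have "Re (log_deriv2 k (of_real g) + log_deriv2 hardy_den (of_real g)) = 
        Re (log_deriv2 (\<lambda>t. C) (of_real g) + - of_real (\<Sum>\<gamma>\<in>Z_zeros_upto n - {g}. of_int (Z_mult \<gamma>) / (\<gamma> - g) ^ 2) + (deriv ^^ 2) (M n) (of_real g))"
      by (rule arg_cong)
    thus ?thesis using F by (simp add: den_log_curvature_def)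
  qed
  have A: "(\<lambda>n. F_hat g / 3 + den_log_curvature g + Re ((deriv ^^ 2) (M n) (of_real g))) \<longlonglongrightarrow> F_hat g / 3 + den_log_curvature g + Re 0"
    by (intro tendsto_intros lim)
  have B: "\<forall>\<^sub>F n in sequentially. F_hat g / 3 + den_log_curvature g + Re ((deriv ^^ 2) (M n) (of_real g)) = (\<Sum>\<gamma>\<in>Z_zeros_upto n - {g}. of_int (Z_mult \<gamma>) / (\<gamma> - g) ^ 2)"
    using ev by eventually_elim (rule eq[symmetric])
  from Lim_transform_eventually[OF A B] show ?thesis by simp
qed

section \<open>The contribution of the Gamma factor\<close>

lemma frac_le_iff: "E > 0 \<Longrightarrow> c > 0 \<Longrightarrow> a / E \<le> b / c \<longleftrightarrow> a * c \<le> b * (E :: real)"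
  by (simp add: divide_simps mult_ac)

lemma frac_less_iff: "E > 0 \<Longrightarrow> c > 0 \<Longrightarrow> a / E < b / c \<longleftrightarrow> a * c < b * (E :: real)"
  by (simp add: divide_simps mult_ac)

lemma sums_telescope_inverse:
  fixes z :: complex
  assumes "\<And>n. z + of_nat n \<noteq> 0" "p > 0"
  shows "(\<lambda>n. 1 / (z + of_nat n) ^ p - 1 / (z + of_nat (Suc n)) ^ p) sums (1 / z ^ p)"
proof -
  have "filterlim (\<lambda>n. z + of_nat n) at_infinity sequentially"
    by (rule tendsto_add_filterlim_at_infinity[OF tendsto_const]) (simp add: tendsto_of_nat)
  hence "filterlim (\<lambda>n. (z + of_nat n) ^ p) at_infinity sequentially"
    by (rule Limits.filterlim_power_at_infinity) (rule assms)
  hence "(\<lambda>n. 1 / (z + of_nat n) ^ p) \<longlonglongrightarrow> 0"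
    by (rule tendsto_divide_0[OF tendsto_const])
  from telescope_sums'[OF this] show ?thesis by simp
qed

text \<open>The terms \<open>1 / z\<close> and \<open>1 / (2 * z\<^sup>2)\<close> are written as telescoping series; what remains of
  \<open>\<Sum> 1 / (z + n)\<^sup>2\<close> is the series of \<open>(1 / (z + n) - 1 / (z + n + 1))\<^sup>2 / 2\<close>.\<close>

lemma Polygamma_1_expansion:
  fixes z :: complex
  assumes z: "\<And>n. z + of_nat n \<noteq> 0"
  shows "(\<lambda>n. 1 / (2 * (z + of_nat n) ^ 2 * (z + of_nat (Suc n)) ^ 2)) sums (Polygamma 1 z - 1 / z - 1 / (2 * z ^ 2))"
proof -
  have "z \<noteq> 0" using z[of 0] by simp
  hence "summable (\<lambda>n. inverse ((z + of_nat n) ^ 2))" by (intro Polygamma_converges') auto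
  hence 1: "(\<lambda>n. inverse ((z + of_nat n) ^ 2)) sums Polygamma 1 z"
    by (simp add: Polygamma_def numeral_2_eq_2 summable_sums)
  have 2: "(\<lambda>n. 1 / (z + of_nat n) - 1 / (z + of_nat (Suc n))) sums (1 / z)"
    using sums_telescope_inverse[OF z, of 1] by simp
  have 3: "(\<lambda>n. (1 / (z + of_nat n) ^ 2 - 1 / (z + of_nat (Suc n)) ^ 2) / 2) sums (1 / z ^ 2 / 2)"
    by (intro sums_divide sums_telescope_inverse z) auto
  have "(\<lambda>n. inverse ((z + of_nat n) ^ 2) - (1 / (z + of_nat n) - 1 / (z + of_nat (Suc n))) - (1 / (z + of_nat n) ^ 2 - 1 / (z + of_nat (Suc n)) ^ 2) / 2)
     sums (Polygamma 1 z - 1 / z - 1 / z ^ 2 / 2)"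
    by (intro sums_diff 1 2 3)
  also have "(\<lambda>n. inverse ((z + of_nat n) ^ 2) - (1 / (z + of_nat n) - 1 / (z + of_nat (Suc n))) - (1 / (z + of_nat n) ^ 2 - 1 / (z + of_nat (Suc n)) ^ 2) / 2) =
     (\<lambda>n. 1 / (2 * (z + of_nat n) ^ 2 * (z + of_nat (Suc n)) ^ 2))"
  proof
    fix n
    have "inverse (u ^ 2) - (1 / u - 1 / (u + 1)) - (1 / u ^ 2 - 1 / (u + 1) ^ 2) / 2 = 1 / (2 * u ^ 2 * (u + 1) ^ 2)"
      if "u \<noteq> 0" "u + 1 \<noteq> 0" for u :: complex
      using that by (simp add: divide_simps) (simp add: algebra_simps power2_eq_square)
    from this[of "z + of_nat n"] show "inverse ((z + of_nat n) ^ 2) - (1 / (z + of_nat n) - 1 / (z + of_nat (Suc n))) - (1 / (z + of_nat n) ^ 2 - 1 / (z + of_nat (Suc n)) ^ 2) / 2 =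
      1 / (2 * (z + of_nat n) ^ 2 * (z + of_nat (Suc n)) ^ 2)"
      using z[of n] z[of "Suc n"] by (simp add: add_ac)
  qed
  finally show ?thesis by (simp add: mult.commute)
qed

lemma sums_inverse_consecutive: "(\<lambda>n. 2 / ((real n + 5) * (real n + 6))) sums (2 / 5)"
proof -
  have "(\<lambda>n. 2 / (real n + 5)) \<longlonglongrightarrow> 0" by real_asymp
  from telescope_sums'[OF this] have "(\<lambda>n. 2 / (real n + 5) - 2 / (real (Suc n) + 5)) sums (2 / 5)" by simp
  also have "(\<lambda>n. 2 / (real n + 5) - 2 / (real (Suc n) + 5)) = (\<lambda>n. 2 / ((real n + 5) * (real n + 6)))"
    by (simp add: fun_eq_iff field_simps)
  finally show ?thesis .
qed

text \<open>Of the two squared moduli in the denominator, one is bounded below by t^2 / 4, which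
  yields the decay in t, and the other by a quadratic in n, which makes the series
  telescope.\<close>

lemma norm_Polygamma_1_remainder:
  fixes z :: complex and t :: real
  assumes re: "Re z = 1 / 4" and im: "Im z ^ 2 = t ^ 2 / 4" and t: "t ^ 2 > 529 / 4"
  shows "norm (Polygamma 1 z - 1 / z - 1 / (2 * z ^ 2)) \<le> 4 / (5 * t ^ 2)"
proof -
  have z: "z + of_nat n \<noteq> 0" for n
  proof
    assume "z + of_nat n = 0"
    hence "Re (z + of_nat n) = 0" by simp
    thus False using re by simp
  qed
  have n2: "norm (z + of_nat n) ^ 2 = (real n + 1 / 4) ^ 2 + t ^ 2 / 4" for n
  proof -
    have "Re (z + of_nat n) = real n + 1 / 4" "Im (z + of_nat n) = Im z" using re by simp_all
    thus ?thesis unfolding cmod_power2 by (simp only: im)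
  qed
  have le: "norm (1 / (2 * (z + of_nat n) ^ 2 * (z + of_nat (Suc n)) ^ 2)) \<le> (2 / t ^ 2) * (2 / ((real n + 5) * (real n + 6)))" for n
  proof -
    have a: "norm (z + of_nat (Suc n)) ^ 2 \<ge> t ^ 2 / 4" unfolding n2 by simp
    \<comment> \<open>The 33 is a rounded 529/16, the least possible value of t^2 / 4; it is large
      enough to dominate (n + 5) (n + 6) / 2 for every n.\<close>
    have b: "norm (z + of_nat n) ^ 2 \<ge> (real n + 5) * (real n + 6) / 2"
    proof -
      have "(real n + 1 / 4) ^ 2 + 33 - (real n + 5) * (real n + 6) / 2 = ((real n - 5) ^ 2 + 89 / 8) / 2"
        by (simp add: power2_eq_square field_simps)
      also have "\<dots> \<ge> 0" by simp
      finally have "(real n + 1 / 4) ^ 2 + 33 \<ge> (real n + 5) * (real n + 6) / 2" by linarith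
      thus ?thesis unfolding n2 using t by linarith
    qed
    have "norm (1 / (2 * (z + of_nat n) ^ 2 * (z + of_nat (Suc n)) ^ 2)) = 
       1 / (2 * (norm (z + of_nat n) ^ 2 * norm (z + of_nat (Suc n)) ^ 2))"
      by (simp only: norm_divide norm_mult norm_power) simp
    also have "\<dots> \<le> 1 / (2 * ((real n + 5) * (real n + 6) / 2 * (t ^ 2 / 4)))"
      using t by (intro divide_left_mono mult_left_mono mult_mono a b mult_pos_pos) (auto simp: z simp del: of_nat_Suc)
    also have "\<dots> = (2 / t ^ 2) * (2 / ((real n + 5) * (real n + 6)))" by simp
    finally show ?thesis .
  qed
  have s: "(\<lambda>n. (2 / t ^ 2) * (2 / ((real n + 5) * (real n + 6)))) sums ((2 / t ^ 2) * (2 / 5))"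
    by (intro sums_mult sums_inverse_consecutive)
  have "norm (Polygamma 1 z - 1 / z - 1 / (2 * z ^ 2)) = norm (\<Sum>n. 1 / (2 * (z + of_nat n) ^ 2 * (z + of_nat (Suc n)) ^ 2))"
    using Polygamma_1_expansion[OF z] by (simp add: sums_iff)
  also have "\<dots> \<le> (\<Sum>n. (2 / t ^ 2) * (2 / ((real n + 5) * (real n + 6))))"
    by (rule norm_suminf_le) (use s le in \<open>auto simp: sums_iff\<close>)
  also have "\<dots> = 4 / (5 * t ^ 2)" using s by (simp add: sums_iff)
  finally show ?thesis .
qed

text \<open>On Re z = 1/4 the terms 1 / z and 1 / (2 z^2) contribute about 1 / t^2 and - 2 / t^2.
  Their sum is about - 1 / t^2, and a remainder of at most 4 / (5 t^2) cannot change its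
  sign.\<close>

lemma Re_Polygamma_1_bounds:
  fixes z :: complex and t :: real
  assumes re: "Re z = 1 / 4" and im: "Im z ^ 2 = t ^ 2 / 4" and t: "t ^ 2 > 529 / 4"
  shows "- (9 / (5 * t ^ 2)) \<le> Re (Polygamma 1 z)" "Re (Polygamma 1 z) \<le> 0"
proof -
  define c where "c = t ^ 2"
  have c: "c > 529 / 4" using t by (simp add: c_def)
  have nz: "norm z ^ 2 = (c + 1 / 4) / 4" unfolding cmod_power2 re im by (simp add: c_def power2_eq_square)
  have r1: "Re (1 / z) = 1 / (c + 1 / 4)"
    unfolding Re_divide using nz c by (simp add: cmod_power2 re field_simps)
  have r2: "Re (1 / (2 * z ^ 2)) = 2 * (1 / 4 - c) / (c + 1 / 4) ^ 2"
  proof -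
    have "Re (1 / (2 * z ^ 2)) = Re (cnj (z ^ 2)) / (2 * (norm z ^ 2) ^ 2)"
      by (simp add: complex_div_cnj[of 1] norm_mult norm_power power_mult_distrib power2_eq_square)
    also have "Re (cnj (z ^ 2)) = Re z ^ 2 - Im z ^ 2" by (simp add: power2_eq_square)
    also have "\<dots> = 1 / 16 - c / 4" unfolding re im c_def by (simp add: power2_eq_square)
    finally have "Re (1 / (2 * z ^ 2)) = (1 / 16 - c / 4) / (2 * ((c + 1 / 4) ^ 2 / 16))" unfolding nz by (simp add: power_divide)
    also have "\<dots> = 2 * (1 / 4 - c) / (c + 1 / 4) ^ 2" by simp
    finally show ?thesis .
  qed
  have main: "1 / (c + 1 / 4) + 2 * (1 / 4 - c) / (c + 1 / 4) ^ 2 = (3 / 4 - c) / (c + 1 / 4) ^ 2"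
  proof -
    have "1 / E + 2 * (1 / 4 - c) / E ^ 2 = (E + 2 * (1 / 4 - c)) / E ^ 2" if "E > 0" for E
      using that by (simp add: add_divide_distrib power2_eq_square)
    from this[of "c + 1 / 4"] show ?thesis using c by simp
  qed
  have rem: "\<bar>Re (Polygamma 1 z - 1 / z - 1 / (2 * z ^ 2))\<bar> \<le> 4 / (5 * c)"
    using norm_Polygamma_1_remainder[OF assms] abs_Re_le_cmod order.trans unfolding c_def by blast
  have "Re (Polygamma 1 z) = (3 / 4 - c) / (c + 1 / 4) ^ 2 + Re (Polygamma 1 z - 1 / z - 1 / (2 * z ^ 2))"
    using r1 r2 main by simp
  moreover have "(3 / 4 - c) / (c + 1 / 4) ^ 2 \<le> - (4 / (5 * c))"
  proof -
    have "4 * (c + 1 / 4) ^ 2 \<le> (c - 3 / 4) * (5 * c)"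
    proof -
      have "(c - 3 / 4) * (5 * c) - 4 * (c + 1 / 4) ^ 2 = c * (c - 23 / 4) - 1 / 4"
        by (simp add: power2_eq_square field_simps)
      moreover have "c * (c - 23 / 4) \<ge> 1 * 1" using c by (intro mult_mono) auto
      ultimately show ?thesis by linarith
    qed
    hence "4 / (5 * c) \<le> (c - 3 / 4) / (c + 1 / 4) ^ 2" using c by (subst frac_le_iff) auto
    thus ?thesis by (simp add: diff_divide_distrib)
  qed
  moreover have "(3 / 4 - c) / (c + 1 / 4) ^ 2 \<ge> - (1 / c)"
  proof -
    have "(c - 3 / 4) * c \<le> (c + 1 / 4) ^ 2" using c by (simp add: power2_eq_square algebra_simps)
    hence "(c - 3 / 4) / (c + 1 / 4) ^ 2 \<le> 1 / c" using c by (subst frac_le_iff) auto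
    thus ?thesis by (simp add: diff_divide_distrib)
  qed
  moreover have "1 / c + 4 / (5 * c) = 9 / (5 * c)" using c by (simp add: field_simps)
  ultimately show "- (9 / (5 * t ^ 2)) \<le> Re (Polygamma 1 z)" "Re (Polygamma 1 z) \<le> 0"
    using rem unfolding c_def[symmetric] by linarith+
qed

lemma den_log_curvature_eq:
  "den_log_curvature t = 2 * (t ^ 2 - 1 / 4) / (t ^ 2 + 1 / 4) ^ 2 + 
     1 / 8 * (Re (Polygamma 1 (1 / 4 + \<i> * of_real t / 2)) + Re (Polygamma 1 (1 / 4 - \<i> * of_real t / 2)))"
proof -
  have c: "t ^ 2 + 1 / 4 > 0" by (simp add: add_nonneg_pos)
  have "Re (1 / (of_real t + of_real e * \<i>) ^ 2) = (t ^ 2 - 1 / 4) / (t ^ 2 + 1 / 4) ^ 2" if e: "e ^ 2 = 1 / 4" for e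
  proof -
    define u where "u = complex_of_real t + of_real e * \<i>"
    have "norm u ^ 2 = t ^ 2 + 1 / 4" unfolding cmod_power2 by (simp add: u_def e)
    moreover have "Re (cnj (u ^ 2)) = t ^ 2 - 1 / 4" using e by (simp add: u_def power2_eq_square)
    moreover have "Re (1 / u ^ 2) = Re (cnj (u ^ 2)) / (norm u ^ 2) ^ 2"
      by (simp add: complex_div_cnj[of 1] norm_mult norm_power power2_eq_square)
    ultimately show ?thesis by (simp add: u_def)
  qed
  from this[of "1 / 2"] this[of "- 1 / 2"]
  have "Re (1 / (of_real t + \<i> / 2) ^ 2) = (t ^ 2 - 1 / 4) / (t ^ 2 + 1 / 4) ^ 2" 
    "Re (1 / (of_real t - \<i> / 2) ^ 2) = (t ^ 2 - 1 / 4) / (t ^ 2 + 1 / 4) ^ 2" 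
    by (simp_all add: power2_eq_square)
  thus ?thesis by (simp add: den_log_curvature_def log_deriv2_hardy_den diff_divide_distrib)
qed

text \<open>The rational main term lies strictly between 1 / t^2 and 2 / t^2. The Gamma contribution
  is nonpositive and at least - (9/20) / t^2, so neither bound is crossed.\<close>

lemma den_log_curvature_bounds:
  assumes t: "t ^ 2 > 529 / 4"
  shows "0 < den_log_curvature t" "den_log_curvature t < 2 / t ^ 2"
proof -
  define c where "c = t ^ 2"
  have c: "c > 529 / 4" using t by (simp add: c_def)
  define p q where "p = Re (Polygamma 1 (1 / 4 + \<i> * of_real t / 2))" and "q = Re (Polygamma 1 (1 / 4 - \<i> * of_real t / 2))"
  have b: "- (9 / (5 * c)) \<le> p" "p \<le> 0" "- (9 / (5 * c)) \<le> q" "q \<le> 0"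
    unfolding p_def q_def c_def by (rule Re_Polygamma_1_bounds[where t = t]; (use t in \<open>simp add: power2_eq_square\<close>))+
  have "2 * (c - 1 / 4) / (c + 1 / 4) ^ 2 < 2 / c"
  proof -
    have "2 * (c - 1 / 4) * c < 2 * (c + 1 / 4) ^ 2" using c by (simp add: power2_eq_square algebra_simps)
    thus ?thesis using c by (subst frac_less_iff) auto
  qed
  moreover have "2 * (c - 1 / 4) / (c + 1 / 4) ^ 2 > 1 / c"
  proof -
    have "2 * (c - 1 / 4) * c - (c + 1 / 4) ^ 2 = c * (c - 1) - 1 / 16" by (simp add: power2_eq_square field_simps)
    moreover have "c * (c - 1) \<ge> 1 * 1" using c by (intro mult_mono) auto
    ultimately have "(c + 1 / 4) ^ 2 < 2 * (c - 1 / 4) * c" by linarith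
    thus ?thesis using c by (subst frac_less_iff) auto
  qed
  moreover have "0 < m + 1 / 8 * (p + q) \<and> m + 1 / 8 * (p + q) < 2 * i"
    if "m < 2 * i" "i < m" "0 < i" "- (9 / 5 * i) \<le> p" "- (9 / 5 * i) \<le> q" for m i
    using that b(2,4) by (intro conjI) (simp_all add: field_simps)
  from this[of "2 * (c - 1 / 4) / (c + 1 / 4) ^ 2" "1 / c"]
  have "2 * (c - 1 / 4) / (c + 1 / 4) ^ 2 < 2 / c \<Longrightarrow> 1 / c < 2 * (c - 1 / 4) / (c + 1 / 4) ^ 2 \<Longrightarrow>
      0 < 2 * (c - 1 / 4) / (c + 1 / 4) ^ 2 + 1 / 8 * (p + q) \<and> 2 * (c - 1 / 4) / (c + 1 / 4) ^ 2 + 1 / 8 * (p + q) < 2 / c"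
    using b(1,3) c by simp
  ultimately show "0 < den_log_curvature t" "den_log_curvature t < 2 / t ^ 2"
    unfolding den_log_curvature_eq p_def[symmetric] q_def[symmetric] c_def[symmetric] by blast+
qed

section \<open>Summation over the zeros\<close>

text \<open>For nonnegative terms the unordered sum is the supremum of the finite partial sums, and
  each finite subset lies in some \<open>Y n\<close>. This connects the sums ordered by
  \<open>xi_radius\<close> with the infinite sum in \<open>g_bar\<close>.\<close>

lemma has_sum_nonneg_exhaustion:
  fixes f :: "'a \<Rightarrow> real"
  assumes nn: "\<And>x. x \<in> X \<Longrightarrow> f x \<ge> 0" and fin: "\<And>n. finite (Y n)" and inc: "incseq Y" and X: "X = (\<Union>n. Y n)"
    and lim: "(\<lambda>n. sum f (Y n)) \<longlonglongrightarrow> l"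
  shows "(f has_sum l) X"
  unfolding has_sum_def
proof (rule order_tendstoI)
  have incs: "incseq (\<lambda>n. sum f (Y n))"
    using inc X by (auto simp: incseq_def intro!: sum_mono2 fin nn)
  have le: "sum f (Y n) \<le> l" for n by (rule incseq_le[OF incs lim])
  have sub: "\<exists>n. F \<subseteq> Y n" if "finite F" "F \<subseteq> X" for F
    using that
  proof induction
    case (insert x F)
    then obtain n m where "F \<subseteq> Y n" "x \<in> Y m" using X by auto
    hence "insert x F \<subseteq> Y (max n m)"
      using incseqD[OF inc, of n "max n m"] incseqD[OF inc, of m "max n m"] by auto
    thus ?case by blast
  qed auto
  have le': "sum f F \<le> l" if F: "finite F" "F \<subseteq> X" for F
  proof -
    obtain n where n: "F \<subseteq> Y n" using sub[OF F] by blast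
    have "sum f F \<le> sum f (Y n)" using n X by (intro sum_mono2 fin nn) auto
    thus ?thesis using le[of n] by simp
  qed
  show "\<forall>\<^sub>F F in finite_subsets_at_top X. sum f F < u" if "l < u" for u
    using le' that by (intro eventually_finite_subsets_at_top_weakI) (meson le_less_trans)
  show "\<forall>\<^sub>F F in finite_subsets_at_top X. u < sum f F" if u: "u < l" for u
  proof -
    obtain n where n: "u < sum f (Y n)"
      using order_tendstoD(1)[OF lim u] by (auto simp: eventually_sequentially)
    show ?thesis unfolding eventually_finite_subsets_at_top
    proof (intro exI[of _ "Y n"] conjI allI impI)
      fix F assume F: "finite F \<and> Y n \<subseteq> F \<and> F \<subseteq> X"
      have "sum f (Y n) \<le> sum f F" using F by (intro sum_mono2 nn) auto
      thus "u < sum f F" using n by simp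
    qed (use fin X in auto)
  qed
qed

text \<open>The two squares u and v add up to 2 (r^2 + x^2), and 1/u + 1/v \<ge> 4 / (u + v). The
  bound no longer depends on the distance between r and x.\<close>

lemma pair_sum_ge:
  fixes r x :: real
  assumes "r ^ 2 \<noteq> x ^ 2"
  shows "2 / (r ^ 2 + x ^ 2) \<le> 1 / (r - x) ^ 2 + 1 / (- r - x) ^ 2"
proof -
  define u v where "u = (r - x) ^ 2" and "v = (- r - x) ^ 2"
  have "r \<noteq> x" "r \<noteq> - x" using assms by auto
  hence uv: "u > 0" "v > 0" unfolding u_def v_def by (simp_all add: add_eq_0_iff2 zero_less_power2)
  have s: "2 * (r ^ 2 + x ^ 2) = u + v" by (simp add: u_def v_def power2_eq_square algebra_simps)
  have "4 * (u * v) \<le> (u + v) * (u + v)"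
    using zero_le_power2[of "u - v"] by (simp add: power2_eq_square algebra_simps)
  hence "4 / (u + v) \<le> (u + v) / (u * v)" using uv by (subst frac_le_iff) (auto simp: add_pos_pos)
  also have "\<dots> = 1 / u + 1 / v" using uv by (simp add: field_simps)
  finally have "4 / (2 * (r ^ 2 + x ^ 2)) \<le> 1 / u + 1 / v" unfolding s .
  moreover have "4 / (2 * c) = 2 / c" for c :: real by simp
  ultimately show ?thesis by (simp only: u_def v_def)
qed

lemma Z_mult_nonneg: "Riemann_Hypothesis \<Longrightarrow> \<gamma> \<in> Z_zeros \<Longrightarrow> Z_mult \<gamma> \<ge> 0"
  using Z_mult_eq by simp

text \<open>For A = 529/4 \<le> x^2 and q \<ge> 0 one has A (q + x^2) \<le> x^2 (q + A), hence 2 /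
  (q + x^2) \<ge> (2 A / x^2) / (q + A). Summation with \<open>xi_zero_sum_large\<close> gives 2 A *
  (10/529) = 5.\<close>

lemma xi_zero_sum_lower:
  assumes RH: Riemann_Hypothesis and x: "x ^ 2 > 529 / 4"
  shows "\<forall>\<^sub>F n in sequentially. 5 / x ^ 2 < (\<Sum>a\<in>xi_zeros_upto n. real (xi_mult a) * (2 / (ordinate a ^ 2 + x ^ 2)))"
  using xi_zero_sum_large[OF RH]
proof eventually_elim
  case (elim n)
  have "(529 / 2 / x ^ 2) * (real (xi_mult a) / (132 - Re a)) \<le> real (xi_mult a) * (2 / (ordinate a ^ 2 + x ^ 2))"
    if a: "a \<in> xi_zeros_upto n" for a
  proof -
    define q where "q = ordinate a ^ 2"
    have q: "q \<ge> 0" by (simp add: q_def)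
    have re: "132 - Re a = q + 529 / 4"
      using arg_cong[OF ordinate(1)[OF RH a], of Re] unfolding q_def by simp
    have "529 / 2 * (q + x ^ 2) \<le> 2 * (x ^ 2 * (q + 529 / 4))"
      using q x mult_right_mono[of "529 / 4" "x ^ 2" q] by (simp add: algebra_simps)
    hence "529 / 2 / (x ^ 2 * (q + 529 / 4)) \<le> 2 / (q + x ^ 2)"
      using q x by (subst frac_le_iff) (auto intro!: mult_pos_pos add_nonneg_pos)
    hence "real (xi_mult a) * (529 / 2 / (x ^ 2 * (q + 529 / 4))) \<le> real (xi_mult a) * (2 / (q + x ^ 2))"
      by (intro mult_left_mono) auto
    thus ?thesis unfolding re q_def[symmetric] by (simp add: mult_ac)
  qed
  hence "(529 / 2 / x ^ 2) * (\<Sum>a\<in>xi_zeros_upto n. real (xi_mult a) / (132 - Re a)) \<le> 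
      (\<Sum>a\<in>xi_zeros_upto n. real (xi_mult a) * (2 / (ordinate a ^ 2 + x ^ 2)))"
    unfolding sum_distrib_left by (intro sum_mono)
  moreover have "(529 / 2 / x ^ 2) * (10 / 529) < (529 / 2 / x ^ 2) * (\<Sum>a\<in>xi_zeros_upto n. real (xi_mult a) / (132 - Re a))"
    using elim x by (intro mult_strict_left_mono) auto
  ultimately show ?case by simp
qed

section \<open>Exhaustion of the zeros by finite sets\<close>

lemma Z_zeros_upto_eventually:
  assumes "\<gamma> \<in> Z_zeros"
  shows "\<forall>\<^sub>F n in sequentially. \<gamma> \<in> Z_zeros_upto n"
proof -
  have "\<forall>\<^sub>F n in sequentially. xi_radius n \<ge> \<gamma> ^ 2 + 1 / 4"
    using filterlim_xi_radius by (simp add: filterlim_at_top)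
  thus ?thesis by eventually_elim (use assms in \<open>simp add: Z_zeros_upto_def\<close>)
qed

lemma incseq_Z_zeros_upto: "incseq Z_zeros_upto"
proof (rule incseq_SucI)
  fix n
  have "xi_radius n \<le> xi_radius (Suc n)" by (simp add: xi_radius_def algebra_simps)
  thus "Z_zeros_upto n \<le> Z_zeros_upto (Suc n)" by (auto simp: Z_zeros_upto_def)
qed

lemma UN_Z_zeros_upto: "(\<Union>n. Z_zeros_upto n) = Z_zeros"
proof (intro equalityI subsetI)
  fix \<gamma> assume "\<gamma> \<in> Z_zeros"
  from Z_zeros_upto_eventually[OF this] show "\<gamma> \<in> (\<Union>n. Z_zeros_upto n)"
    by (auto simp: eventually_sequentially)
qed (auto simp: Z_zeros_upto_def)

definition zero_term :: "real \<Rightarrow> real \<Rightarrow> real \<Rightarrow> real" where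
  "zero_term g1 g2 \<gamma> = of_int (Z_mult \<gamma>) * (1 / (\<gamma> - g1)\<^sup>2 + 1 / (\<gamma> - g2)\<^sup>2)"

text \<open>Each of the two limits omits only its own zero and so contains the other one with term 1
  / (g1 - g2)^2. Removing both terms is the origin of the - 2 in \<open>g_hat\<close>.\<close>

lemma zero_term_has_sum:
  assumes RH: Riemann_Hypothesis and g1: "simple_Z_zero g1" and g2: "simple_Z_zero g2" and ne: "g1 \<noteq> g2"
  shows "(zero_term g1 g2 has_sum (F_hat g1 / 3 + den_log_curvature g1 + F_hat g2 / 3 + den_log_curvature g2 - 2 / (g1 - g2) ^ 2)) (Z_zeros - {g1, g2})"
proof (rule has_sum_nonneg_exhaustion)
  show "0 \<le> zero_term g1 g2 \<gamma>" if "\<gamma> \<in> Z_zeros - {g1, g2}" for \<gamma>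
    unfolding zero_term_def using that Z_mult_nonneg[OF RH] by (intro mult_nonneg_nonneg) auto
  show "finite (Z_zeros_upto n - {g1, g2})" for n using Z_zeros_upto_parts(4)[OF RH] by auto
  show "incseq (\<lambda>n. Z_zeros_upto n - {g1, g2})" using incseq_Z_zeros_upto by (auto simp: incseq_def)
  show "Z_zeros - {g1, g2} = (\<Union>n. Z_zeros_upto n - {g1, g2})" using UN_Z_zeros_upto by blast
  have z: "g1 \<in> Z_zeros" "Z_mult g1 = 1" "g2 \<in> Z_zeros" "Z_mult g2 = 1"
    using g1 g2 by (auto simp: simple_Z_zero_def)
  let ?s = "\<lambda>g n. \<Sum>\<gamma>\<in>Z_zeros_upto n - {g}. of_int (Z_mult \<gamma>) / (\<gamma> - g) ^ 2"
  have "(\<lambda>n. ?s g1 n + ?s g2 n - 2 / (g1 - g2) ^ 2) \<longlonglongrightarrow>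
      (F_hat g1 / 3 + den_log_curvature g1) + (F_hat g2 / 3 + den_log_curvature g2) - 2 / (g1 - g2) ^ 2"
    by (intro tendsto_intros F_hat_limit RH g1 g2)
  moreover have "\<forall>\<^sub>F n in sequentially. ?s g1 n + ?s g2 n - 2 / (g1 - g2) ^ 2 = sum (zero_term g1 g2) (Z_zeros_upto n - {g1, g2})"
    using Z_zeros_upto_eventually[OF z(1)] Z_zeros_upto_eventually[OF z(3)]
  proof eventually_elim
    case (elim n)
    have fin: "finite (Z_zeros_upto n)" by (rule Z_zeros_upto_parts(4)[OF RH])
    have "?s g1 n = 1 / (g2 - g1) ^ 2 + (\<Sum>\<gamma>\<in>Z_zeros_upto n - {g1} - {g2}. of_int (Z_mult \<gamma>) / (\<gamma> - g1) ^ 2)"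
      using elim fin ne z by (subst sum.remove[of _ g2]) auto
    moreover have "?s g2 n = 1 / (g1 - g2) ^ 2 + (\<Sum>\<gamma>\<in>Z_zeros_upto n - {g2} - {g1}. of_int (Z_mult \<gamma>) / (\<gamma> - g2) ^ 2)"
      using elim fin ne z by (subst sum.remove[of _ g1]) auto
    moreover have "Z_zeros_upto n - {g1} - {g2} = Z_zeros_upto n - {g1, g2}" "Z_zeros_upto n - {g2} - {g1} = Z_zeros_upto n - {g1, g2}" by auto
    moreover have "sum (zero_term g1 g2) (Z_zeros_upto n - {g1, g2}) = 
       (\<Sum>\<gamma>\<in>Z_zeros_upto n - {g1, g2}. of_int (Z_mult \<gamma>) / (\<gamma> - g1) ^ 2) + (\<Sum>\<gamma>\<in>Z_zeros_upto n - {g1, g2}. of_int (Z_mult \<gamma>) / (\<gamma> - g2) ^ 2)"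
      unfolding sum.distrib[symmetric] by (simp add: zero_term_def distrib_left)
    moreover have "(g2 - g1) ^ 2 = (g1 - g2) ^ 2" by (rule power2_commute)
    ultimately show ?case by simp
  qed
  ultimately have "(\<lambda>n. sum (zero_term g1 g2) (Z_zeros_upto n - {g1, g2})) \<longlonglongrightarrow>
      (F_hat g1 / 3 + den_log_curvature g1) + (F_hat g2 / 3 + den_log_curvature g2) - 2 / (g1 - g2) ^ 2"
    by (rule Lim_transform_eventually)
  thus "(\<lambda>n. sum (zero_term g1 g2) (Z_zeros_upto n - {g1, g2})) \<longlonglongrightarrow>
      F_hat g1 / 3 + den_log_curvature g1 + F_hat g2 / 3 + den_log_curvature g2 - 2 / (g1 - g2) ^ 2"
    by (simp add: add.assoc)
qed

text \<open>From the total 5 / x^2 the pairs belonging to x and y are removed. Both zeros are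
  simple, so they account for 2 / (x^2 + x^2) = 1 / x^2 and at most 2 / (x^2 + y^2).\<close>

lemma zero_sum_lower_part:
  assumes RH: Riemann_Hypothesis and x: "x \<in> Z_zeros" "Z_mult x = 1" and y: "y \<in> Z_zeros" "Z_mult y = 1"
  shows "\<forall>\<^sub>F n in sequentially. 4 / x ^ 2 - 2 / (x ^ 2 + y ^ 2) <
    (\<Sum>\<gamma>\<in>Z_zeros_upto n - {x, y}. of_int (Z_mult \<gamma>) / (\<gamma> - x) ^ 2)"
  using xi_zero_sum_lower[OF RH Z_zero_large[OF RH x(1)]] Z_zeros_upto_eventually[OF x(1)] Z_zeros_upto_eventually[OF y(1)]
proof eventually_elim
  case (elim n)
  let ?A = "xi_zeros_upto n"
  define ax ay :: complex where "ax = - of_real (x ^ 2 + 1 / 4)" and "ay = - of_real (y ^ 2 + 1 / 4)"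
  have nonneg: "of_int (Z_mult \<gamma>) / (\<gamma> - x) ^ 2 \<ge> 0" if "\<gamma> \<in> Z_zeros_upto n" for \<gamma>
    using that Z_mult_nonneg[OF RH] by (auto simp: Z_zeros_upto_def)
  have fin: "finite (Z_zeros_upto n)" "finite ?A" using Z_zeros_upto_parts(4)[OF RH] finite_xi_zeros_upto by auto
  \<comment> \<open>\<open>pair_sum_ge\<close> treats \<gamma> and - \<gamma> together, so
    \<open>h\<close> drops - x and - y along with x and y; their true terms are nonnegative and are
    simply given away.\<close>
  define h where "h = (\<lambda>\<gamma>. if \<gamma> ^ 2 = x ^ 2 \<or> \<gamma> ^ 2 = y ^ 2 then 0 else of_int (Z_mult \<gamma>) / (\<gamma> - x) ^ 2)"
  have x0: "x ^ 2 > 0" "y ^ 2 > 0" using Z_zero_large[OF RH x(1)] Z_zero_large[OF RH y(1)] by linarith+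
  have "int (xi_mult ax) = 1" "int (xi_mult ay) = 1"
    using Z_mult_eq[OF RH x(1)] Z_mult_eq[OF RH y(1)] x(2) y(2) unfolding ax_def ay_def by (simp_all only:)
  hence mult1: "xi_mult ax = 1" "xi_mult ay = 1" by (simp_all only: of_nat_eq_1_iff)
  have ord: "ordinate ax ^ 2 = x ^ 2" "ordinate ay ^ 2 = y ^ 2" by (simp_all add: ax_def ay_def)
  have "(\<Sum>a\<in>?A - {ax, ay}. real (xi_mult a) * (2 / (ordinate a ^ 2 + x ^ 2))) \<le> (\<Sum>a\<in>?A - {ax, ay}. h (ordinate a) + h (- ordinate a))"
  proof (rule sum_mono)
    fix a assume a: "a \<in> ?A - {ax, ay}"
    hence aA: "a \<in> ?A" by simp
    have ne: "ordinate a ^ 2 \<noteq> x ^ 2" "ordinate a ^ 2 \<noteq> y ^ 2"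
    proof -
      have "a \<noteq> ax" "a \<noteq> ay" using a by auto
      thus "ordinate a ^ 2 \<noteq> x ^ 2" "ordinate a ^ 2 \<noteq> y ^ 2"
        using ordinate(1)[OF RH aA] unfolding ax_def ay_def by metis+
    qed
    have "real (xi_mult a) * (2 / (ordinate a ^ 2 + x ^ 2)) \<le> real (xi_mult a) * (1 / (ordinate a - x) ^ 2 + 1 / (- ordinate a - x) ^ 2)"
      by (intro mult_left_mono pair_sum_ge ne) auto
    also have "\<dots> = h (ordinate a) + h (- ordinate a)"
      using ne unfolding h_def power2_minus ordinate(4,5)[OF RH aA] by (simp only: if_False simp_thms) (simp add: distrib_left)
    finally show "real (xi_mult a) * (2 / (ordinate a ^ 2 + x ^ 2)) \<le> h (ordinate a) + h (- ordinate a)" .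
  qed
  also have "\<dots> \<le> (\<Sum>a\<in>?A. h (ordinate a) + h (- ordinate a))"
  proof (rule sum_mono2)
    fix a assume "a \<in> ?A - (?A - {ax, ay})"
    hence "a \<in> ?A" by simp
    hence "ordinate a \<in> Z_zeros_upto n" "- ordinate a \<in> Z_zeros_upto n" 
      using ordinate(3)[OF RH, of a n] by (auto simp: Z_zeros_upto_def)
    thus "0 \<le> h (ordinate a) + h (- ordinate a)" unfolding h_def using nonneg by (auto intro!: add_nonneg_nonneg)
  qed (use fin in auto)
  also have "\<dots> = sum h (Z_zeros_upto n)" by (rule sum_Z_zeros_upto[OF RH, symmetric])
  also have "\<dots> = sum h (Z_zeros_upto n - {x, y})"
    by (rule sum.mono_neutral_right) (use fin in \<open>auto simp: h_def\<close>)
  also have "\<dots> \<le> (\<Sum>\<gamma>\<in>Z_zeros_upto n - {x, y}. of_int (Z_mult \<gamma>) / (\<gamma> - x) ^ 2)"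
    by (rule sum_mono) (use nonneg in \<open>auto simp: h_def\<close>)
  finally have 1: "(\<Sum>a\<in>?A - {ax, ay}. real (xi_mult a) * (2 / (ordinate a ^ 2 + x ^ 2))) \<le> 
      (\<Sum>\<gamma>\<in>Z_zeros_upto n - {x, y}. of_int (Z_mult \<gamma>) / (\<gamma> - x) ^ 2)" .
  have "(\<Sum>a\<in>?A. real (xi_mult a) * (2 / (ordinate a ^ 2 + x ^ 2))) \<le> 
     (\<Sum>a\<in>(?A - {ax, ay}) \<union> {ax, ay}. real (xi_mult a) * (2 / (ordinate a ^ 2 + x ^ 2)))"
    by (rule sum_mono2) (use fin in auto)
  also have "\<dots> = (\<Sum>a\<in>?A - {ax, ay}. real (xi_mult a) * (2 / (ordinate a ^ 2 + x ^ 2))) + 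
     (\<Sum>a\<in>{ax, ay}. real (xi_mult a) * (2 / (ordinate a ^ 2 + x ^ 2)))"
    by (rule sum.union_disjoint) (use fin in auto)
  \<comment> \<open>If y = - x, both ordinates belong to the same zero of \<open>reduced_xi\<close>,
    which is then counted once.\<close>
  also have "(\<Sum>a\<in>{ax, ay}. real (xi_mult a) * (2 / (ordinate a ^ 2 + x ^ 2))) \<le> 1 / x ^ 2 + 2 / (x ^ 2 + y ^ 2)"
  proof (cases "ax = ay")
    case True
    have "(\<Sum>a\<in>{ax, ay}. real (xi_mult a) * (2 / (ordinate a ^ 2 + x ^ 2))) = 2 / (x ^ 2 + x ^ 2)"
      unfolding True[symmetric] using mult1 ord(1) by simp
    thus ?thesis by simp
  next
    case False
    hence "(\<Sum>a\<in>{ax, ay}. real (xi_mult a) * (2 / (ordinate a ^ 2 + x ^ 2))) = 2 / (x ^ 2 + x ^ 2) + 2 / (y ^ 2 + x ^ 2)"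
      using mult1 ord by simp
    thus ?thesis by (simp add: add.commute)
  qed
  finally show ?case using elim(1) 1 by (simp add: add_divide_distrib[symmetric]) 
qed

text \<open>Adding the bounds at both zeros gives 4/g1^2 + 4/g2^2 - 4 / (g1^2 + g2^2), and the last
  fraction is at most 1/g1^2 + 1/g2^2. One finite stage suffices because all terms are
  nonnegative.\<close>

lemma F_hat_sum_lower:
  assumes RH: Riemann_Hypothesis and g1: "simple_Z_zero g1" and g2: "simple_Z_zero g2" and ne: "g1 \<noteq> g2"
  shows "3 * (1 / g1 ^ 2 + 1 / g2 ^ 2) \<le> F_hat g1 / 3 + den_log_curvature g1 + F_hat g2 / 3 + den_log_curvature g2 - 2 / (g1 - g2) ^ 2"
proof -
  have z: "g1 \<in> Z_zeros" "Z_mult g1 = 1" "g2 \<in> Z_zeros" "Z_mult g2 = 1"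
    using g1 g2 by (auto simp: simple_Z_zero_def)
  have pos: "g1 ^ 2 > 0" "g2 ^ 2 > 0" using Z_zero_large[OF RH z(1)] Z_zero_large[OF RH z(3)] by linarith+
  obtain n where n: "4 / g1 ^ 2 - 2 / (g1 ^ 2 + g2 ^ 2) < (\<Sum>\<gamma>\<in>Z_zeros_upto n - {g1, g2}. of_int (Z_mult \<gamma>) / (\<gamma> - g1) ^ 2)"
    "4 / g2 ^ 2 - 2 / (g2 ^ 2 + g1 ^ 2) < (\<Sum>\<gamma>\<in>Z_zeros_upto n - {g2, g1}. of_int (Z_mult \<gamma>) / (\<gamma> - g2) ^ 2)"
    using eventually_conj[OF zero_sum_lower_part[OF RH z] zero_sum_lower_part[OF RH z(3,4) z(1,2)]]
    by (auto simp: eventually_sequentially)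
  have "4 / (u + v) \<le> 1 / u + 1 / v" if "u > 0" "v > 0" for u v :: real
  proof -
    have "4 * (u * v) \<le> (u + v) * (u + v)"
      using zero_le_power2[of "u - v"] by (simp add: power2_eq_square algebra_simps)
    hence "4 / (u + v) \<le> (u + v) / (u * v)" using that by (subst frac_le_iff) auto
    thus ?thesis using that by (simp add: field_simps)
  qed
  from this[OF pos] have "3 * (1 / g1 ^ 2 + 1 / g2 ^ 2) \<le> 
      (4 / g1 ^ 2 - 2 / (g1 ^ 2 + g2 ^ 2)) + (4 / g2 ^ 2 - 2 / (g2 ^ 2 + g1 ^ 2))" by (simp add: add.commute)
  also have "\<dots> \<le> sum (zero_term g1 g2) (Z_zeros_upto n - {g1, g2})"
    using n by (simp add: zero_term_def distrib_left sum.distrib insert_commute)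
  also have "\<dots> \<le> F_hat g1 / 3 + den_log_curvature g1 + F_hat g2 / 3 + den_log_curvature g2 - 2 / (g1 - g2) ^ 2"
  proof (rule has_sum_mono_neutral[OF has_sum_finite zero_term_has_sum[OF assms]])
    fix \<gamma> assume "\<gamma> \<in> (Z_zeros - {g1, g2}) - (Z_zeros_upto n - {g1, g2})"
    thus "0 \<le> zero_term g1 g2 \<gamma>" unfolding zero_term_def using Z_mult_nonneg[OF RH] by (intro mult_nonneg_nonneg) auto
  qed (use Z_zeros_upto_parts(4)[OF RH] in \<open>auto simp: Z_zeros_upto_def\<close>)
  finally show ?thesis .
qed

theorem theorem1:
  fixes \<gamma>\<^sub>1 \<gamma>\<^sub>2 :: real
  assumes "Riemann_Hypothesis"
    and "simple_Z_zero \<gamma>\<^sub>1" and "simple_Z_zero \<gamma>\<^sub>2" and "\<gamma>\<^sub>1 \<noteq> \<gamma>\<^sub>2"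
  shows "0 < g_bar \<gamma>\<^sub>1 \<gamma>\<^sub>2 - g_hat \<gamma>\<^sub>1 \<gamma>\<^sub>2
    \<and> g_bar \<gamma>\<^sub>1 \<gamma>\<^sub>2 - g_hat \<gamma>\<^sub>1 \<gamma>\<^sub>2
        < 3 * (\<gamma>\<^sub>1 - \<gamma>\<^sub>2)\<^sup>2 * (1 / \<gamma>\<^sub>1\<^sup>2 + 1 / \<gamma>\<^sub>2\<^sup>2)
    \<and> 3 * (\<gamma>\<^sub>1 - \<gamma>\<^sub>2)\<^sup>2 * (1 / \<gamma>\<^sub>1\<^sup>2 + 1 / \<gamma>\<^sub>2\<^sup>2) < 3 * g_hat \<gamma>\<^sub>1 \<gamma>\<^sub>2"
proof -
  define d where "d = (\<gamma>\<^sub>1 - \<gamma>\<^sub>2)\<^sup>2"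
  define l where "l = F_hat \<gamma>\<^sub>1 / 3 + den_log_curvature \<gamma>\<^sub>1 + F_hat \<gamma>\<^sub>2 / 3 + den_log_curvature \<gamma>\<^sub>2 - 2 / d"
  define i where "i = 1 / \<gamma>\<^sub>1\<^sup>2 + 1 / \<gamma>\<^sub>2\<^sup>2"
  define D where "D = den_log_curvature \<gamma>\<^sub>1 + den_log_curvature \<gamma>\<^sub>2"
  have d: "d > 0" using assms(4) by (simp add: d_def)
  have z: "\<gamma>\<^sub>1 \<in> Z_zeros" "\<gamma>\<^sub>2 \<in> Z_zeros" using assms(2,3) by (auto simp: simple_Z_zero_def)
  note large = Z_zero_large[OF assms(1) z(1)] Z_zero_large[OF assms(1) z(2)]
  have D: "0 < D" "D < 2 * i"
    using den_log_curvature_bounds[OF large(1)] den_log_curvature_bounds[OF large(2)] by (auto simp: D_def i_def)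
  have "\<gamma>\<^sub>1\<^sup>2 > 0" "\<gamma>\<^sub>2\<^sup>2 > 0" using large by linarith+
  hence i: "i > 0" unfolding i_def by (intro add_pos_pos divide_pos_pos) auto
  have "infsum (zero_term \<gamma>\<^sub>1 \<gamma>\<^sub>2) (Z_zeros - {\<gamma>\<^sub>1, \<gamma>\<^sub>2}) = l"
    unfolding l_def d_def by (rule infsumI[OF zero_term_has_sum[OF assms]])
  hence bar: "g_bar \<gamma>\<^sub>1 \<gamma>\<^sub>2 = d * l" unfolding g_bar_def zero_term_def d_def by simp
  have "d * l = g_hat \<gamma>\<^sub>1 \<gamma>\<^sub>2 + d * D"
    unfolding g_hat_def d_def[symmetric] l_def D_def using d by (simp add: field_simps)
  hence diff: "g_bar \<gamma>\<^sub>1 \<gamma>\<^sub>2 - g_hat \<gamma>\<^sub>1 \<gamma>\<^sub>2 = d * D" and hat: "g_hat \<gamma>\<^sub>1 \<gamma>\<^sub>2 = d * (l - D)"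
    by (simp_all add: bar right_diff_distrib)
  have l: "3 * i \<le> l" unfolding i_def l_def d_def by (rule F_hat_sum_lower[OF assms])
  \<comment> \<open>The third inequality closes the budget: l \<ge> 3 i and D < 2 i give l - D >
    i.\<close>
  have "0 < d * D" "d * D < d * (3 * i)" "d * (3 * i) < d * (3 * (l - D))"
    using d D i l by (auto intro!: mult_strict_left_mono)
  moreover have "d * (3 * i) = 3 * d * i" "d * (3 * (l - D)) = 3 * (d * (l - D))" by simp_all
  ultimately show ?thesis unfolding diff unfolding hat d_def[symmetric] i_def[symmetric] by (simp only: simp_thms)
qed

end
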